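(* For any countable compact space $X$, there exists a linear subspace $Y$ of $C([0,1])$ linearly isometric to $C(X)$ such that every nonzero $f \in Y$ is a Besicovitch function.
   Context: All topological spaces are assumed to be Hausdorff; in particular "compact space" means compact Hausdorff space. For a compact space $X$, $C(X)$ denotes the real normed space of continuous real-valued functions on $X$ with the supremum norm $\lVert \cdot \rVert$. "Nonzero function" means a function that is not identically zero. A continuous function $f \colon [a,b] \to \mathbb{R}$ ($a<b$) is called a Besicovitch function if it has no one-sided derivative, finite or infinite, at any point: for every $x \in (a,b]$ the left derivative $\lim_{t \to x^-} \frac{f(t)-f(x)}{t-x}$ does not exist in $[-\infty,+\infty]$, and for every $x \in [a,b)$ the right derivative $\lim_{t \to x^+} \frac{f(t)-f(x)}{t-x}$ does not exist in $[-\infty,+\infty]$. *)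

theory Defs
  imports "HOL-Analysis.Analysis" "HOL-Library.Function_Algebras"
begin

(* HOL-Library.Function_Algebras supplies pointwise 0, + and - on functions; this adds the
   pointwise scalar multiplication, so that the library's subspace applies to sets of functions. *)
instantiation "fun" :: (type, real_vector) real_vector
begin

definition scaleR_fun :: "real \<Rightarrow> ('a \<Rightarrow> 'b) \<Rightarrow> 'a \<Rightarrow> 'b" where
  "scaleR_fun c f = (\<lambda>x. c *\<^sub>R f x)"

instance
  by standard (simp_all add: scaleR_fun_def plus_fun_def fun_eq_iff algebra_simps)

end

(* A function on the carrier of X is represented by its extension by 0 to the whole type, so
   that equality in C(X) is equality of functions and the vector space operations are pointwise. *)
definition cont_fun_space :: "'a topology \<Rightarrow> ('a \<Rightarrow> real) set" where
  "cont_fun_space X =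
     {f. continuous_map X euclideanreal f \<and> (\<forall>x. x \<notin> topspace X \<longrightarrow> f x = 0)}"

(* The inserted 0 is redundant for nonempty X; it makes the norm 0 on the empty space, where
   Sup would otherwise be taken over the empty set of reals. *)
definition sup_norm :: "'a topology \<Rightarrow> ('a \<Rightarrow> real) \<Rightarrow> real" where
  "sup_norm X f = Sup (insert 0 ((\<lambda>x. \<bar>f x\<bar>) ` topspace X))"

definition linear_isometry_between ::
    "'a topology \<Rightarrow> ('a \<Rightarrow> real) set \<Rightarrow> 'b topology \<Rightarrow> ('b \<Rightarrow> real) set \<Rightarrow> (('a \<Rightarrow> real) \<Rightarrow> ('b \<Rightarrow> real)) \<Rightarrow> bool"
  where
  "linear_isometry_between X V Z W T \<longleftrightarrow>
     bij_betw T V W \<and>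
     (\<forall>f\<in>V. \<forall>g\<in>V. T (f + g) = T f + T g) \<and>
     (\<forall>c. \<forall>f\<in>V. T (c *\<^sub>R f) = c *\<^sub>R T f) \<and>
     (\<forall>f\<in>V. sup_norm Z (T f) = sup_norm X f)"

definition linearly_isometric ::
    "'a topology \<Rightarrow> ('a \<Rightarrow> real) set \<Rightarrow> 'b topology \<Rightarrow> ('b \<Rightarrow> real) set \<Rightarrow> bool" where
  "linearly_isometric X V Z W \<longleftrightarrow> (\<exists>T. linear_isometry_between X V Z W T)"

(* The limits are taken in ereal, so infinite one-sided derivatives are excluded as well. *)
definition besicovitch_function :: "real \<Rightarrow> real \<Rightarrow> (real \<Rightarrow> real) \<Rightarrow> bool" where
  "besicovitch_function a b f \<longleftrightarrow>
     a < b \<and> continuous_on {a..b} f \<and>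
     (\<forall>x\<in>{a<..b}. \<nexists>l::ereal. ((\<lambda>t. ereal ((f t - f x) / (t - x))) \<longlongrightarrow> l) (at_left x)) \<and>
     (\<forall>x\<in>{a..<b}. \<nexists>l::ereal. ((\<lambda>t. ereal ((f t - f x) / (t - x))) \<longlongrightarrow> l) (at_right x))"

abbreviation unit_interval :: "real topology" where
  "unit_interval \<equiv> top_of_set {0..1}"

end

theory Submission
  imports Defs
begin

text \<open>
  Let \<open>x\<^sub>0, x\<^sub>1, \<dots>\<close> enumerate \<open>X\<close>. The embedding sends \<open>f\<close> to \<open>t \<mapsto> \<langle>\<Phi>(t), f\<rangle>\<close>, where \<open>\<Phi>\<close> is a weak* continuous
  curve in the unit ball of \<open>\<ell>\<^sub>1(X)\<close> passing through every Dirac measure \<open>\<delta>\<^sub>x\<close>. It is built by recursion: on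
  an interval with base value \<open>c\<close>, it follows \<open>c + \<psi> w\<close> for a fixed profile \<open>\<psi> : [0,1] \<rightarrow> [0,1]\<close>, which is
  constant on each of a dense family of gaps; on a gap the construction starts again from the constant
  value reached there, in a new direction \<open>w\<close> pointing at some \<open>\<plusminus>\<delta>\<^sub>x\<close>.

  An infinite limit of the right difference quotients of \<open>F\<close> at \<open>t\<close> is excluded by a sequence of points at
  which they stay bounded; a finite one by loops \<open>t < a \<le> q \<le> b\<close> at arbitrarily small scales with \<open>F a = F b\<close>
  but \<open>\<bar>F q - F a\<bar> \<ge> c (b - t)\<close>. Loops towards all \<open>\<plusminus>\<delta>\<^sub>x\<close> occur at each \<open>t\<close> at
  arbitrarily small scales. Bounded quotients come from the profile being Lipschitz along a Cantor set of
  positive measure when the recursion stops at \<open>t\<close>. When it does not stop, they come from exact returns: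
  \<open>\<psi>\<close> takes the value of a gap again, on either side of it, at a distance no smaller than the amplitude
  permitted inside the gap. This forces \<open>\<psi>\<close> to have two layers, the excursions in the gaps of
  the outer staircase pointing back to values which the outer staircase still has to cross.

  The Dirac measures are reached by full jumps from \<open>\<delta>\<^sub>p\<close> to \<open>\<delta>\<^sub>x\<close>, where \<open>p\<close> is the best approximation of
  \<open>x\<close> among the points listed before it. An infinite chain of such jumps would converge to a listed point,
  which would have been a better choice of \<open>p\<close> eventually; this is where countability enters.
\<close>

section \<open>A criterion against one-sided derivatives, and continuity of sums of bumps\<close>

text \<open>A finite limit \<open>L\<close> makes \<open>F\<close> affine near \<open>t\<close> up
  to a small multiple of \<open>b - t\<close>. Equal values at \<open>a\<close> and \<open>b\<close>
  then force \<open>L * (b - a)\<close> to be small as well, so \<open>F\<close> is nearly constant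
  between them and cannot have a loop of size \<open>c * (b - t)\<close>.\<close>

lemma no_right_derivative:
  fixes F :: "real \<Rightarrow> real"
  assumes lip: "\<exists>C. \<forall>e>0. \<exists>s. t < s \<and> s < t + e \<and> \<bar>F s - F t\<bar> \<le> C * (s - t)"
    and loop: "\<exists>c>0. \<forall>e>0. \<exists>a q b. t < a \<and> a \<le> q \<and> q \<le> b \<and> b < t + e \<and> F a = F b
                 \<and> c * (b - t) \<le> \<bar>F q - F a\<bar>"
  shows "\<nexists>l::ereal. ((\<lambda>x. ereal ((F x - F t) / (x - t))) \<longlongrightarrow> l) (at_right t)"
proof
  assume "\<exists>l::ereal. ((\<lambda>x. ereal ((F x - F t) / (x - t))) \<longlongrightarrow> l) (at_right t)"
  then obtain l where l: "((\<lambda>x. ereal ((F x - F t) / (x - t))) \<longlongrightarrow> l) (at_right t)" by blast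
  obtain C where C: "\<And>e. e > 0 \<Longrightarrow> \<exists>s. t < s \<and> s < t + e \<and> \<bar>F s - F t\<bar> \<le> C * (s - t)"
    using lip by blast
  have far: "\<exists>s. (F s - F t) / (s - t) \<le> C \<and> - C \<le> (F s - F t) / (s - t) \<and> P s" if P: "eventually P (at_right t)" for P
  proof -
    obtain b where b: "b > t" "\<And>y. t < y \<Longrightarrow> y < b \<Longrightarrow> P y"
      using P unfolding eventually_at_right_field by blast
    obtain s where s: "t < s" "s < t + (b - t)" "\<bar>F s - F t\<bar> \<le> C * (s - t)"
      using C[of "b - t"] b(1) by auto
    then have "\<bar>(F s - F t) / (s - t)\<bar> \<le> C" by (simp add: pos_divide_le_eq)
    then have "(F s - F t) / (s - t) \<le> C \<and> - C \<le> (F s - F t) / (s - t) \<and> P s"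
      using s b by (metis abs_le_iff minus_le_iff add_diff_cancel_left' add_diff_eq)
    then show ?thesis by blast
  qed
  show False
  proof (cases l)
    case (real L)
    then have L: "((\<lambda>x. (F x - F t) / (x - t)) \<longlongrightarrow> L) (at_right t)" using l by simp
    obtain c where c: "c > 0" and lp: "\<And>e. e > 0 \<Longrightarrow> \<exists>a q b. t < a \<and> a \<le> q \<and> q \<le> b \<and>
        b < t + e \<and> F a = F b \<and> c * (b - t) \<le> \<bar>F q - F a\<bar>" using loop by blast
    \<comment> \<open>The final estimate collects four errors of size
      \<open>c / 8 * (b - t)\<close>: two from the endpoints of the loop, two from the points
      \<open>q\<close> and \<open>a\<close>. Their sum is half of the required
      \<open>c * (b - t)\<close>.\<close>
    have "eventually (\<lambda>x. dist ((F x - F t) / (x - t)) L < c / 8) (at_right t)"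
      by (rule tendstoD[OF L]) (use c in simp)
    then obtain b0 where b0: "b0 > t"
      and close: "\<And>y. t < y \<Longrightarrow> y < b0 \<Longrightarrow> dist ((F y - F t) / (y - t)) L < c / 8"
      unfolding eventually_at_right_field by blast
    obtain a q b where ab: "t < a" "a \<le> q" "q \<le> b" "b < t + (b0 - t)" "F a = F b"
      "c * (b - t) \<le> \<bar>F q - F a\<bar>" using lp[of "b0 - t"] b0 by auto
    have lin: "\<bar>F y - F t - L * (y - t)\<bar> \<le> c / 8 * (b - t)" if "t < y" "y \<le> b" for y
    proof -
      have "F y - F t - L * (y - t) = ((F y - F t) / (y - t) - L) * (y - t)"
        using that by (simp add: field_simps)
      then have "\<bar>F y - F t - L * (y - t)\<bar> = dist ((F y - F t) / (y - t)) L * (y - t)"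
        using that by (simp add: dist_real_def abs_mult)
      also have "\<dots> \<le> c / 8 * (b - t)"
        using close[of y] that ab c by (intro mult_mono) auto
      finally show ?thesis .
    qed
    have 1: "\<bar>L * (b - a)\<bar> \<le> 2 * (c / 8 * (b - t))"
    proof -
      have "L * (b - a) = (F a - F t - L * (a - t)) - (F b - F t - L * (b - t))"
        using ab(5) by (simp add: algebra_simps)
      then show ?thesis using lin[of a] lin[of b] ab(1-3) by argo
    qed
    have 2: "\<bar>L * (q - a)\<bar> \<le> \<bar>L * (b - a)\<bar>"
      using ab by (simp add: abs_mult mult_left_mono)
    have "F q - F a = (F q - F t - L * (q - t)) - (F a - F t - L * (a - t)) + L * (q - a)"
      by (simp add: algebra_simps)
    then have "\<bar>F q - F a\<bar> \<le> 4 * (c / 8 * (b - t))"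
      using lin[of q] lin[of a] ab 1 2 by linarith
    moreover have "0 < c * (b - t)" using c ab by simp
    ultimately show False using ab(6) by simp
  next
    case PInf
    then have "eventually (\<lambda>x. ereal ((F x - F t) / (x - t)) > ereal C) (at_right t)"
      using l by (intro order_tendstoD) auto
    from far[OF this] show False by fastforce
  next
    case MInf
    then have "eventually (\<lambda>x. ereal ((F x - F t) / (x - t)) < ereal (- C)) (at_right t)"
      using l by (intro order_tendstoD) auto
    from far[OF this] show False by fastforce
  qed
qed

text \<open>Since only finitely many bumps exceed any given size and their supports are disjoint,
  the finite sums of large bumps converge uniformly to \<open>B\<close>. It serves both for the
  truncated curves and for the profile.\<close>

lemma continuous_on_bump_sum:
  fixes \<beta> :: "'i \<Rightarrow> real \<Rightarrow> real" and lo hi \<eta> :: "'i \<Rightarrow> real"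
  assumes cont: "\<And>j. j \<in> G \<Longrightarrow> continuous_on {lo j..hi j} (\<beta> j)"
    and ends: "\<And>j. j \<in> G \<Longrightarrow> lo j < hi j \<and> \<beta> j (lo j) = 0 \<and> \<beta> j (hi j) = 0"
    and bound: "\<And>j u. j \<in> G \<Longrightarrow> lo j < u \<Longrightarrow> u < hi j \<Longrightarrow> \<bar>\<beta> j u\<bar> \<le> \<eta> j"
    and fin: "\<And>e. e > 0 \<Longrightarrow> finite {j \<in> G. \<eta> j \<ge> e}"
    and on_gap: "\<And>j u. j \<in> G \<Longrightarrow> lo j < u \<Longrightarrow> u < hi j \<Longrightarrow> B u = \<beta> j u"
    and off_gap: "\<And>u. u \<in> S \<Longrightarrow> (\<And>j. j \<in> G \<Longrightarrow> \<not> (lo j < u \<and> u < hi j)) \<Longrightarrow> B u = 0"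
    and disj: "\<And>i j u. i \<in> G \<Longrightarrow> j \<in> G \<Longrightarrow> lo i < u \<Longrightarrow> u < hi i \<Longrightarrow> lo j < u \<Longrightarrow> u < hi j \<Longrightarrow> i = j"
  shows "continuous_on S B"
proof -
  \<comment> \<open>Each bump vanishes at both ends of its gap, so composing it with the clamping
    map is its continuous extension by zero.\<close>
  define clip where "clip j u = max (lo j) (min (hi j) u)" for j u
  have piece: "continuous_on S (\<lambda>u. \<beta> j (clip j u))" if j: "j \<in> G" for j
  proof (rule continuous_on_compose2[OF cont[OF j]])
    show "continuous_on S (clip j)" unfolding clip_def by (intro continuous_intros)
    show "clip j ` S \<subseteq> {lo j..hi j}" using ends[OF j] by (auto simp: clip_def)
  qed
  have val: "\<beta> j (clip j u) = (if lo j < u \<and> u < hi j then \<beta> j u else 0)" if j: "j \<in> G" for j u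
    using ends[OF j] by (auto simp: clip_def min_def max_def)
  define R where "R n u = (\<Sum>j\<in>{j \<in> G. \<eta> j \<ge> inverse (real (Suc n))}. \<beta> j (clip j u))" for n u
  have Rcont: "continuous_on S (R n)" for n
    unfolding R_def by (intro continuous_on_sum piece) auto
  have near: "\<bar>R n u - B u\<bar> \<le> inverse (real (Suc n))" if u: "u \<in> S" for n u
  proof (cases "\<exists>j\<in>G. lo j < u \<and> u < hi j")
    case True
    then obtain j where j: "j \<in> G" "lo j < u" "u < hi j" by blast
    have other: "\<beta> i (clip i u) = 0" if "i \<in> G" "i \<noteq> j" for i
      using val[OF that(1)] disj[OF that(1) j(1)] that j by auto
    have "R n u = (\<Sum>i\<in>{i \<in> G. \<eta> i \<ge> inverse (real (Suc n))}. if i = j then \<beta> j u else 0)"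
      unfolding R_def by (rule sum.cong) (use other val j in auto)
    also have "\<dots> = (if \<eta> j \<ge> inverse (real (Suc n)) then \<beta> j u else 0)"
      using fin[of "inverse (real (Suc n))"] j by (simp add: sum.delta)
    finally show ?thesis using on_gap[OF j] bound[OF j] by auto
  next
    case False
    then have "R n u = 0" unfolding R_def by (intro sum.neutral) (auto simp: val)
    moreover have "B u = 0" using False u by (intro off_gap) auto
    ultimately show ?thesis by simp
  qed
  have "uniform_limit S R B sequentially"
  proof (rule uniform_limitI)
    fix e :: real assume "e > 0"
    then obtain N where N: "inverse (real (Suc N)) < e" using reals_Archimedean by blast
    show "\<forall>\<^sub>F n in sequentially. \<forall>x\<in>S. dist (R n x) (B x) < e"
    proof (rule eventually_sequentiallyI[of N], intro ballI)
      fix n u assume "n \<ge> N" and u: "u \<in> S"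
      then have "inverse (real (Suc n)) \<le> inverse (real (Suc N))" by (simp add: field_simps)
      with near[OF u, of n] N show "dist (R n u) (B u) < e" unfolding dist_real_def by argo
    qed
  qed
  then show ?thesis
    by (rule uniform_limit_theorem[rotated]) (auto intro: always_eventually Rcont)
qed

text \<open>A node of the recursion carries its depth, an index \<open>k\<close> if its base value is exactly \<open>\<delta>\<close> at \<open>x\<^sub>k\<close>, the
  amplitude allowed for its excursion, its length as a subinterval of \<open>[0,1]\<close>, and a target: the numbers
  \<open>2 e\<close> and \<open>2 e + 1\<close> stand for \<open>\<delta>\<close> and \<open>-\<delta>\<close> at \<open>x\<^sub>e\<close>. A function on \<open>X\<close> is represented by the sequence
  \<open>v\<close> of its values at the \<open>x\<^sub>e\<close>.\<close>

datatype node = Node (lev: nat) (flag: "nat option") (amp: real) (len: real) (goal: nat)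

definition aim :: "nat \<Rightarrow> (nat \<Rightarrow> real) \<Rightarrow> real" where
  "aim d v = (if even d then v (d div 2) else - v (d div 2))"

text \<open>Here \<open>h\<close> is the amplitude permitted inside a gap relative to the length of the surrounding interval.
  In the gaps of \<open>Z0\<close> and \<open>Z1\<close> an exact base is kept or replaced by the target of the jump. Everything is
  stated to the right of a point only, since \<open>mir\<close> reflects the gaps.\<close>

locale gap_profile =
  fixes \<psi> :: "real \<Rightarrow> real" and G :: "'i set" and lo hi \<theta> h :: "'i \<Rightarrow> real"
    and tgt :: "'i \<Rightarrow> nat" and Z0 Z1 :: "'i set" and mir :: "'i \<Rightarrow> 'i"
  assumes psi_cont: "continuous_on {0..1} \<psi>"
    and psi_range: "0 \<le> u \<Longrightarrow> u \<le> 1 \<Longrightarrow> 0 \<le> \<psi> u \<and> \<psi> u \<le> 1"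
    and psi_0: "\<psi> 0 = 0"
    and psi_sym: "0 \<le> u \<Longrightarrow> u \<le> 1 \<Longrightarrow> \<psi> (1 - u) = \<psi> u"
    and gap: "j \<in> G \<Longrightarrow> 0 < lo j \<and> lo j < hi j \<and> hi j < 1"
    and psi_gap: "j \<in> G \<Longrightarrow> lo j \<le> u \<Longrightarrow> u \<le> hi j \<Longrightarrow> \<psi> u = \<theta> j"
    and disj: "i \<in> G \<Longrightarrow> j \<in> G \<Longrightarrow> lo i \<le> u \<Longrightarrow> u < hi i \<Longrightarrow> lo j \<le> u \<Longrightarrow> u < hi j \<Longrightarrow> i = j"
    and mirror: "j \<in> G \<Longrightarrow> mir j \<in> G \<and> lo (mir j) = 1 - hi j \<and> hi (mir j) = 1 - lo j \<and>
                  \<theta> (mir j) = \<theta> j \<and> h (mir j) = h j \<and> tgt (mir j) = tgt j"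
    and mirror_Z: "j \<in> G \<Longrightarrow> (mir j \<in> Z0 \<longleftrightarrow> j \<in> Z0) \<and> (mir j \<in> Z1 \<longleftrightarrow> j \<in> Z1)"
    and h_bounds: "j \<in> G \<Longrightarrow> hi j - lo j \<le> h j \<and> h j \<le> 1/4"
    and h_fin: "e > 0 \<Longrightarrow> finite {j \<in> G. h j \<ge> e}"
    and Z_sub: "Z0 \<subseteq> G" "Z1 \<subseteq> G"
    and Z_fin: "finite Z0" "finite Z1"
    and Z_ne: "Z0 \<noteq> {}" "Z1 \<noteq> {}"
    and Z0: "j \<in> Z0 \<Longrightarrow> \<theta> j = 0"
    and Z1: "j \<in> Z1 \<Longrightarrow> \<theta> j = 1"
    and ret: "j \<in> G \<Longrightarrow> \<exists>s. hi j + h j \<le> s \<and> s \<le> 1 \<and> (\<forall>i\<in>G. \<not> (lo i < s \<and> s < hi i)) \<and> \<psi> s = \<theta> j"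
    and lip: "0 \<le> u \<Longrightarrow> u < 1 \<Longrightarrow> (\<And>j. j \<in> G \<Longrightarrow> \<not> (lo j \<le> u \<and> u < hi j)) \<Longrightarrow>
       \<exists>C. \<forall>e>0. \<exists>s. u < s \<and> s < u + e \<and> s \<le> 1 \<and> (\<forall>i\<in>G. \<not> (lo i < s \<and> s < hi i)) \<and>
           \<bar>\<psi> s - \<psi> u\<bar> \<le> C * (s - u)"
    and near: "0 \<le> u \<Longrightarrow> u < 1 \<Longrightarrow> (\<And>j. j \<in> G \<Longrightarrow> \<not> (lo j \<le> u \<and> u < hi j)) \<Longrightarrow>
       \<exists>C>0. \<forall>e>0. \<exists>j\<in>G - (Z0 \<union> Z1). tgt j = d \<and> u < lo j \<and> hi j < u + e \<and> hi j - u \<le> C * h j"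
    and nbr: "\<exists>C>0. \<forall>j\<in>G. \<exists>i\<in>G - (Z0 \<union> Z1). tgt i = d \<and> hi j \<le> lo i \<and> hi i - lo j \<le> C * h i"
begin

lemma theta_range: "j \<in> G \<Longrightarrow> 0 \<le> \<theta> j \<and> \<theta> j \<le> 1"
  using psi_range[of "lo j"] psi_gap[of j "lo j"] gap[of j] by auto

lemma h_pos: "j \<in> G \<Longrightarrow> 0 < h j"
  using h_bounds[of j] gap[of j] by auto

lemma len_pos: "j \<in> G \<Longrightarrow> 0 < hi j - lo j"
  using gap[of j] by auto

lemma psi_1: "\<psi> 1 = 0"
  using psi_sym[of 0] psi_0 by simp

text \<open>Only the interiors of gaps are excluded: at the ends of a gap the formula with \<psi>
  and the recursion inside the gap give the same value.\<close>

definition free :: "real \<Rightarrow> bool" where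
  "free u \<longleftrightarrow> (\<forall>j\<in>G. \<not> (lo j < u \<and> u < hi j))"

lemma gap_unique:
  "i \<in> G \<Longrightarrow> j \<in> G \<Longrightarrow> lo i < u \<Longrightarrow> u < hi i \<Longrightarrow> lo j < u \<Longrightarrow> u < hi j \<Longrightarrow> i = j"
  using disj[of i j u] by auto

lemma free_lo: assumes "j \<in> G" shows "free (lo j)"
  unfolding free_def
proof (intro ballI notI)
  fix i assume "i \<in> G" "lo i < lo j \<and> lo j < hi i"
  then show False using disj[of i j "lo j"] gap[of j] assms by auto
qed

lemma free_reflect: assumes "free u" shows "free (1 - u)"
  unfolding free_def
proof (intro ballI notI)
  fix j assume j: "j \<in> G" "lo j < 1 - u \<and> 1 - u < hi j"
  then have "lo (mir j) < u \<and> u < hi (mir j)" using mirror[of j] by auto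
  then show False using assms j mirror[of j] unfolding free_def by auto
qed

text \<open>Disjointness of half-open gaps settles left endpoints only; the reflection turns a right
  endpoint into a left one.\<close>

lemma free_hi: assumes "j \<in> G" shows "free (hi j)"
  using free_reflect[OF free_lo[of "mir j"]] mirror[OF assms] by simp

lemma free_0: "free 0" and free_1: "free 1"
  unfolding free_def using gap by (auto simp: not_less less_imp_le)

end

section \<open>Refining partitions of the points, and the parent of an index\<close>

text \<open>This abstracts a sequence of ever finer partitions of \<open>X\<close> into finitely
  many clopen cells, with \<open>E m i j\<close> meaning that the points with indices
  \<open>i\<close> and \<open>j\<close> share a cell at stage \<open>m\<close>. \<open>E_fin\<close>
  comes from the finiteness of each partition, \<open>E_cluster\<close> from compactness together
  with the fact that the cluster point is itself listed.\<close>

locale agreement =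
  fixes E :: "nat \<Rightarrow> nat \<Rightarrow> nat \<Rightarrow> bool"
  assumes E_refl: "E m i i"
    and E_sym: "E m i j \<Longrightarrow> E m j i"
    and E_trans: "E m i j \<Longrightarrow> E m j k \<Longrightarrow> E m i k"
    and E_mono: "E m i j \<Longrightarrow> m' \<le> m \<Longrightarrow> E m' i j"
    and E_fin: "\<exists>N. \<forall>n\<ge>N. \<exists>i<n. E m i n"
    and E_cluster: "\<And>f :: nat \<Rightarrow> nat. \<exists>j. \<forall>m. infinite {n. E m (f n) j}"
begin

text \<open>Choosing the least among the best approximating indices is what rules out infinite chains
  of parents.\<close>

definition parent :: "nat \<Rightarrow> nat" where
  "parent n = (LEAST j. j < n \<and> (\<forall>i<n. \<forall>m. E m i n \<longrightarrow> E m j n))"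

text \<open>By \<open>E_mono\<close> these sets of stages are initial segments of the naturals,
  hence nested.\<close>

lemma agree_linear: "{m. E m i n} \<subseteq> {m. E m j n} \<or> {m. E m j n} \<subseteq> {m. E m i n}"
proof (rule disjCI, rule subsetI, rule ccontr)
  fix a assume "\<not> {m. E m j n} \<subseteq> {m. E m i n}" and a: "a \<in> {m. E m i n}" "a \<notin> {m. E m j n}"
  then obtain b where b: "E b j n" "\<not> E b i n" by auto
  show False using a b E_mono[of a i n b] E_mono[of b j n a] by (cases "a \<le> b") auto
qed

text \<open>Among finitely many nested sets a maximal one is the greatest.\<close>

lemma best_exists: assumes "n > 0"
  shows "\<exists>j. j < n \<and> (\<forall>i<n. \<forall>m. E m i n \<longrightarrow> E m j n)"
proof -
  have "finite ((\<lambda>i. {m. E m i n}) ` {..<n})" "(\<lambda>i. {m. E m i n}) ` {..<n} \<noteq> {}"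
    using assms by auto
  from finite_has_maximal[OF this] obtain j where j: "j < n"
    and max: "\<And>i. i < n \<Longrightarrow> {m. E m j n} \<subseteq> {m. E m i n} \<Longrightarrow> {m. E m j n} = {m. E m i n}" by auto
  have "{m. E m i n} \<subseteq> {m. E m j n}" if "i < n" for i
    using agree_linear[of i n j] max[OF that] by auto
  then show ?thesis using j by blast
qed

lemma parent_less: "n > 0 \<Longrightarrow> parent n < n"
  and parent_best: "i < n \<Longrightarrow> E m i n \<Longrightarrow> E m (parent n) n"
proof -
  show "parent n < n" if "n > 0"
    using LeastI_ex[OF best_exists[OF that]] unfolding parent_def by blast
  show "E m (parent n) n" if "i < n" "E m i n"
    using LeastI_ex[OF best_exists[of n]] that unfolding parent_def by auto
qed

text \<open>An index below the parent that agreed with \<open>n\<close> as long as the parent does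
  would also be a best approximation, against the choice of the least one.\<close>

lemma parent_least:
  assumes "n > 0" "j < parent n" shows "\<exists>m. E m (parent n) n \<and> \<not> E m j n"
proof (rule ccontr)
  assume "\<not> ?thesis"
  then have "j < n \<and> (\<forall>i<n. \<forall>m. E m i n \<longrightarrow> E m j n)"
    using parent_best[of _ n] parent_less[OF assms(1)] assms(2) by (meson less_trans)
  then show False using assms(2) not_less_Least unfolding parent_def by blast
qed

text \<open>From some depth on a jump stays inside one cell of stage \<open>m\<close>, so it changes
  the values of a continuous function only a little.\<close>

lemma parent_eventually: "\<exists>N. \<forall>n\<ge>N. n > 0 \<longrightarrow> E m (parent n) n"
  using E_fin[of m] parent_best by meson

text \<open>If jumps went on forever, the visited indices would cluster at some listed
  \<open>j\<close>. Once they exceed \<open>j\<close>, every jump separates \<open>n\<close> from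
  \<open>j\<close> at a stage where \<open>n\<close> and its parent still agree, so jumping no
  longer changes how long the current index agrees with \<open>j\<close>. That length is finite,
  which contradicts clustering.\<close>

lemma parent_chain_stops:
  fixes k :: "nat \<Rightarrow> nat"
  assumes step: "\<And>n. k (Suc n) = k n \<or> n > 0 \<and> k (Suc n) = n \<and> k n = parent n"
  shows "\<exists>N. \<forall>n\<ge>N. k (Suc n) = k n"
proof (rule ccontr)
  assume "\<not> ?thesis"
  then have ex: "\<exists>n\<ge>N. k (Suc n) \<noteq> k n" for N by auto
  have incr: "k n \<le> k (Suc n)" for n using step[of n] parent_less[of n] by auto
  have mono: "k a \<le> k b" if "a \<le> b" for a b using lift_Suc_mono_le[of k] incr that by blast
  obtain j where j: "\<And>m. infinite {n. E m (k n) j}" using E_cluster[of k] by blast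
  obtain n0 where n0: "n0 \<ge> Suc j" "k (Suc n0) \<noteq> k n0" using ex by blast
  then have k0: "k (Suc n0) = n0" "n0 > j" using step[of n0] by auto
  \<comment> \<open>The stages where \<open>j\<close> agrees with either end of the jump lie below a
    stage \<open>m\<close> at which both ends agree with each other, so the two ends agree with
    \<open>j\<close> at the same stages.\<close>
  have same: "E b j (k n) \<longleftrightarrow> E b j (k (Suc n))" if n: "n \<ge> Suc n0" for n b
  proof (cases "k (Suc n) = k n")
    case False
    then have p: "n > 0" "k (Suc n) = n" "k n = parent n" using step[of n] by auto
    have "j < parent n" using mono[OF n] k0 p by simp
    then obtain m where m: "E m (parent n) n" "\<not> E m j n" using parent_least p(1) by blast
    have small: "b < m" if "E b j (parent n) \<or> E b j n"
    proof (rule ccontr)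
      assume "\<not> b < m"
      then have "E m j (parent n) \<or> E m j n" using that E_mono[of b] by auto
      then show False using m E_trans by blast
    qed
    then have "E b (parent n) n" if "E b j (parent n) \<or> E b j n"
      using that m(1) E_mono[of m "parent n" n b] by (meson less_imp_le)
    then show ?thesis using p E_trans E_sym by metis
  qed simp
  have const: "E b j (k n) \<longleftrightarrow> E b j (k (Suc n0))" if "n \<ge> Suc n0" for n b
    using that
  proof (induction n rule: dec_induct)
    case (step n)
    then show ?case using same[of n b] by blast
  qed simp
  \<comment> \<open>One further jump exhibits a stage at which the current index differs from
    \<open>j\<close>; by constancy this holds from \<open>Suc n0\<close> on.\<close>
  obtain n where n: "n \<ge> Suc n0" "k (Suc n) \<noteq> k n" using ex by blast
  then have p: "n > 0" "k (Suc n) = n" "k n = parent n" using step[of n] by auto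
  have "j < parent n" using mono[OF n(1)] k0 p by simp
  then obtain m where m: "\<not> E m j n" using parent_least p(1) by blast
  have "\<not> E m j (k (Suc n))" using p m by simp
  then have "\<not> E m j (k i)" if "i \<ge> Suc n0" for i
    using const[OF that, of m] const[of "Suc n" m] n(1) by auto
  then have "{n. E m (k n) j} \<subseteq> {..<Suc n0}"
    using E_sym by (force simp: not_less[symmetric])
  then show False using j[of m] finite_subset by blast
qed

end

section \<open>The curve associated with a gap profile\<close>

locale gap_embedding = gap_profile \<psi> G lo hi \<theta> h tgt Z0 Z1 mir + agreement E
  for \<psi> :: "real \<Rightarrow> real" and G :: "'i set" and lo hi \<theta> h :: "'i \<Rightarrow> real"
    and tgt :: "'i \<Rightarrow> nat" and Z0 Z1 :: "'i set" and mir :: "'i \<Rightarrow> 'i"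
    and E :: "nat \<Rightarrow> nat \<Rightarrow> nat \<Rightarrow> bool"
begin

text \<open>The depth doubles as the index of the point to be reached: a jump to the point with
  index \<open>n\<close> happens only at depth \<open>n\<close>, and only from a base that is
  exactly at the parent of \<open>n\<close>.\<close>

definition jumps :: "node \<Rightarrow> bool" where
  "jumps s \<longleftrightarrow> lev s > 0 \<and> flag s = Some (parent (lev s))"

text \<open>This is the displacement \<open>w\<close> of the overview, paired with the function
  \<open>v\<close>. A jump covers the whole distance, regardless of the amplitude; any other node
  covers only the fraction \<open>amp s\<close> of the way to its target.\<close>

definition step :: "(nat \<Rightarrow> real) \<Rightarrow> node \<Rightarrow> real \<Rightarrow> real" where
  "step v s c = (if jumps s then v (lev s) - c else amp s * (aim (goal s) v - c))"

definition child :: "node \<Rightarrow> 'i \<Rightarrow> node" where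
  "child s j = Node (Suc (lev s))
     (if j \<in> Z0 then flag s else if j \<in> Z1 \<and> jumps s then Some (lev s) else None)
     (h j * len s) ((hi j - lo j) * len s) (tgt j)"

definition root :: node where "root = Node 0 (Some 0) 1 1 0"

text \<open>The recursion is cut off at depth \<open>N\<close>, where excursions are replaced by the
  constant base value. The argument \<open>u\<close> is the coordinate inside the node, so each gap
  is rescaled to the unit interval.\<close>

fun approx :: "nat \<Rightarrow> (nat \<Rightarrow> real) \<Rightarrow> node \<Rightarrow> real \<Rightarrow> real \<Rightarrow> real" where
  "approx 0 v s c u = c"
| "approx (Suc N) v s c u =
     (if free u then c + \<psi> u * step v s c
      else let j = THE j. j \<in> G \<and> lo j < u \<and> u < hi j
           in approx N v (child s j) (c + \<theta> j * step v s c) ((u - lo j) / (hi j - lo j)))"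

definition curve :: "(nat \<Rightarrow> real) \<Rightarrow> node \<Rightarrow> real \<Rightarrow> real \<Rightarrow> real" where
  "curve v s c u = lim (\<lambda>N. approx N v s c u)"

text \<open>The invariant of the recursion. The factor 2 accommodates the root as well as children,
  whose amplitude is at most a quarter of the length of their parent node; the last clause says that
  flagged bases are exact.\<close>

definition sound :: "(nat \<Rightarrow> real) \<Rightarrow> real \<Rightarrow> node \<Rightarrow> real \<Rightarrow> bool" where
  "sound v B s c \<longleftrightarrow> (\<forall>e. \<bar>v e\<bar> \<le> B) \<and> \<bar>c\<bar> \<le> B \<and> 0 \<le> amp s \<and> amp s \<le> 1 \<and>
     amp s \<le> 2 * (1/2) ^ lev s \<and> 0 < len s \<and> len s \<le> (1/2) ^ lev s \<and>
     (\<forall>k. flag s = Some k \<longrightarrow> c = v k)"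

text \<open>Uniform continuity with respect to the refining partitions; every continuous function on
  \<open>X\<close> yields such a sequence.\<close>

definition admissible :: "(nat \<Rightarrow> real) \<Rightarrow> bool" where
  "admissible v \<longleftrightarrow> (\<forall>e>0. \<exists>m. \<forall>i j. E m i j \<longrightarrow> \<bar>v i - v j\<bar> \<le> e)"

section \<open>Bounds, convergence and continuity of the truncated curves\<close>

lemma approx_free: "free u \<Longrightarrow> approx (Suc N) v s c u = c + \<psi> u * step v s c"
  by simp

lemma approx_gap:
  assumes "j \<in> G" "lo j < u" "u < hi j"
  shows "approx (Suc N) v s c u =
    approx N v (child s j) (c + \<theta> j * step v s c) ((u - lo j) / (hi j - lo j))"
proof -
  have "(THE j. j \<in> G \<and> lo j < u \<and> u < hi j) = j"
    using gap_unique assms by (intro the_equality) auto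
  moreover have "\<not> free u" using assms unfolding free_def by blast
  ultimately show ?thesis by simp
qed

lemma rescale_range:
  assumes "j \<in> G" "lo j \<le> u" "u \<le> hi j"
  shows "0 \<le> (u - lo j) / (hi j - lo j)" "(u - lo j) / (hi j - lo j) \<le> 1"
  using assms gap[of j] by (auto simp: divide_simps)

lemma approx_ends: "approx N v s c 0 = c" "approx N v s c 1 = c"
  by (cases N; simp add: free_0 free_1 psi_0 psi_1)+

lemma abs_convex:
  fixes c y x t e :: real
  assumes "\<bar>c - x\<bar> \<le> e" "\<bar>y - x\<bar> \<le> e" "0 \<le> t" "t \<le> 1"
  shows "\<bar>c + t * (y - c) - x\<bar> \<le> e"
proof -
  have "c + t * (y - c) - x = (1 - t) * (c - x) + t * (y - x)" by (simp add: algebra_simps)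
  also have "\<bar>\<dots>\<bar> \<le> (1 - t) * \<bar>c - x\<bar> + t * \<bar>y - x\<bar>"
    using assms by (intro order.trans[OF abs_triangle_ineq]) (simp add: abs_mult)
  also have "\<dots> \<le> (1 - t) * e + t * e"
    using assms by (intro add_mono mult_left_mono) auto
  finally show ?thesis by (simp add: algebra_simps)
qed

lemma abs_aim: "(\<And>e. \<bar>v e\<bar> \<le> B) \<Longrightarrow> \<bar>aim d v\<bar> \<le> B"
  unfolding aim_def by auto

text \<open>Both kinds of move run along a segment from \<open>c\<close> towards a value of absolute
  value at most \<open>B\<close>. Hence the embedding does not increase the norm.\<close>

lemma sound_step:
  assumes "sound v B s c" "0 \<le> t" "t \<le> 1"
  shows "\<bar>c + t * step v s c\<bar> \<le> B"
proof -
  have "\<bar>aim (goal s) v\<bar> \<le> B" using assms(1) by (intro abs_aim) (auto simp: sound_def)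
  then have "\<bar>c + t * amp s * (aim (goal s) v - c)\<bar> \<le> B" "\<bar>c + t * (v (lev s) - c)\<bar> \<le> B"
    using abs_convex[of c 0 B "aim (goal s) v" "t * amp s"] abs_convex[of c 0 B "v (lev s)" t] assms
    by (auto simp: sound_def mult_le_one)
  then show ?thesis by (simp add: step_def mult.assoc)
qed

lemma sound_nonneg: "sound v B s c \<Longrightarrow> 0 \<le> B"
  unfolding sound_def using abs_ge_zero order_trans by blast

lemma step_small:
  assumes "sound v B s c" "\<not> jumps s" shows "\<bar>step v s c\<bar> \<le> 2 * B * amp s"
proof -
  have "\<bar>aim (goal s) v\<bar> \<le> B" "\<bar>c\<bar> \<le> B"
    using assms(1) by (auto simp: sound_def intro: abs_aim)
  then have "\<bar>aim (goal s) v - c\<bar> \<le> 2 * B" by linarith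
  then have "amp s * \<bar>aim (goal s) v - c\<bar> \<le> amp s * (2 * B)"
    using assms(1) by (intro mult_left_mono) (auto simp: sound_def)
  then show ?thesis using assms by (simp add: step_def abs_mult sound_def mult_ac)
qed

lemma child_sel [simp]:
  "lev (child s j) = Suc (lev s)"
  "amp (child s j) = h j * len s"
  "len (child s j) = (hi j - lo j) * len s"
  "goal (child s j) = tgt j"
  "flag (child s j) = (if j \<in> Z0 then flag s else if j \<in> Z1 \<and> jumps s then Some (lev s) else None)"
  by (simp_all add: child_def)

lemma sound_child:
  assumes s: "sound v B s c" and j: "j \<in> G"
  shows "sound v B (child s j) (c + \<theta> j * step v s c)"
proof -
  have l: "0 < len s" "len s \<le> (1/2) ^ lev s" using s by (auto simp: sound_def)
  have l1: "len s \<le> 1" using l(2) power_le_one[of "1/2::real" "lev s"] by linarith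
  have hj: "0 < h j" "h j \<le> 1/4" "hi j - lo j \<le> h j" "0 < hi j - lo j"
    using h_bounds[OF j] h_pos[OF j] len_pos[OF j] by auto
  have a: "h j * len s \<le> 1/4 * len s" using hj l by (intro mult_right_mono) auto
  have b: "(hi j - lo j) * len s \<le> 1/4 * len s" using hj l by (intro mult_right_mono) auto
  have bounds: "h j * len s \<le> 1" "h j * len s \<le> (1/2) ^ lev s"
      "(hi j - lo j) * len s * 2 \<le> (1/2) ^ lev s"
    using a b l l1 by linarith+
  \<comment> \<open>In \<open>Z0\<close> nothing has been added to the base; in \<open>Z1\<close> a
    full jump has been completed, so the base is \<open>v (lev s)\<close> exactly.\<close>
  have f: "c + \<theta> j * step v s c = v k" if "flag (child s j) = Some k" for k
    using that s Z0[of j] Z1[of j] by (auto simp: sound_def step_def split: if_splits)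
  have "0 \<le> amp (child s j)" "0 < len (child s j)" using hj l by simp_all
  moreover have "\<bar>c + \<theta> j * step v s c\<bar> \<le> B"
    using sound_step[OF s, of "\<theta> j"] theta_range[OF j] by blast
  moreover have "\<forall>e. \<bar>v e\<bar> \<le> B" using s by (simp add: sound_def)
  ultimately show ?thesis unfolding sound_def using f bounds by auto
qed

text \<open>The second bound makes estimates by \<open>amp + len\<close> close under recursion:
  everything inside a gap is paid for by the length of the surrounding node.\<close>

lemma child_size:
  assumes "sound v B s c" "j \<in> G"
  shows "amp (child s j) + len (child s j) \<le> 2 * h j * len s"
    and "amp (child s j) + len (child s j) \<le> len s"
proof -
  have l: "0 < len s" using assms by (auto simp: sound_def)
  have "(h j + (hi j - lo j)) * len s \<le> (2 * h j) * len s"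
    using h_bounds[OF assms(2)] l by (intro mult_right_mono) auto
  moreover have "(2 * h j) * len s \<le> 1 * len s"
    using h_bounds[OF assms(2)] l by (intro mult_right_mono) auto
  ultimately show "amp (child s j) + len (child s j) \<le> 2 * h j * len s"
    "amp (child s j) + len (child s j) \<le> len s" by (simp_all add: algebra_simps)
qed

text \<open>An unflagged node cannot jump, and neither can its descendants. The part with
  \<open>amp s\<close> pays for its own displacement, the part with \<open>len s\<close> for all
  excursions in its gaps.\<close>

lemma approx_small:
  assumes "sound v B s c" "flag s = None" "0 \<le> u" "u \<le> 1"
  shows "\<bar>approx N v s c u - c\<bar> \<le> 2 * B * (amp s + len s)"
  using assms
proof (induction N arbitrary: s c u)
  case 0
  have "0 \<le> 2 * B * (amp s + len s)" using sound_nonneg[OF 0(1)] 0(1) by (simp add: sound_def)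
  then show ?case by simp
next
  case (Suc N)
  have B: "0 \<le> B" "0 \<le> amp s" "0 < len s"
    using sound_nonneg[OF Suc.prems(1)] Suc.prems(1) by (auto simp: sound_def)
  have st: "\<bar>step v s c\<bar> \<le> 2 * B * amp s"
    using Suc.prems by (intro step_small) (auto simp: jumps_def)
  have part: "\<bar>t * step v s c\<bar> \<le> 2 * B * amp s" if "0 \<le> t" "t \<le> 1" for t
    using mult_mono[of t 1 "\<bar>step v s c\<bar>" "2 * B * amp s"] st that by (simp add: abs_mult)
  show ?case
  proof (cases "free u")
    case True
    have "0 \<le> 2 * B * len s" using B by simp
    then show ?thesis using True part[of "\<psi> u"] psi_range[OF Suc.prems(3,4)]
      by (simp add: distrib_left)
  next
    case False
    then obtain j where j: "j \<in> G" "lo j < u" "u < hi j" unfolding free_def by auto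
    define c' where "c' = c + \<theta> j * step v s c"
    have "\<bar>approx N v (child s j) c' ((u - lo j) / (hi j - lo j)) - c'\<bar>
        \<le> 2 * B * (amp (child s j) + len (child s j))"
      unfolding c'_def
      using Suc.prems j rescale_range[of j u] by (intro Suc.IH sound_child) (auto simp: jumps_def)
    also have "\<dots> \<le> 2 * B * len s"
      using child_size(2)[OF Suc.prems(1) j(1)] B by (intro mult_left_mono) auto
    finally have "\<bar>approx (Suc N) v s c u - c'\<bar> \<le> 2 * B * len s"
      using approx_gap[OF j] by (simp add: c'_def)
    moreover have "\<bar>c' - c\<bar> \<le> 2 * B * amp s"
      using part[of "\<theta> j"] theta_range[OF j(1)] by (simp add: c'_def)
    ultimately show ?thesis by (simp add: distrib_left)
  qed
qed

text \<open>Below a flagged node jumps may be large in number, but all of them stay in the cell of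
  \<open>k0\<close> at stage \<open>m\<close>. Comparing with this fixed \<open>k0\<close> keeps the
  error \<open>e\<close> from accumulating along the chain.\<close>

lemma approx_exact:
  assumes "sound v B s c" "flag s = Some k" "0 \<le> u" "u \<le> 1" "E m k k0"
    and "\<And>n. n \<ge> lev s \<Longrightarrow> n > 0 \<Longrightarrow> E m (parent n) n"
    and v: "\<And>i j. E m i j \<Longrightarrow> \<bar>v i - v j\<bar> \<le> e"
  shows "\<bar>approx N v s c u - v k0\<bar> \<le> e + 2 * B * (amp s + len s)"
  using assms(1-6)
proof (induction N arbitrary: s c u k)
  case 0
  have "0 \<le> 2 * B * (amp s + len s)" using sound_nonneg[OF 0(1)] 0(1) by (simp add: sound_def)
  moreover have "c = v k" using 0(1,2) by (simp add: sound_def)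
  ultimately show ?case using v[OF 0(5)] by simp
next
  case (Suc N)
  have B: "0 \<le> B" "0 \<le> amp s" "0 < len s"
    using sound_nonneg[OF Suc.prems(1)] Suc.prems(1) by (auto simp: sound_def)
  have ck: "c = v k" using Suc.prems by (auto simp: sound_def)
  have jk: "E m (lev s) k0" if "jumps s"
    using that Suc.prems(2,5) Suc.prems(6)[of "lev s"] E_sym[of m k "lev s"] E_trans[of m "lev s" k k0]
    by (auto simp: jumps_def)
  have part: "\<bar>c + t * step v s c - v k0\<bar> \<le> e + 2 * B * amp s" if t: "0 \<le> t" "t \<le> 1" for t
  proof (cases "jumps s")
    case True
    have "\<bar>c + t * (v (lev s) - c) - v k0\<bar> \<le> e"
      using v[OF jk[OF True]] v[OF Suc.prems(5)] ck t by (intro abs_convex) auto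
    moreover have "0 \<le> 2 * B * amp s" using B by simp
    ultimately show ?thesis using True by (simp add: step_def)
  next
    case False
    have "\<bar>t * step v s c\<bar> \<le> 2 * B * amp s"
      using mult_mono[of t 1 "\<bar>step v s c\<bar>" "2 * B * amp s"] step_small[OF Suc.prems(1) False] t
      by (simp add: abs_mult)
    then show ?thesis using v[OF Suc.prems(5)] ck by linarith
  qed
  show ?case
  proof (cases "free u")
    case True
    have "0 \<le> 2 * B * len s" using B by simp
    then show ?thesis using True part[of "\<psi> u"] psi_range[OF Suc.prems(3,4)]
      by (simp add: distrib_left)
  next
    case False
    then obtain j where j: "j \<in> G" "lo j < u" "u < hi j" unfolding free_def by auto
    define c' where "c' = c + \<theta> j * step v s c"
    define u' where "u' = (u - lo j) / (hi j - lo j)"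
    have u': "0 \<le> u'" "u' \<le> 1" using rescale_range[of j u] j by (auto simp: u'_def)
    have snd: "sound v B (child s j) c'" unfolding c'_def by (rule sound_child[OF Suc.prems(1) j(1)])
    have eq: "approx (Suc N) v s c u = approx N v (child s j) c' u'"
      using approx_gap[OF j] by (simp add: c'_def u'_def)
    have sz: "2 * B * (amp (child s j) + len (child s j)) \<le> 2 * B * len s"
      using child_size(2)[OF Suc.prems(1) j(1)] B by (intro mult_left_mono) auto
    show ?thesis
    proof (cases "flag (child s j)")
      case None
      have "\<bar>approx N v (child s j) c' u' - c'\<bar> \<le> 2 * B * len s"
        using approx_small[OF snd None u', of N] sz by linarith
      moreover have "\<bar>c' - v k0\<bar> \<le> e + 2 * B * amp s"
        using part[of "\<theta> j"] theta_range[OF j(1)] by (simp add: c'_def)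
      ultimately show ?thesis unfolding eq by (simp add: distrib_left)
    next
      case (Some k')
      have "E m k' k0" using Some Suc.prems(2,5) jk by (auto split: if_splits)
      then have "\<bar>approx N v (child s j) c' u' - v k0\<bar> \<le> e + 2 * B * (amp (child s j) + len (child s j))"
        using Suc.prems(6) by (intro Suc.IH[OF snd Some u']) auto
      moreover have "0 \<le> 2 * B * amp s" using B by simp
      ultimately show ?thesis using sz unfolding eq by (simp only: distrib_left)
    qed
  qed
qed

text \<open>Deep nodes have small amplitude and length, and deep jumps stay in one cell; so
  \<open>approx_small\<close> or \<open>approx_exact\<close> applies, uniformly over all such
  nodes.\<close>

lemma approx_osc:
  assumes v: "admissible v" and e: "e > 0"
  shows "\<exists>N0. \<forall>s c u M. sound v B s c \<longrightarrow> N0 \<le> lev s \<longrightarrow> 0 \<le> u \<longrightarrow> u \<le> 1 \<longrightarrow>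
           \<bar>approx M v s c u - c\<bar> \<le> e"
proof -
  obtain m where m: "\<And>i j. E m i j \<Longrightarrow> \<bar>v i - v j\<bar> \<le> e / 2"
    using v e unfolding admissible_def by (meson half_gt_zero)
  obtain N1 where N1: "\<And>n. n \<ge> N1 \<Longrightarrow> n > 0 \<Longrightarrow> E m (parent n) n"
    using parent_eventually[of m] by blast
  have "(\<lambda>n. 6 * B * (1/2::real) ^ n) \<longlonglongrightarrow> 6 * B * 0"
    by (intro tendsto_intros LIMSEQ_power_zero) auto
  then have "eventually (\<lambda>n. 6 * B * (1/2::real) ^ n < e / 2) sequentially"
    using e by (intro order_tendstoD(2)) auto
  then obtain N2 where N2: "\<And>n. n \<ge> N2 \<Longrightarrow> 6 * B * (1/2::real) ^ n < e / 2"
    unfolding eventually_sequentially by blast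
  have "\<bar>approx M v s c u - c\<bar> \<le> e"
    if s: "sound v B s c" "max N1 N2 \<le> lev s" "0 \<le> u" "u \<le> 1" for s c u M
  proof -
    have "amp s + len s \<le> 3 * (1/2) ^ lev s" using s by (auto simp: sound_def)
    then have "2 * B * (amp s + len s) \<le> 2 * B * (3 * (1/2) ^ lev s)"
      using sound_nonneg[OF s(1)] by (intro mult_left_mono) auto
    also have "\<dots> < e / 2" using N2[of "lev s"] s(2) by simp
    finally have small: "2 * B * (amp s + len s) < e / 2" .
    show ?thesis
    proof (cases "flag s")
      case None
      then show ?thesis using approx_small[OF s(1) None s(3,4), of M] small e by linarith
    next
      case (Some k)
      have "c = v k" using s(1) Some by (auto simp: sound_def)
      moreover have "\<bar>approx M v s c u - v k\<bar> \<le> e / 2 + 2 * B * (amp s + len s)"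
      proof (rule approx_exact[OF s(1) Some s(3,4) E_refl _ m])
        show "E m (parent n) n" if "n \<ge> lev s" "n > 0" for n using N1[of n] that s(2) by simp
      qed
      ultimately show ?thesis using small by linarith
    qed
  qed
  then show ?thesis by blast
qed

text \<open>Deepening the cutoff changes values only inside nodes \<open>N\<close> levels further
  down, where \<open>approx_osc\<close> controls the change.\<close>

lemma approx_cauchy:
  assumes v: "admissible v" and e: "e > 0"
  shows "\<exists>N0. \<forall>s c u N M. sound v B s c \<longrightarrow> N0 \<le> N \<longrightarrow> 0 \<le> u \<longrightarrow> u \<le> 1 \<longrightarrow>
           \<bar>approx (N + M) v s c u - approx N v s c u\<bar> \<le> e"
proof -
  obtain N0 where N0: "\<And>s c u M. sound v B s c \<Longrightarrow> N0 \<le> lev s \<Longrightarrow> 0 \<le> u \<Longrightarrow> u \<le> 1 \<Longrightarrow>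
           \<bar>approx M v s c u - c\<bar> \<le> e" using approx_osc[OF v e] by metis
  have "\<bar>approx (N + M) v s c u - approx N v s c u\<bar> \<le> e"
    if "sound v B s c" "N0 \<le> lev s + N" "0 \<le> u" "u \<le> 1" for s c u N M
    using that
  proof (induction N arbitrary: s c u)
    case 0
    then show ?case using N0[of s c u M] by simp
  next
    case (Suc N)
    show ?case
    proof (cases "free u")
      case True
      then show ?thesis using e by simp
    next
      case False
      then obtain j where j: "j \<in> G" "lo j < u" "u < hi j" unfolding free_def by auto
      show ?thesis
        unfolding add_Suc approx_gap[OF j]
        using Suc.prems j rescale_range[of j u] by (intro Suc.IH sound_child) auto
    qed
  qed
  then show ?thesis by (meson trans_le_add2)
qed

lemma curve_uniform_limit:
  assumes v: "admissible v" and s: "sound v B s c"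
  shows "uniform_limit {0..1} (\<lambda>N. approx N v s c) (curve v s c) sequentially"
proof -
  have "uniformly_convergent_on {0..1} (\<lambda>N. approx N v s c)"
  proof (intro Cauchy_uniformly_convergent uniformly_Cauchy_onI)
    fix e :: real assume "e > 0"
    then obtain N0 where N0: "\<And>u N M. N0 \<le> N \<Longrightarrow> 0 \<le> u \<Longrightarrow> u \<le> 1 \<Longrightarrow>
           \<bar>approx (N + M) v s c u - approx N v s c u\<bar> \<le> e / 3"
      using approx_cauchy[OF v, of "e / 3" B] s by (metis divide_pos_pos zero_less_numeral)
    have "dist (approx m v s c u) (approx n v s c u) < e"
      if "u \<in> {0..1}" "m \<ge> N0" "n \<ge> N0" for u m n
      using N0[of N0 u "m - N0"] N0[of N0 u "n - N0"] that \<open>e > 0\<close> unfolding dist_real_def by simp argo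
    then show "\<exists>M. \<forall>x\<in>{0..1}. \<forall>m\<ge>M. \<forall>n\<ge>M. dist (approx m v s c x) (approx n v s c x) < e"
      by blast
  qed
  then show ?thesis
    unfolding curve_def by (simp add: uniformly_convergent_uniform_limit_iff)
qed

lemma curve_tendsto:
  assumes "admissible v" "sound v B s c" "0 \<le> u" "u \<le> 1"
  shows "(\<lambda>N. approx N v s c u) \<longlonglongrightarrow> curve v s c u"
  using tendsto_uniform_limitI[OF curve_uniform_limit[OF assms(1,2)]] assms(3,4) by auto

lemma curve_free:
  assumes "free u" shows "curve v s c u = c + \<psi> u * step v s c"
proof -
  have "(\<lambda>N. approx (Suc N) v s c u) \<longlonglongrightarrow> c + \<psi> u * step v s c"
    by (simp only: approx_free[OF assms]) (rule tendsto_const)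
  then have "(\<lambda>N. approx N v s c u) \<longlonglongrightarrow> c + \<psi> u * step v s c"
    by (rule LIMSEQ_imp_Suc)
  then show ?thesis unfolding curve_def by (rule limI)
qed

lemma curve_ends: "curve v s c 0 = c" "curve v s c 1 = c"
  using curve_free[OF free_0] curve_free[OF free_1] psi_0 psi_1 by simp_all

text \<open>Self-similarity passes to the limit. The endpoints of the gap are included, since both
  sides equal the base value of the child there.\<close>

lemma curve_gap:
  assumes v: "admissible v" "sound v B s c" and j: "j \<in> G" "lo j \<le> u" "u \<le> hi j"
  shows "curve v s c u = curve v (child s j) (c + \<theta> j * step v s c) ((u - lo j) / (hi j - lo j))"
proof (cases "u = lo j \<or> u = hi j")
  case True
  then show ?thesis
    using curve_free[OF free_lo[OF j(1)], of v s c] curve_free[OF free_hi[OF j(1)], of v s c]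
      psi_gap[of j u] j gap[of j] curve_ends
    by auto
next
  case False
  then have u: "lo j < u" "u < hi j" using j by auto
  have "(\<lambda>N. approx (Suc N) v s c u) \<longlonglongrightarrow>
      curve v (child s j) (c + \<theta> j * step v s c) ((u - lo j) / (hi j - lo j))"
    unfolding approx_gap[OF j(1) u]
    using rescale_range[OF j] by (intro curve_tendsto[OF v(1) sound_child[OF v(2) j(1)]])
  then have "(\<lambda>N. approx N v s c u) \<longlonglongrightarrow>
      curve v (child s j) (c + \<theta> j * step v s c) ((u - lo j) / (hi j - lo j))"
    by (rule LIMSEQ_imp_Suc)
  then show ?thesis unfolding curve_def[of v s c u] by (rule limI)
qed

lemma curve_small:
  assumes "admissible v" "sound v B s c" "flag s = None" "0 \<le> u" "u \<le> 1"
  shows "\<bar>curve v s c u - c\<bar> \<le> 2 * B * (amp s + len s)"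
proof (rule tendsto_upperbound)
  show "(\<lambda>N. \<bar>approx N v s c u - c\<bar>) \<longlonglongrightarrow> \<bar>curve v s c u - c\<bar>"
    by (intro tendsto_intros curve_tendsto[OF assms(1,2,4,5)])
qed (auto intro!: always_eventually approx_small assms)

lemma curve_osc:
  assumes v: "admissible v" and e: "e > 0"
  shows "\<exists>N0. \<forall>s c u. sound v B s c \<longrightarrow> N0 \<le> lev s \<longrightarrow> 0 \<le> u \<longrightarrow> u \<le> 1 \<longrightarrow>
           \<bar>curve v s c u - c\<bar> \<le> e"
proof -
  obtain N0 where N0: "\<And>s c u M. sound v B s c \<Longrightarrow> N0 \<le> lev s \<Longrightarrow> 0 \<le> u \<Longrightarrow> u \<le> 1 \<Longrightarrow>
           \<bar>approx M v s c u - c\<bar> \<le> e" using approx_osc[OF v e] by metis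
  have "\<bar>curve v s c u - c\<bar> \<le> e" if s: "sound v B s c" "N0 \<le> lev s" "0 \<le> u" "u \<le> 1" for s c u
  proof (rule tendsto_upperbound)
    show "(\<lambda>N. \<bar>approx N v s c u - c\<bar>) \<longlonglongrightarrow> \<bar>curve v s c u - c\<bar>"
      by (intro tendsto_intros curve_tendsto[OF v s(1,3,4)])
  qed (auto intro!: always_eventually N0 s)
  then show ?thesis by blast
qed

lemma approx_bound:
  assumes "sound v B s c" "0 \<le> u" "u \<le> 1" shows "\<bar>approx N v s c u\<bar> \<le> B"
  using assms
proof (induction N arbitrary: s c u)
  case 0
  then show ?case by (simp add: sound_def)
next
  case (Suc N)
  show ?case
  proof (cases "free u")
    case True
    then show ?thesis using sound_step[OF Suc.prems(1)] psi_range[OF Suc.prems(2,3)] by simp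
  next
    case False
    then obtain j where j: "j \<in> G" "lo j < u" "u < hi j" unfolding free_def by auto
    show ?thesis unfolding approx_gap[OF j]
      using Suc.prems j rescale_range[of j u] by (intro Suc.IH sound_child) auto
  qed
qed

lemma curve_bound:
  assumes "admissible v" "sound v B s c" "0 \<le> u" "u \<le> 1" shows "\<bar>curve v s c u\<bar> \<le> B"
proof (rule tendsto_upperbound)
  show "(\<lambda>N. \<bar>approx N v s c u\<bar>) \<longlonglongrightarrow> \<bar>curve v s c u\<bar>"
    by (intro tendsto_intros curve_tendsto[OF assms])
qed (auto intro!: always_eventually approx_bound assms)

text \<open>Inductively, the truncated curve is the continuous function with \<psi> plus one bump in
  each gap.\<close>

lemma approx_continuous:
  assumes "sound v B s c" shows "continuous_on {0..1} (approx N v s c)"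
  using assms
proof (induction N arbitrary: s c)
  case 0
  then show ?case by (simp add: fun_eq_iff continuous_on_const cong: continuous_on_cong)
next
  case (Suc N)
  define c' where "c' j = c + \<theta> j * step v s c" for j
  define bump where "bump j u = approx N v (child s j) (c' j) ((u - lo j) / (hi j - lo j)) - c' j"
    for j u
  define \<beta> where "\<beta> u = approx (Suc N) v s c u - (c + \<psi> u * step v s c)" for u
  \<comment> \<open>Gaps in \<open>Z0\<close> and \<open>Z1\<close> may hold flagged children, which
    can jump, so only the crude bound \<open>2 * B\<close> is available there; these gaps are finite
    in number. All others have bumps of the order of \<open>h j\<close>.\<close>
  define \<eta> where "\<eta> j = (if j \<in> Z0 \<union> Z1 then 2 * B else 4 * B * h j)" for j
  have B: "0 \<le> B" by (rule sound_nonneg[OF Suc.prems])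
  have l: "0 < len s" "len s \<le> 1"
    using Suc.prems power_le_one[of "1/2::real" "lev s"] by (auto simp: sound_def)
  have snd: "sound v B (child s j) (c' j)" if "j \<in> G" for j
    unfolding c'_def by (rule sound_child[OF Suc.prems that])
  have "continuous_on {0..1} \<beta>"
  proof (rule continuous_on_bump_sum[where G = G and \<beta> = bump and lo = lo and hi = hi and \<eta> = \<eta>])
    fix j assume j: "j \<in> G"
    show "continuous_on {lo j..hi j} (bump j)"
      unfolding bump_def using rescale_range[OF j] len_pos[OF j]
      by (intro continuous_intros continuous_on_compose2[OF Suc.IH[OF snd[OF j]]]) auto
    show "lo j < hi j \<and> bump j (lo j) = 0 \<and> bump j (hi j) = 0"
      using gap[OF j] by (simp add: bump_def approx_ends)
    fix u assume u: "lo j < u" "u < hi j"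
    let ?u = "(u - lo j) / (hi j - lo j)"
    have u': "0 \<le> ?u" "?u \<le> 1" using rescale_range[OF j] u by auto
    show "\<bar>bump j u\<bar> \<le> \<eta> j"
    proof (cases "j \<in> Z0 \<union> Z1")
      case True
      have "\<bar>c' j\<bar> \<le> B" using snd[OF j] by (simp add: sound_def)
      then show ?thesis
        using approx_bound[OF snd[OF j] u', of N] True by (auto simp: \<eta>_def bump_def)
    next
      case False
      have "\<bar>bump j u\<bar> \<le> 2 * B * (amp (child s j) + len (child s j))"
        unfolding bump_def by (intro approx_small snd j u') (use False in auto)
      also have "\<dots> \<le> 2 * B * (2 * h j * len s)"
        using child_size(1)[OF Suc.prems j] B by (intro mult_left_mono) auto
      also have "\<dots> \<le> 2 * B * (2 * h j * 1)"
        using l B h_pos[OF j] by (intro mult_left_mono) auto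
      finally show ?thesis using False by (simp add: \<eta>_def)
    qed
    show "\<beta> u = bump j u"
      unfolding \<beta>_def approx_gap[OF j u] using psi_gap[OF j, of u] u by (simp add: bump_def c'_def)
  next
    fix e :: real assume e: "e > 0"
    \<comment> \<open>The added 1 keeps the threshold meaningful when \<open>B\<close> is
      zero.\<close>
    have "{j \<in> G. \<eta> j \<ge> e} \<subseteq> Z0 \<union> Z1 \<union> {j \<in> G. h j \<ge> e / (4 * B + 1)}"
    proof
      fix j assume j: "j \<in> {j \<in> G. \<eta> j \<ge> e}"
      have "e \<le> h j * (4 * B + 1)" if "j \<notin> Z0 \<union> Z1"
        using j that h_pos[of j] by (auto simp: \<eta>_def algebra_simps)
      then show "j \<in> Z0 \<union> Z1 \<union> {j \<in> G. h j \<ge> e / (4 * B + 1)}"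
        using j B by (auto simp: pos_divide_le_eq)
    qed
    then show "finite {j \<in> G. \<eta> j \<ge> e}"
      using Z_fin h_fin[of "e / (4 * B + 1)"] e B by (auto intro: finite_subset)
  next
    fix u assume "\<And>j. j \<in> G \<Longrightarrow> \<not> (lo j < u \<and> u < hi j)"
    then show "\<beta> u = 0" by (simp add: \<beta>_def free_def)
  qed (use gap_unique in blast)
  moreover have "approx (Suc N) v s c = (\<lambda>u. \<beta> u + (c + \<psi> u * step v s c))"
    by (simp add: \<beta>_def fun_eq_iff)
  ultimately show ?case by (auto intro!: continuous_intros psi_cont)
qed

lemma curve_continuous:
  assumes "admissible v" "sound v B s c" shows "continuous_on {0..1} (curve v s c)"
  by (rule uniform_limit_theorem[OF _ curve_uniform_limit[OF assms]])
    (auto intro: always_eventually approx_continuous assms)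

section \<open>Symmetry and linearity of the curve\<close>

text \<open>A gap and its mirror image create the same child with the same base. This later reduces
  left derivatives to right ones.\<close>

lemma approx_symmetric:
  assumes "0 \<le> u" "u \<le> 1" shows "approx N v s c (1 - u) = approx N v s c u"
  using assms
proof (induction N arbitrary: s c u)
  case (Suc N)
  show ?case
  proof (cases "free u")
    case True
    then show ?thesis
      using free_reflect[OF True] psi_sym[OF Suc.prems] by simp
  next
    case False
    then obtain j where j: "j \<in> G" "lo j < u" "u < hi j" unfolding free_def by auto
    have m: "mir j \<in> G" "lo (mir j) = 1 - hi j" "hi (mir j) = 1 - lo j" "\<theta> (mir j) = \<theta> j"
      "h (mir j) = h j" "tgt (mir j) = tgt j" using mirror[OF j(1)] by auto
    have ch: "child s (mir j) = child s j" using m mirror_Z[OF j(1)] by (simp add: child_def)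
    have "approx (Suc N) v s c (1 - u) =
        approx N v (child s (mir j)) (c + \<theta> (mir j) * step v s c)
          ((1 - u - lo (mir j)) / (hi (mir j) - lo (mir j)))"
      using j m by (intro approx_gap) auto
    also have "(1 - u - lo (mir j)) / (hi (mir j) - lo (mir j)) = 1 - (u - lo j) / (hi j - lo j)"
    proof -
      have "1 - u - lo (mir j) = (hi j - lo j) - (u - lo j)" "hi (mir j) - lo (mir j) = hi j - lo j"
        using m by simp_all
      then show ?thesis using j by (simp only: diff_divide_distrib[of "hi j - lo j"]) simp
    qed
    finally show ?thesis
      unfolding approx_gap[OF j] using Suc.IH[OF rescale_range[of j u]] j m ch
      by (simp del: approx.simps)
  qed
qed simp

lemma curve_symmetric: "0 \<le> u \<Longrightarrow> u \<le> 1 \<Longrightarrow> curve v s c (1 - u) = curve v s c u"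
  unfolding curve_def by (simp add: approx_symmetric)

lemma step_linear:
  "step (\<lambda>i. a * v i + b * w i) s (a * c + b * d) = a * step v s c + b * step w s d"
  by (auto simp: step_def aim_def algebra_simps)

text \<open>The tree of nodes is independent of the function \<open>v\<close>, and every
  displacement is linear in \<open>v\<close> and the base jointly.\<close>

lemma approx_linear:
  "approx N (\<lambda>i. a * v i + b * w i) s (a * c + b * d) u = a * approx N v s c u + b * approx N w s d u"
proof (induction N arbitrary: s c d u)
  case (Suc N)
  have "a * c + b * d + t * (a * step v s c + b * step w s d) =
      a * (c + t * step v s c) + b * (d + t * step w s d)" for t
    by (simp add: algebra_simps)
  then show ?case by (simp add: step_linear Suc.IH Let_def)
qed simp

lemma curve_linear:
  assumes "admissible v" "sound v B s c" "admissible w" "sound w B' s d" "0 \<le> u" "u \<le> 1"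
  shows "curve (\<lambda>i. a * v i + b * w i) s (a * c + b * d) u = a * curve v s c u + b * curve w s d u"
proof -
  have "(\<lambda>N. a * approx N v s c u + b * approx N w s d u) \<longlonglongrightarrow> a * curve v s c u + b * curve w s d u"
    by (intro tendsto_intros curve_tendsto[OF assms(1,2,5,6)] curve_tendsto[OF assms(3-6)])
  then show ?thesis
    unfolding curve_def[of "\<lambda>i. a * v i + b * w i"] approx_linear by (intro limI)
qed

end

section \<open>Absence of one-sided derivatives along the curve\<close>

context gap_embedding
begin

text \<open>Node \<open>s\<close> occupies the interval of length \<open>len s\<close> starting at
  \<alpha>, and the whole curve restricted to it is the curve of that node.\<close>

definition placed :: "(nat \<Rightarrow> real) \<Rightarrow> real \<Rightarrow> node \<Rightarrow> real \<Rightarrow> real \<Rightarrow> bool" where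
  "placed v B s c \<alpha> \<longleftrightarrow> sound v B s c \<and> 0 \<le> \<alpha> \<and> \<alpha> + len s \<le> 1 \<and>
     (\<forall>u. 0 \<le> u \<longrightarrow> u \<le> 1 \<longrightarrow> curve v root (v 0) (\<alpha> + len s * u) = curve v s c u)"

lemma sound_root: "(\<And>e. \<bar>v e\<bar> \<le> B) \<Longrightarrow> sound v B root (v 0)"
  by (simp add: sound_def root_def)

lemma placed_root: "(\<And>e. \<bar>v e\<bar> \<le> B) \<Longrightarrow> placed v B root (v 0) 0"
  using sound_root by (simp add: placed_def) (simp add: root_def)

lemma placed_sound: "placed v B s c \<alpha> \<Longrightarrow> sound v B s c"
  by (simp add: placed_def)

lemma placed_len: "placed v B s c \<alpha> \<Longrightarrow> 0 < len s"
  by (simp add: placed_def sound_def)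

lemma placed_curve:
  "placed v B s c \<alpha> \<Longrightarrow> 0 \<le> u \<Longrightarrow> u \<le> 1 \<Longrightarrow>
    curve v root (v 0) (\<alpha> + len s * u) = curve v s c u"
  by (simp add: placed_def)

lemma placed_child:
  assumes v: "admissible v" and p: "placed v B s c \<alpha>" and j: "j \<in> G"
  shows "placed v B (child s j) (c + \<theta> j * step v s c) (\<alpha> + len s * lo j)"
proof -
  have s: "sound v B s c" and l: "0 < len s" and \<alpha>: "0 \<le> \<alpha>" "\<alpha> + len s \<le> 1"
    using p by (auto simp: placed_def sound_def)
  have "len s * hi j \<le> len s * 1" using gap[OF j] l by (intro mult_left_mono) auto
  then have "\<alpha> + len s * lo j + len (child s j) \<le> 1" using \<alpha> by (simp add: algebra_simps)
  moreover have "0 \<le> \<alpha> + len s * lo j" using gap[OF j] \<alpha> l by simp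
  moreover have "curve v root (v 0) (\<alpha> + len s * lo j + len (child s j) * u) =
      curve v (child s j) (c + \<theta> j * step v s c) u" if u: "0 \<le> u" "u \<le> 1" for u
  proof -
    define x where "x = lo j + (hi j - lo j) * u"
    have "(hi j - lo j) * u \<le> (hi j - lo j) * 1" "0 \<le> (hi j - lo j) * u"
      using len_pos[OF j] u by (auto intro: mult_left_mono)
    then have x: "lo j \<le> x" "x \<le> hi j" by (auto simp: x_def)
    have "\<alpha> + len s * lo j + len (child s j) * u = \<alpha> + len s * x"
      by (simp add: x_def algebra_simps)
    moreover have "curve v root (v 0) (\<alpha> + len s * x) = curve v s c x"
      using placed_curve[OF p, of x] x gap[OF j] by simp
    ultimately have "curve v root (v 0) (\<alpha> + len s * lo j + len (child s j) * u) = curve v s c x"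
      by (simp only:)
    also have "\<dots> = curve v (child s j) (c + \<theta> j * step v s c) ((x - lo j) / (hi j - lo j))"
      by (rule curve_gap[OF v s j x])
    also have "(x - lo j) / (hi j - lo j) = u" using len_pos[OF j] by (simp add: x_def)
    finally show ?thesis .
  qed
  ultimately show ?thesis unfolding placed_def using sound_child[OF s j] by blast
qed

text \<open>Descending through gaps of \<open>Z0\<close> keeps an exact base while the depth grows,
  so one can wait for the depth at which a wanted jump is offered.\<close>

lemma placed_stay:
  assumes v: "admissible v" and p: "placed v B s (v k) \<alpha>" "flag s = Some k"
  shows "\<exists>s' \<alpha>'. placed v B s' (v k) \<alpha>' \<and> flag s' = Some k \<and> lev s' = lev s + m"
proof (induction m)
  case 0
  then show ?case using p by auto
next
  case (Suc m)
  then obtain s' \<alpha>' where s': "placed v B s' (v k) \<alpha>'" "flag s' = Some k" "lev s' = lev s + m"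
    by blast
  obtain j where j: "j \<in> Z0" using Z_ne by blast
  then have "j \<in> G" using Z_sub by blast
  from placed_child[OF v s'(1) this]
  have "placed v B (child s' j) (v k) (\<alpha>' + len s' * lo j)" using Z0[OF j] by simp
  then show ?case using s' j by (intro exI[of _ "child s' j"] exI[of _ "\<alpha>' + len s' * lo j"]) auto
qed

text \<open>Induction along parents: reach the parent of \<open>k\<close>, wait there until depth
  \<open>k\<close>, and jump to \<open>k\<close>. Attaining all values gives the lower bound for the
  norm.\<close>

lemma curve_attains:
  assumes v: "admissible v" "\<And>e. \<bar>v e\<bar> \<le> B"
  shows "\<exists>t. 0 \<le> t \<and> t \<le> 1 \<and> curve v root (v 0) t = v k"
proof -
  have "\<exists>s \<alpha>. placed v B s (v k) \<alpha> \<and> flag s = Some k \<and> lev s \<le> Suc k \<and> (k = 0 \<longrightarrow> lev s = 0)" for k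
  proof (induction k rule: less_induct)
    case (less k)
    show ?case
    proof (cases "k = 0")
      case True
      then show ?thesis using placed_root[OF v(2)]
        by (intro exI[of _ root] exI[of _ 0]) (simp add: root_def)
    next
      case False
      then have pk: "parent k < k" using parent_less by simp
      from less[OF this] obtain s \<alpha> where
        s: "placed v B s (v (parent k)) \<alpha>" "flag s = Some (parent k)" "lev s \<le> Suc (parent k)" by blast
      \<comment> \<open>The depth is at most \<open>Suc (parent k)\<close>, hence at most
        \<open>k\<close>: the moment for this jump has not passed.\<close>
      obtain s' \<alpha>' where s': "placed v B s' (v (parent k)) \<alpha>'" "flag s' = Some (parent k)" "lev s' = k"
        using placed_stay[OF v(1) s(1,2), of "k - lev s"] s(3) pk by auto
      have jm: "jumps s'" using s' False by (simp add: jumps_def)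
      obtain j where j: "j \<in> Z1" using Z_ne by blast
      have nz: "j \<notin> Z0" using Z0[of j] Z1[OF j] by auto
      have "j \<in> G" using j Z_sub by blast
      from placed_child[OF v(1) s'(1) this]
      have "placed v B (child s' j) (v k) (\<alpha>' + len s' * lo j)"
        using Z1[OF j] jm s'(3) by (simp add: step_def)
      moreover have "flag (child s' j) = Some k" "lev (child s' j) = Suc k"
        using j nz jm s'(3) by auto
      ultimately show ?thesis using False by auto
    qed
  qed
  then obtain s \<alpha> where s: "placed v B s (v k) \<alpha>" by blast
  then have "curve v root (v 0) \<alpha> = v k" "0 \<le> \<alpha>" "\<alpha> \<le> 1"
    using placed_curve[OF s, of 0] placed_len[OF s] by (auto simp: curve_ends placed_def)
  then show ?thesis by blast
qed

text \<open>The child of such a gap is unflagged, so it makes no jump. It starts and ends at its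
  base, and in between, at the left end of a gap of \<open>Z1\<close>, it has made its full
  displacement.\<close>

lemma loop_in_gap:
  assumes v: "admissible v" and p: "placed v B s c \<alpha>" and i: "i \<in> G" "i \<notin> Z0" "i \<notin> Z1"
  shows "\<exists>q. \<alpha> + len s * lo i \<le> q \<and> q \<le> \<alpha> + len s * hi i \<and>
     curve v root (v 0) (\<alpha> + len s * hi i) = curve v root (v 0) (\<alpha> + len s * lo i) \<and>
     \<bar>curve v root (v 0) q - curve v root (v 0) (\<alpha> + len s * lo i)\<bar> =
       h i * len s * \<bar>aim (tgt i) v - curve v root (v 0) (\<alpha> + len s * lo i)\<bar>"
proof -
  define r where "r = child s i"
  define c' where "c' = c + \<theta> i * step v s c"
  have r: "placed v B r c' (\<alpha> + len s * lo i)"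
    unfolding r_def c'_def by (rule placed_child[OF v p i(1)])
  have lr: "len r = (hi i - lo i) * len s" by (simp add: r_def)
  have a: "curve v root (v 0) (\<alpha> + len s * lo i) = c'"
    using placed_curve[OF r, of 0] by (simp add: curve_ends)
  have b: "curve v root (v 0) (\<alpha> + len s * hi i) = c'"
    using placed_curve[OF r, of 1] by (simp add: curve_ends lr algebra_simps)
  obtain z where z: "z \<in> Z1" using Z_ne by blast
  then have zG: "z \<in> G" using Z_sub by blast
  define q where "q = \<alpha> + len s * lo i + len r * lo z"
  have "curve v root (v 0) q = curve v r c' (lo z)"
    unfolding q_def using gap[OF zG] by (intro placed_curve[OF r]) auto
  also have "\<dots> = c' + step v r c'"
    using curve_free[OF free_lo[OF zG], of v r c'] psi_gap[OF zG, of "lo z"] gap[OF zG] Z1[OF z] by simp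
  also have "step v r c' = h i * len s * (aim (tgt i) v - c')"
    using i by (simp add: step_def jumps_def r_def)
  finally have "\<bar>curve v root (v 0) q - c'\<bar> = h i * len s * \<bar>aim (tgt i) v - c'\<bar>"
    using h_pos[OF i(1)] placed_len[OF p] by (simp add: abs_mult)
  moreover have "\<alpha> + len s * lo i \<le> q" using placed_len[OF r] gap[OF zG] by (simp add: q_def)
  moreover have "q \<le> \<alpha> + len s * hi i"
  proof -
    have "len r * lo z \<le> len r * 1" using placed_len[OF r] gap[OF zG] by (intro mult_left_mono) auto
    then show ?thesis by (simp add: q_def lr algebra_simps)
  qed
  ultimately show ?thesis using a b by auto
qed

text \<open>The sign of the target is chosen so that the loops towards it keep a positive relative size
  for the given \<^term>\<open>v\<close>, wherever the curve is at the base point.\<close>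

lemma no_right_derivative_curve:
  assumes v: "admissible v" "\<And>e. \<bar>v e\<bar> \<le> B" "v e0 \<noteq> 0"
    and t: "0 \<le> t" "t < 1"
    and F: "\<And>x. 0 \<le> x \<Longrightarrow> x \<le> 1 \<Longrightarrow> F x = curve v root (v 0) x"
    and lip: "\<exists>C. \<forall>e>0. \<exists>s. t < s \<and> s < t + e \<and> s \<le> 1 \<and> \<bar>F s - F t\<bar> \<le> C * (s - t)"
    and gaps: "\<And>d. \<exists>C>0. \<forall>e>0. \<exists>s c \<alpha> i. placed v B s c \<alpha> \<and> i \<in> G - (Z0 \<union> Z1) \<and> tgt i = d \<and>
        t < \<alpha> + len s * lo i \<and> \<alpha> + len s * hi i < t + e \<and> \<alpha> + len s * hi i - t \<le> C * (h i * len s)"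
  shows "\<nexists>l::ereal. ((\<lambda>x. ereal ((F x - F t) / (x - t))) \<longlongrightarrow> l) (at_right t)"
proof (rule no_right_derivative)
  show "\<exists>C. \<forall>e>0. \<exists>s>t. s < t + e \<and> \<bar>F s - F t\<bar> \<le> C * (s - t)" using lip by meson
  have "\<exists>d. \<bar>v e0\<bar> \<le> \<bar>aim d v - F t\<bar>"
  proof (cases "\<bar>v e0\<bar> \<le> \<bar>v e0 - F t\<bar>")
    case True
    then show ?thesis by (intro exI[of _ "2 * e0"]) (simp add: aim_def)
  next
    case False
    then show ?thesis by (intro exI[of _ "2 * e0 + 1"]) (simp add: aim_def)
  qed
  then obtain d where d: "\<bar>v e0\<bar> \<le> \<bar>aim d v - F t\<bar>" by blast
  have cont: "continuous_on {0..1} F"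
    using curve_continuous[OF v(1) sound_root[OF v(2)]] continuous_on_cong[of "{0..1}" "{0..1}" F] F
    by auto
  \<comment> \<open>On this scale \<open>F\<close> moves by less than half of
    \<open>\<bar>v e0\<bar>\<close>, so the chosen target remains at least that half away from the
    base of every loop used.\<close>
  obtain \<delta> where \<delta>: "\<delta> > 0" "\<And>x. 0 \<le> x \<Longrightarrow> x \<le> 1 \<Longrightarrow> \<bar>x - t\<bar> < \<delta> \<Longrightarrow> \<bar>F x - F t\<bar> < \<bar>v e0\<bar> / 2"
    using cont[unfolded continuous_on_iff, rule_format, of t "\<bar>v e0\<bar> / 2"] t v(3)
    by (auto simp: dist_real_def)
  obtain C where C: "C > 0" and g: "\<And>e. e > 0 \<Longrightarrow> \<exists>s c \<alpha> i. placed v B s c \<alpha> \<and> i \<in> G - (Z0 \<union> Z1) \<and>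
      tgt i = d \<and> t < \<alpha> + len s * lo i \<and> \<alpha> + len s * hi i < t + e \<and>
      \<alpha> + len s * hi i - t \<le> C * (h i * len s)"
    using gaps[of d] by blast
  have "\<exists>a q b. t < a \<and> a \<le> q \<and> q \<le> b \<and> b < t + e \<and> F a = F b \<and>
      \<bar>v e0\<bar> / (2 * C) * (b - t) \<le> \<bar>F q - F a\<bar>" if e: "e > 0" for e
  proof -
    obtain s c \<alpha> i where p: "placed v B s c \<alpha>" and i: "i \<in> G" "i \<notin> Z0" "i \<notin> Z1" "tgt i = d"
      and pos: "t < \<alpha> + len s * lo i" "\<alpha> + len s * hi i < t + min e \<delta>"
        "\<alpha> + len s * hi i - t \<le> C * (h i * len s)"
      using g[of "min e \<delta>"] e \<delta>(1) by auto
    define a where "a = \<alpha> + len s * lo i"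
    define b where "b = \<alpha> + len s * hi i"
    have l: "0 < len s" by (rule placed_len[OF p])
    have "len s * lo i \<le> len s * hi i" "len s * hi i \<le> len s * 1"
      using l gap[OF i(1)] by (auto intro!: mult_left_mono)
    then have ab: "a \<le> b" "b \<le> 1" using p by (auto simp: placed_def a_def b_def)
    obtain q where q: "a \<le> q" "q \<le> b" "curve v root (v 0) b = curve v root (v 0) a"
      "\<bar>curve v root (v 0) q - curve v root (v 0) a\<bar> = h i * len s * \<bar>aim d v - curve v root (v 0) a\<bar>"
      using loop_in_gap[OF v(1) p i(1-3)] i(4) unfolding a_def b_def by blast
    have eqs: "curve v root (v 0) b = F b" "curve v root (v 0) a = F a" "curve v root (v 0) q = F q"
      using F ab q pos t by (auto simp: a_def[symmetric])
    have "\<bar>F a - F t\<bar> < \<bar>v e0\<bar> / 2" using \<delta>(2)[of a] pos ab t by (auto simp: a_def b_def)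
    then have "\<bar>v e0\<bar> / 2 \<le> \<bar>aim d v - F a\<bar>" using d by linarith
    then have "h i * len s * (\<bar>v e0\<bar> / 2) \<le> \<bar>F q - F a\<bar>"
      using q(4) l h_pos[OF i(1)] unfolding eqs by simp
    moreover have "\<bar>v e0\<bar> / (2 * C) * (b - t) \<le> \<bar>v e0\<bar> / (2 * C) * (C * (h i * len s))"
      using pos C by (intro mult_left_mono) (auto simp: b_def)
    moreover have "\<bar>v e0\<bar> / (2 * C) * (C * (h i * len s)) = h i * len s * (\<bar>v e0\<bar> / 2)"
      using C by simp
    ultimately have "\<bar>v e0\<bar> / (2 * C) * (b - t) \<le> \<bar>F q - F a\<bar>" by linarith
    then show ?thesis using pos q eqs by (intro exI[of _ a] exI[of _ q] exI[of _ b]) (auto simp: a_def b_def)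
  qed
  then show "\<exists>c>0. \<forall>e>0. \<exists>a q b. t < a \<and> a \<le> q \<and> q \<le> b \<and> b < t + e \<and> F a = F b \<and>
      c * (b - t) \<le> \<bar>F q - F a\<bar>"
    using C v(3) by (intro exI[of _ "\<bar>v e0\<bar> / (2 * C)"]) auto
qed

text \<open>On free points of the node, \<open>F\<close> is an affine image of \<psi>, so the two
  hypotheses of the criterion are the properties \<open>lip\<close> and \<open>near\<close> of the
  profile, rescaled by \<open>len s\<close>.\<close>

lemma stopping_point:
  assumes v: "admissible v" and p: "placed v B s c \<alpha>" and u: "0 \<le> u" "u < 1"
    and stop: "\<And>j. j \<in> G \<Longrightarrow> \<not> (lo j \<le> u \<and> u < hi j)"
    and t: "t = \<alpha> + len s * u"
    and F: "\<And>x. 0 \<le> x \<Longrightarrow> x \<le> 1 \<Longrightarrow> F x = curve v root (v 0) x"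
  shows "\<exists>C. \<forall>e>0. \<exists>s. t < s \<and> s < t + e \<and> s \<le> 1 \<and> \<bar>F s - F t\<bar> \<le> C * (s - t)"
    and "\<exists>C>0. \<forall>e>0. \<exists>s c \<alpha> i. placed v B s c \<alpha> \<and> i \<in> G - (Z0 \<union> Z1) \<and> tgt i = d \<and>
        t < \<alpha> + len s * lo i \<and> \<alpha> + len s * hi i < t + e \<and> \<alpha> + len s * hi i - t \<le> C * (h i * len s)"
proof -
  have l: "0 < len s" by (rule placed_len[OF p])
  have range: "0 \<le> \<alpha> + len s * x" "\<alpha> + len s * x \<le> 1" if "0 \<le> x" "x \<le> 1" for x
  proof -
    have "len s * x \<le> len s * 1" using l that by (intro mult_left_mono) auto
    then show "\<alpha> + len s * x \<le> 1" using p by (auto simp: placed_def)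
    show "0 \<le> \<alpha> + len s * x" using l that p by (auto simp: placed_def)
  qed
  have "free u" using stop unfolding free_def by force
  have val: "F (\<alpha> + len s * x) = c + \<psi> x * step v s c" if "0 \<le> x" "x \<le> 1" "free x" for x
    using F[OF range[OF that(1,2)]] placed_curve[OF p that(1,2)] curve_free[OF that(3)] by simp
  obtain C where C: "\<And>e. e > 0 \<Longrightarrow> \<exists>x. u < x \<and> x < u + e \<and> x \<le> 1 \<and> free x \<and>
      \<bar>\<psi> x - \<psi> u\<bar> \<le> C * (x - u)"
    using lip[OF u stop] unfolding free_def by blast
  have "\<exists>x. t < x \<and> x < t + e \<and> x \<le> 1 \<and> \<bar>F x - F t\<bar> \<le> (\<bar>step v s c\<bar> * C / len s) * (x - t)"
    if e: "e > 0" for e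
  proof -
    obtain x where x: "u < x" "x < u + e / len s" "x \<le> 1" "free x" "\<bar>\<psi> x - \<psi> u\<bar> \<le> C * (x - u)"
      using C[of "e / len s"] e l by auto
    have "len s * x < len s * (u + e / len s)" "len s * u < len s * x"
      using x l by auto
    then have 1: "t < \<alpha> + len s * x" "\<alpha> + len s * x < t + e"
      using l by (auto simp: t distrib_left)
    have "F (\<alpha> + len s * x) - F t = (\<psi> x - \<psi> u) * step v s c"
      using val[of x] val[of u] u x \<open>free u\<close> by (simp add: t algebra_simps)
    then have "\<bar>F (\<alpha> + len s * x) - F t\<bar> \<le> C * (x - u) * \<bar>step v s c\<bar>"
      using x(5) by (simp add: abs_mult mult_right_mono)
    also have "\<dots> = (\<bar>step v s c\<bar> * C / len s) * (\<alpha> + len s * x - t)"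
      using l by (simp add: t field_simps)
    finally show ?thesis using 1 range[of x] u x by (intro exI[of _ "\<alpha> + len s * x"]) auto
  qed
  then show "\<exists>C. \<forall>e>0. \<exists>s. t < s \<and> s < t + e \<and> s \<le> 1 \<and> \<bar>F s - F t\<bar> \<le> C * (s - t)" by blast
  obtain C where C: "C > 0" "\<And>e. e > 0 \<Longrightarrow> \<exists>j\<in>G - (Z0 \<union> Z1). tgt j = d \<and> u < lo j \<and> hi j < u + e \<and>
      hi j - u \<le> C * h j"
    using near[OF u stop, of d] by blast
  have "\<exists>s c \<alpha> i. placed v B s c \<alpha> \<and> i \<in> G - (Z0 \<union> Z1) \<and> tgt i = d \<and>
      t < \<alpha> + len s * lo i \<and> \<alpha> + len s * hi i < t + e \<and> \<alpha> + len s * hi i - t \<le> C * (h i * len s)" if e: "e > 0" for e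
  proof -
    obtain j where j: "j \<in> G - (Z0 \<union> Z1)" "tgt j = d" "u < lo j" "hi j < u + e / len s"
      "hi j - u \<le> C * h j" using C(2)[of "e / len s"] e l by auto
    have "len s * hi j < len s * (u + e / len s)" "len s * u < len s * lo j"
      "len s * (hi j - u) \<le> len s * (C * h j)"
      using j l by (auto simp del: right_diff_distrib)
    then have "t < \<alpha> + len s * lo j" "\<alpha> + len s * hi j < t + e"
      "\<alpha> + len s * hi j - t \<le> C * (h j * len s)"
      using l by (auto simp: t distrib_left algebra_simps)
    then show ?thesis using j p
      by (intro exI[of _ s] exI[of _ c] exI[of _ \<alpha>] exI[of _ j]) auto
  qed
  then show "\<exists>C>0. \<forall>e>0. \<exists>s c \<alpha> i. placed v B s c \<alpha> \<and> i \<in> G - (Z0 \<union> Z1) \<and> tgt i = d \<and>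
        t < \<alpha> + len s * lo i \<and> \<alpha> + len s * hi i < t + e \<and> \<alpha> + len s * hi i - t \<le> C * (h i * len s)"
    using C(1) by blast
qed

text \<open>Loops are found in a gap to the right of the one containing the point, by
  \<open>nbr\<close>, at every depth. Bounded quotients come from the exact returns
  \<open>ret\<close>, in two ways according to whether the flag is ever lost.\<close>

lemma nested_point:
  fixes s :: "nat \<Rightarrow> node" and c \<alpha> u :: "nat \<Rightarrow> real" and j :: "nat \<Rightarrow> 'i"
  assumes v: "admissible v"
    and p: "\<And>n. placed v B (s n) (c n) (\<alpha> n)" and lev: "\<And>n. lev (s n) = n"
    and u: "\<And>n. 0 \<le> u n \<and> u n < 1" and t: "\<And>n. t = \<alpha> n + len (s n) * u n"
    and j: "\<And>n. j n \<in> G \<and> lo (j n) \<le> u n \<and> u n < hi (j n)"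
    and s_Suc: "\<And>n. s (Suc n) = child (s n) (j n)"
    and c_Suc: "\<And>n. c (Suc n) = c n + \<theta> (j n) * step v (s n) (c n)"
    and F: "\<And>x. 0 \<le> x \<Longrightarrow> x \<le> 1 \<Longrightarrow> F x = curve v root (v 0) x"
  shows "\<exists>C. \<forall>e>0. \<exists>s. t < s \<and> s < t + e \<and> s \<le> 1 \<and> \<bar>F s - F t\<bar> \<le> C * (s - t)"
    and "\<exists>C>0. \<forall>e>0. \<exists>s c \<alpha> i. placed v B s c \<alpha> \<and> i \<in> G - (Z0 \<union> Z1) \<and> tgt i = d \<and>
        t < \<alpha> + len s * lo i \<and> \<alpha> + len s * hi i < t + e \<and> \<alpha> + len s * hi i - t \<le> C * (h i * len s)"
proof -
  have l: "0 < len (s n)" for n by (rule placed_len[OF p])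
  have snd: "sound v B (s n) (c n)" for n by (rule placed_sound[OF p])
  have l_le: "len (s n) \<le> (1/2) ^ n" for n using snd[of n] lev[of n] by (simp add: sound_def)
  have \<alpha>: "0 \<le> \<alpha> n" "\<alpha> n + len (s n) \<le> 1" for n using p[of n] by (auto simp: placed_def)
  have t_ge: "\<alpha> n \<le> t" for n using t[of n] l[of n] u[of n] by simp
  have range: "0 \<le> \<alpha> n + len (s n) * x" "\<alpha> n + len (s n) * x \<le> \<alpha> n + len (s n)"
    "\<alpha> n + len (s n) * x \<le> 1"
    if "0 \<le> x" "x \<le> 1" for x n
  proof -
    have "len (s n) * x \<le> len (s n) * 1" using l[of n] that by (intro mult_left_mono) auto
    then show "\<alpha> n + len (s n) * x \<le> \<alpha> n + len (s n)" by simp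
    then show "\<alpha> n + len (s n) * x \<le> 1" using \<alpha>(2)[of n] by linarith
    show "0 \<le> \<alpha> n + len (s n) * x" using l[of n] \<alpha>(1)[of n] that by auto
  qed
  have val: "F (\<alpha> n + len (s n) * x) = curve v (s n) (c n) x" if "0 \<le> x" "x \<le> 1" for x n
    using F[OF range(1,3)[OF that]] placed_curve[OF p that] by simp
  have small: "\<exists>n\<ge>N. len (s n) < e" if e: "e > 0" for e N
  proof -
    obtain n where n: "(1/2::real) ^ n < e" using real_arch_pow_inv[of e "1/2"] e by auto
    have "(1/2::real) ^ max n N \<le> (1/2) ^ n" by (intro power_decreasing) auto
    then have "len (s (max n N)) < e" using n l_le[of "max n N"] by linarith
    then show ?thesis by (intro exI[of _ "max n N"]) simp
  qed
  show "\<exists>C>0. \<forall>e>0. \<exists>s c \<alpha> i. placed v B s c \<alpha> \<and> i \<in> G - (Z0 \<union> Z1) \<and> tgt i = d \<and>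
        t < \<alpha> + len s * lo i \<and> \<alpha> + len s * hi i < t + e \<and> \<alpha> + len s * hi i - t \<le> C * (h i * len s)"
  proof -
    obtain C where C: "C > 0" "\<And>k. k \<in> G \<Longrightarrow> \<exists>i\<in>G - (Z0 \<union> Z1). tgt i = d \<and> hi k \<le> lo i \<and>
        hi i - lo k \<le> C * h i" using nbr[of d] by blast
    have "\<exists>s c \<alpha> i. placed v B s c \<alpha> \<and> i \<in> G - (Z0 \<union> Z1) \<and> tgt i = d \<and>
        t < \<alpha> + len s * lo i \<and> \<alpha> + len s * hi i < t + e \<and> \<alpha> + len s * hi i - t \<le> C * (h i * len s)"
      if e: "e > 0" for e
    proof -
      obtain n where n: "len (s n) < e" using small[OF e, of 0] by blast
      obtain i where i: "i \<in> G - (Z0 \<union> Z1)" "tgt i = d" "hi (j n) \<le> lo i"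
        "hi i - lo (j n) \<le> C * h i" using C(2)[of "j n"] j[of n] by blast
      have "u n < lo i" "hi i - u n \<le> C * h i" using i j[of n] by auto
      then have "len (s n) * u n < len (s n) * lo i"
        "len (s n) * (hi i - u n) \<le> len (s n) * (C * h i)" using l[of n] by auto
      then have "t < \<alpha> n + len (s n) * lo i" "\<alpha> n + len (s n) * hi i - t \<le> C * (h i * len (s n))"
        by (auto simp: t[of n] algebra_simps)
      moreover have "\<alpha> n + len (s n) * hi i < t + e"
        using range(2)[of "hi i" n] gap[of i] i(1) n t_ge[of n] by auto
      ultimately show ?thesis using i p[of n]
        by (intro exI[of _ "s n"] exI[of _ "c n"] exI[of _ "\<alpha> n"] exI[of _ i]) auto
    qed
    then show ?thesis using C(1) by blast
  qed
  \<comment> \<open>These are the returns: at \<open>r n\<close> the surrounding node takes the base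
    value of the next node, at least \<open>h (j n)\<close> beyond the gap.\<close>
  obtain r where r: "\<And>n. hi (j n) + h (j n) \<le> r n \<and> r n \<le> 1 \<and> free (r n) \<and> \<psi> (r n) = \<theta> (j n)"
  proof -
    have "\<exists>x. hi (j n) + h (j n) \<le> x \<and> x \<le> 1 \<and> free x \<and> \<psi> x = \<theta> (j n)" for n
      using ret[of "j n"] j[of n] unfolding free_def by blast
    then show ?thesis using that by metis
  qed
  define x where "x n = \<alpha> n + len (s n) * r n" for n
  have r01: "0 \<le> r n" "r n \<le> 1" for n
    using r[of n] j[of n] gap[of "j n"] h_pos[of "j n"] by auto
  have Fx: "F (x n) = c (Suc n)" for n
    unfolding x_def using val[OF r01] curve_free[of "r n"] r[of n] c_Suc[of n] by simp
  have x_ge: "h (j n) * len (s n) \<le> x n - t" for n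
  proof -
    have "h (j n) * len (s n) \<le> (r n - u n) * len (s n)"
      using r[of n] j[of n] l[of n] by (intro mult_right_mono) auto
    then show ?thesis by (simp add: x_def t[of n] algebra_simps)
  qed
  have x_gt: "t < x n" for n
    using x_ge[of n] mult_pos_pos[OF h_pos[of "j n"] l[of n]] j[of n] by auto
  have x_le: "x n \<le> 1" "x n \<le> t + len (s n)" for n
    using range[OF r01, of n n] t_ge[of n] by (auto simp: x_def)
  show "\<exists>C. \<forall>e>0. \<exists>s. t < s \<and> s < t + e \<and> s \<le> 1 \<and> \<bar>F s - F t\<bar> \<le> C * (s - t)"
  proof (cases "\<exists>N. flag (s N) = None")
    case True
    then obtain N where N: "flag (s N) = None" by blast
    have none: "flag (s n) = None" if "n \<ge> N" for n
      using that by (induction n rule: dec_induct) (auto simp: N s_Suc jumps_def)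
    have *: "\<bar>F (x n) - F t\<bar> \<le> 4 * B * (x n - t)" if n: "n \<ge> N" for n
    proof -
      have B: "0 \<le> B" by (rule sound_nonneg[OF snd])
      have "F t = curve v (s (Suc n)) (c (Suc n)) (u (Suc n))"
        using val[of "u (Suc n)" "Suc n"] u[of "Suc n"] t[of "Suc n"] by auto
      \<comment> \<open>Without a flag the curve leaves the base value \<open>F (x n)\<close> by at
        most \<open>4 * B * h (j n) * len (s n)\<close>, while the return is at least
        \<open>h (j n) * len (s n)\<close> away.\<close>
      then have "\<bar>F t - F (x n)\<bar> \<le> 2 * B * (amp (s (Suc n)) + len (s (Suc n)))"
        using curve_small[OF v snd[of "Suc n"] none, of "u (Suc n)"] u[of "Suc n"] n Fx by simp
      also have "\<dots> \<le> 2 * B * (2 * h (j n) * len (s n))"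
        using child_size(1)[OF snd[of n], of "j n"] j[of n] B unfolding s_Suc
        by (intro mult_left_mono) auto
      also have "\<dots> \<le> 2 * B * (2 * (x n - t))"
        using x_ge[of n] B by (intro mult_left_mono) auto
      finally show ?thesis by (simp add: abs_minus_commute algebra_simps)
    qed
    have "\<exists>s. t < s \<and> s < t + e \<and> s \<le> 1 \<and> \<bar>F s - F t\<bar> \<le> 4 * B * (s - t)" if e: "e > 0" for e
    proof -
      obtain n where n: "n \<ge> N" "len (s n) < e" using small[OF e, of N] by blast
      then have "x n < t + e" using x_le(2)[of n] by linarith
      then show ?thesis using x_gt[of n] x_le(1)[of n] * [OF n(1)]
        by (intro exI[of _ "x n"] conjI)
    qed
    then show ?thesis by blast
  next
    case False
    define k where "k n = the (flag (s n))" for n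
    have k: "flag (s n) = Some (k n)" for n using False by (auto simp: k_def)
    \<comment> \<open>The flags along the chain either stay or jump from a parent at the matching
      depth, so they stabilize. From then on the base is one fixed value, equal to
      \<open>F t\<close>, and the returns have difference quotient zero.\<close>
    have "k (Suc n) = k n \<or> n > 0 \<and> k (Suc n) = n \<and> k n = parent n" for n
      using k[of "Suc n"] k[of n] lev[of n] by (auto simp: s_Suc jumps_def split: if_splits)
    then obtain N where N: "\<And>n. n \<ge> N \<Longrightarrow> k (Suc n) = k n" using parent_chain_stops[of k] by blast
    have kN: "k n = k N" if "n \<ge> N" for n
      using that by (induction n rule: dec_induct) (auto simp: N)
    have cN: "c n = v (k N)" if "n \<ge> N" for n
      using snd[of n] k[of n] kN[OF that] by (simp add: sound_def)
    have "\<bar>F t - v (k N)\<bar> \<le> e" if e: "e > 0" for e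
    proof -
      obtain N0 where N0: "\<And>s c u. sound v B s c \<Longrightarrow> N0 \<le> lev s \<Longrightarrow> 0 \<le> u \<Longrightarrow> u \<le> 1 \<Longrightarrow>
           \<bar>curve v s c u - c\<bar> \<le> e" using curve_osc[OF v e] by metis
      define n where "n = max N0 N"
      have "\<bar>curve v (s n) (c n) (u n) - c n\<bar> \<le> e"
        using N0[OF snd[of n], of "u n"] lev[of n] u[of n] by (auto simp: n_def)
      then show ?thesis using val[of "u n" n] u[of n] t[of n] cN[of n] by (simp add: n_def)
    qed
    then have "F t = v (k N)" using dense_ge[of 0 "\<bar>F t - v (k N)\<bar>"] by auto
    then have *: "F (x n) = F t" if "n \<ge> N" for n using Fx[of n] cN[of "Suc n"] that by simp
    have "\<exists>s. t < s \<and> s < t + e \<and> s \<le> 1 \<and> \<bar>F s - F t\<bar> \<le> 0 * (s - t)" if e: "e > 0" for e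
    proof -
      obtain n where n: "n \<ge> N" "len (s n) < e" using small[OF e, of N] by blast
      then have "x n < t + e" using x_le(2)[of n] by linarith
      then show ?thesis using x_gt[of n] x_le(1)[of n] * [OF n(1)] by (intro exI[of _ "x n"]) simp
    qed
    then show ?thesis by blast
  qed
qed

text \<open>Gaps are half-open here because to the right of a left endpoint the curve is governed by
  the inside of the gap. If no node has the point outside all its gaps, dependent choice follows the
  point through an infinite chain.\<close>

lemma curve_no_right_derivative:
  assumes v: "admissible v" "\<And>e. \<bar>v e\<bar> \<le> B" "v e0 \<noteq> 0"
    and t: "0 \<le> t" "t < 1"
    and F: "\<And>x. 0 \<le> x \<Longrightarrow> x \<le> 1 \<Longrightarrow> F x = curve v root (v 0) x"
  shows "\<nexists>l::ereal. ((\<lambda>x. ereal ((F x - F t) / (x - t))) \<longlongrightarrow> l) (at_right t)"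
proof (cases "\<exists>s c \<alpha> u. placed v B s c \<alpha> \<and> 0 \<le> u \<and> u < 1 \<and> t = \<alpha> + len s * u \<and>
    (\<forall>j\<in>G. \<not> (lo j \<le> u \<and> u < hi j))")
  case True
  then obtain s c \<alpha> u where p: "placed v B s c \<alpha>" "0 \<le> u" "u < 1"
    "\<And>j. j \<in> G \<Longrightarrow> \<not> (lo j \<le> u \<and> u < hi j)" "t = \<alpha> + len s * u" by blast
  note sp = stopping_point[where F = F, OF v(1) p F]
  show ?thesis by (rule no_right_derivative_curve[OF v t F sp(1) sp(2)])
next
  case False
  then have ex: "\<exists>j\<in>G. lo j \<le> u \<and> u < hi j"
    if "placed v B s c \<alpha>" "0 \<le> u" "u < 1" "t = \<alpha> + len s * u" for s c \<alpha> u using that by blast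
  let ?P = "\<lambda>n (s, c, \<alpha>, u). placed v B s c \<alpha> \<and> lev s = n \<and> 0 \<le> u \<and> u < 1 \<and> t = \<alpha> + len s * u"
  let ?Q = "\<lambda>n (s, c, \<alpha>, u) (s', c', \<alpha>', u'). \<exists>j. j \<in> G \<and> lo j \<le> u \<and> u < hi j \<and>
      s' = child s j \<and> c' = c + \<theta> j * step v s c"
  have "\<exists>f. \<forall>n. ?P n (f n) \<and> ?Q n (f n) (f (Suc n))"
  proof (rule dependent_nat_choice)
    show "\<exists>x. ?P 0 x"
      using placed_root[OF v(2)] t
      by (intro exI[of _ "(root, v 0, 0, t)"]) (auto simp: root_def)
  next
    fix x n assume P: "?P n x"
    obtain s c \<alpha> u where x: "x = (s, c, \<alpha>, u)" by (cases x)
    with P have p: "placed v B s c \<alpha>" "lev s = n" "0 \<le> u" "u < 1" "t = \<alpha> + len s * u" by auto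
    obtain j where j: "j \<in> G" "lo j \<le> u" "u < hi j" using ex[OF p(1,3,4,5)] by blast
    define u' where "u' = (u - lo j) / (hi j - lo j)"
    have u': "0 \<le> u'" "u' < 1" using j by (auto simp: u'_def divide_simps)
    have "(hi j - lo j) * u' = u - lo j" using j by (simp add: u'_def)
    then have "t = \<alpha> + len s * lo j + len s * ((hi j - lo j) * u')"
      using p(5) by (simp only:) (simp add: algebra_simps)
    then have "t = \<alpha> + len s * lo j + len (child s j) * u'" by (simp add: mult_ac)
    then have "?P (Suc n) (child s j, c + \<theta> j * step v s c, \<alpha> + len s * lo j, u')"
      using placed_child[OF v(1) p(1) j(1)] p(2) u' by auto
    moreover have "?Q n x (child s j, c + \<theta> j * step v s c, \<alpha> + len s * lo j, u')"
      using j x by auto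
    ultimately show "\<exists>y. ?P (Suc n) y \<and> ?Q n x y" by blast
  qed
  then obtain f where f: "\<forall>n. ?P n (f n) \<and> ?Q n (f n) (f (Suc n))" by blast
  define s where "s n = fst (f n)" for n
  define c where "c n = fst (snd (f n))" for n
  define \<alpha> where "\<alpha> n = fst (snd (snd (f n)))" for n
  define u where "u n = snd (snd (snd (f n)))" for n
  have fn: "f n = (s n, c n, \<alpha> n, u n)" for n by (simp add: s_def c_def \<alpha>_def u_def)
  have P: "placed v B (s n) (c n) (\<alpha> n)" "lev (s n) = n" "0 \<le> u n \<and> u n < 1"
    "t = \<alpha> n + len (s n) * u n" for n using f[rule_format, of n] by (auto simp: fn)
  have "\<exists>j. \<forall>n. j n \<in> G \<and> lo (j n) \<le> u n \<and> u n < hi (j n) \<and> s (Suc n) = child (s n) (j n) \<and>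
      c (Suc n) = c n + \<theta> (j n) * step v (s n) (c n)"
    using f by (intro choice) (auto simp: fn)
  then obtain j where j: "\<And>n. j n \<in> G \<and> lo (j n) \<le> u n \<and> u n < hi (j n)"
    "\<And>n. s (Suc n) = child (s n) (j n)" "\<And>n. c (Suc n) = c n + \<theta> (j n) * step v (s n) (c n)"
    by blast
  note np = nested_point[where F = F and s = s and c = c and \<alpha> = \<alpha> and u = u and j = j, OF v(1) P j F]
  show ?thesis by (rule no_right_derivative_curve[OF v t F np(1) np(2)])
qed

text \<open>The curve equals its reflection, under which left quotients become negated right
  quotients.\<close>

lemma curve_no_left_derivative:
  assumes v: "admissible v" "\<And>e. \<bar>v e\<bar> \<le> B" "v e0 \<noteq> 0"
    and t: "0 < t" "t \<le> 1"
    and F: "\<And>x. 0 \<le> x \<Longrightarrow> x \<le> 1 \<Longrightarrow> F x = curve v root (v 0) x"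
  shows "\<nexists>l::ereal. ((\<lambda>x. ereal ((F x - F t) / (x - t))) \<longlongrightarrow> l) (at_left t)"
proof
  define H where "H x = F (1 - x)" for x
  have H: "H x = curve v root (v 0) x" if "0 \<le> x" "x \<le> 1" for x
    using that F[of "1 - x"] curve_symmetric[of x v root "v 0"] by (simp add: H_def)
  assume "\<exists>l::ereal. ((\<lambda>x. ereal ((F x - F t) / (x - t))) \<longlongrightarrow> l) (at_left t)"
  then obtain l where "((\<lambda>x. ereal ((F x - F t) / (x - t))) \<longlongrightarrow> l) (at_left t)" by blast
  moreover have "filterlim (\<lambda>x. 1 - x) (at_left t) (at_right (1 - t))"
    unfolding filterlim_at by (auto intro!: tendsto_eq_intros simp: eventually_at_filter)
  ultimately have "((\<lambda>x. ereal ((F (1 - x) - F t) / (1 - x - t))) \<longlongrightarrow> l) (at_right (1 - t))"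
    by (rule filterlim_compose)
  then have "((\<lambda>x. - ereal ((F (1 - x) - F t) / (1 - x - t))) \<longlongrightarrow> - l) (at_right (1 - t))"
    by (intro tendsto_intros)
  moreover have "- ereal ((F (1 - x) - F t) / (1 - x - t)) = ereal ((H x - H (1 - t)) / (x - (1 - t)))" for x
  proof -
    have "x - (1 - t) = - (1 - x - t)" by simp
    then show ?thesis by (simp only: H_def minus_divide_right[symmetric] uminus_ereal.simps) simp
  qed
  ultimately show False
    using curve_no_right_derivative[where F = H, OF v _ _ H, of "1 - t"] t by auto
qed

end

section \<open>A fat Cantor staircase\<close>

text \<open>For nonnegative \<open>y\<close> the rounded number \<open>2 ^ k * y\<close> counts the
  odd multiples of \<open>1 / 2 ^ Suc k\<close> to the left of \<open>y\<close>, each of which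
  carries a gap of width \<open>1 / 4 ^ Suc k\<close>. So the sum is the total width of the gaps
  before \<open>y\<close>; ties are rounded down here and up in \<open>stair_hi\<close>, which
  includes a gap at \<open>y\<close> itself.\<close>

definition stair_lo :: "real \<Rightarrow> real" where
  "stair_lo y = y / 2 + (\<Sum>k. of_int \<lceil>2 ^ k * y - 1/2\<rceil> / 4 ^ Suc k)"

definition stair_hi :: "real \<Rightarrow> real" where
  "stair_hi y = y / 2 + (\<Sum>k. of_int \<lfloor>2 ^ k * y + 1/2\<rfloor> / 4 ^ Suc k)"

lemma summable_stair:
  assumes "\<And>k. \<bar>f k - 2 ^ k * y\<bar> \<le> 2"
  shows "summable (\<lambda>k. f k / 4 ^ Suc k :: real)"
proof (rule summable_comparison_test'[where g = "\<lambda>k. (\<bar>y\<bar> + 2) * (1/2) ^ k" and N = 0])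
  show "summable (\<lambda>k. (\<bar>y\<bar> + 2) * (1/2::real) ^ k)"
    by (intro summable_mult summable_geometric) simp
  fix k :: nat
  have "\<bar>f k\<bar> \<le> \<bar>2 ^ k * y\<bar> + 2" using assms[of k] by linarith
  also have "\<dots> \<le> (\<bar>y\<bar> + 2) * 2 ^ k" by (simp add: abs_mult algebra_simps)
  finally have "\<bar>f k\<bar> / 4 ^ Suc k \<le> (\<bar>y\<bar> + 2) * 2 ^ k / 4 ^ k"
    by (intro frac_le) auto
  also have "\<dots> = (\<bar>y\<bar> + 2) * (1/2) ^ k"
  proof -
    have "(4::real) ^ k = 2 ^ k * 2 ^ k" by (simp flip: power_mult_distrib)
    then show ?thesis by (simp add: power_divide)
  qed
  finally show "norm (f k / 4 ^ Suc k) \<le> (\<bar>y\<bar> + 2) * (1/2) ^ k" by simp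
qed

lemma summable_lo: fixes y :: real shows "summable (\<lambda>k. real_of_int \<lceil>2 ^ k * y - 1/2\<rceil> / 4 ^ Suc k)"
proof (rule summable_stair)
  have "\<bar>of_int \<lceil>b - 1/2\<rceil> - b\<bar> \<le> 2" for b :: real by linarith
  then show "\<bar>of_int \<lceil>2 ^ k * y - 1/2\<rceil> - 2 ^ k * y\<bar> \<le> 2" for k .
qed

lemma summable_hi: fixes y :: real shows "summable (\<lambda>k. real_of_int \<lfloor>2 ^ k * y + 1/2\<rfloor> / 4 ^ Suc k)"
proof (rule summable_stair)
  have "\<bar>of_int \<lfloor>b + 1/2\<rfloor> - b\<bar> \<le> 2" for b :: real by linarith
  then show "\<bar>of_int \<lfloor>2 ^ k * y + 1/2\<rfloor> - 2 ^ k * y\<bar> \<le> 2" for k .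
qed

lemma stair_lo_le_hi: "stair_lo y \<le> stair_hi y"
proof -
  have "\<lceil>b - 1/2\<rceil> \<le> \<lfloor>b + 1/2 :: real\<rfloor>" for b by linarith
  then have "real_of_int \<lceil>2 ^ k * y - 1/2\<rceil> \<le> of_int \<lfloor>2 ^ k * y + 1/2\<rfloor>" for k
    unfolding of_int_le_iff .
  then show ?thesis unfolding stair_lo_def stair_hi_def
    by (intro add_left_mono suminf_le summable_lo summable_hi divide_right_mono) auto
qed

text \<open>The sums are monotone, so the linear part \<open>y / 2\<close> survives as a lower bound
  for the growth. This is the positive measure of the Cantor set, and makes the inverse Lipschitz
  with constant 2.\<close>

lemma stair_gap: assumes "x < y" shows "y - x \<le> 2 * (stair_lo y - stair_hi x)"
proof -
  have "\<lfloor>a + 1/2\<rfloor> \<le> \<lceil>b - 1/2\<rceil>" if "a < b" for a b :: real using that by linarith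
  then have "real_of_int \<lfloor>2 ^ k * x + 1/2\<rfloor> \<le> of_int \<lceil>2 ^ k * y - 1/2\<rceil>" for k
    unfolding of_int_le_iff using assms by simp
  then have "(\<Sum>k. real_of_int \<lfloor>2 ^ k * x + 1/2\<rfloor> / 4 ^ Suc k) \<le> (\<Sum>k. of_int \<lceil>2 ^ k * y - 1/2\<rceil> / 4 ^ Suc k)"
    by (intro suminf_le summable_lo summable_hi divide_right_mono) auto
  then show ?thesis unfolding stair_lo_def stair_hi_def by (simp add: field_simps)
qed

lemma stair_less: "x < y \<Longrightarrow> stair_hi x < stair_lo y"
  using stair_gap[of x y] by simp

lemma stair_hi_mono: "x \<le> y \<Longrightarrow> stair_hi x \<le> stair_hi y"
  using stair_less[of x y] stair_lo_le_hi[of y] by (cases "x = y") auto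

lemma stair_lo_mono: "x \<le> y \<Longrightarrow> stair_lo x \<le> stair_lo y"
  using stair_less[of x y] stair_lo_le_hi[of x] by (cases "x = y") auto

text \<open>The total width of the gaps: \<open>2 ^ k\<close> of them at each level
  \<open>k\<close>.\<close>

lemma sums_half_power: "(\<lambda>k. 2 ^ k / 4 ^ Suc k :: real) sums (1/2)"
proof -
  have "2 ^ k / 4 ^ Suc k = 1/4 * (1/2::real) ^ k" for k
  proof -
    have "(4::real) ^ k = 2 ^ k * 2 ^ k" by (simp flip: power_mult_distrib)
    then show ?thesis by (simp add: power_divide)
  qed
  then have "(\<lambda>k. 2 ^ k / 4 ^ Suc k :: real) = (\<lambda>k. 1/4 * (1/2) ^ k)" by blast
  moreover have "(\<lambda>k. 1/4 * (1/2::real) ^ k) sums (1/4 * (1 / (1 - 1/2)))"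
    by (intro sums_mult geometric_sums) simp
  ultimately show ?thesis by (simp only:) simp
qed

lemma stair_reflect: "stair_lo (1 - y) = 1 - stair_hi y"
proof -
  have "\<lceil>2 ^ k * (1 - y) - 1/2\<rceil> = 2 ^ k - \<lfloor>2 ^ k * y + 1/2\<rfloor>" for k
  proof -
    have "2 ^ k * (1 - y) - 1/2 = of_int (2 ^ k) - (2 ^ k * y + 1/2)" by (simp add: algebra_simps)
    then show ?thesis by (simp only: ceiling_def minus_diff_eq) linarith
  qed
  then have "(\<Sum>k. real_of_int \<lceil>2 ^ k * (1 - y) - 1/2\<rceil> / 4 ^ Suc k) =
      (\<Sum>k. 2 ^ k / 4 ^ Suc k - of_int \<lfloor>2 ^ k * y + 1/2\<rfloor> / 4 ^ Suc k)"
    by (simp add: diff_divide_distrib)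
  also have "\<dots> = 1/2 - (\<Sum>k. of_int \<lfloor>2 ^ k * y + 1/2\<rfloor> / 4 ^ Suc k)"
    using sums_half_power suminf_diff[OF _ summable_hi, of "\<lambda>k. 2 ^ k / 4 ^ Suc k" y]
    unfolding sums_iff by metis
  finally show ?thesis by (simp add: stair_lo_def stair_hi_def diff_divide_distrib)
qed

lemma stair_0: "stair_lo 0 = 0" "stair_hi 0 = 0"
proof -
  have "\<lceil>- (1/2) :: real\<rceil> = 0" "\<lfloor>1/2 :: real\<rfloor> = 0" by linarith+
  then show "stair_lo 0 = 0" "stair_hi 0 = 0" by (simp_all add: stair_lo_def stair_hi_def)
qed

lemma stair_1: "stair_lo 1 = 1" "stair_hi 1 = 1"
  using stair_reflect[of 0] stair_reflect[of 1] stair_0 by simp_all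

lemma stair_range:
  assumes "0 \<le> y" "y \<le> 1"
  shows "0 \<le> stair_lo y" "stair_lo y \<le> 1" "0 \<le> stair_hi y" "stair_hi y \<le> 1"
  using stair_lo_mono[of 0 y] stair_lo_mono[of y 1] stair_hi_mono[of 0 y] stair_hi_mono[of y 1]
    stair_0 stair_1 assms by auto

text \<open>Half of the bound comes from the linear part, the other half from gaps at levels
  \<open>r\<close> and above.\<close>

lemma stair_cell:
  fixes i :: int
  shows "stair_lo ((of_int i + 1) / 2 ^ r) - stair_hi (of_int i / 2 ^ r) \<le> 1 / 2 ^ r"
proof -
  let ?x = "of_int i / 2 ^ r :: real" and ?y = "(of_int i + 1) / 2 ^ r :: real"
  have summand: "real_of_int \<lceil>2 ^ k * ?y - 1/2\<rceil> - of_int \<lfloor>2 ^ k * ?x + 1/2\<rfloor> \<le> 2 ^ k / 2 ^ r" for k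
  \<comment> \<open>Between neighbouring multiples of \<open>1 / 2 ^ r\<close> there is no gap
    position of level below \<open>r\<close>, and there are exactly \<open>2 ^ (k - r)\<close> of
    each level \<open>k\<close> from \<open>r\<close> on.\<close>
  proof (cases "k < r")
    case True
    define s where "s = r - Suc k"
    have r: "(2::real) ^ r = 2 ^ k * (2 * 2 ^ s)"
      using True by (simp add: s_def flip: power_add power_Suc)
    define n where "n = \<lfloor>2 ^ k * ?x + 1/2\<rfloor>"
    have eqs: "2 ^ k * ?x = of_int i / (2 * 2 ^ s)" "2 ^ k * ?y = (of_int i + 1) / (2 * 2 ^ s)"
      by (simp_all add: r)
    have "2 ^ k * ?x + 1/2 < of_int n + 1" unfolding n_def by linarith
    then have "of_int i < (of_int n + 1/2) * (2 * 2 ^ s :: real)"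
      unfolding eqs by (simp add: field_simps)
    also have "\<dots> = of_int ((2 * n + 1) * 2 ^ s)" by (simp add: algebra_simps)
    finally have "i + 1 \<le> (2 * n + 1) * 2 ^ s" unfolding of_int_less_iff by simp
    then have "real_of_int (i + 1) \<le> of_int ((2 * n + 1) * 2 ^ s)" unfolding of_int_le_iff .
    then have "2 ^ k * ?y - 1/2 \<le> of_int n" unfolding eqs by (simp add: field_simps)
    then have "real_of_int \<lceil>2 ^ k * ?y - 1/2\<rceil> \<le> of_int n" by (simp add: ceiling_le_iff)
    moreover have "0 \<le> (2::real) ^ k / 2 ^ r" by simp
    ultimately show ?thesis unfolding n_def by linarith
  next
    case False
    have e: "(2::real) ^ k = 2 ^ r * 2 ^ (k - r)" using False by (simp flip: power_add)
    have x: "2 ^ k * ?x = of_int (2 ^ (k - r) * i)" and y: "2 ^ k * ?y = of_int (2 ^ (k - r) * (i + 1))"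
      by (simp_all add: e)
    have round: "\<lfloor>of_int z + 1/2 :: real\<rfloor> = z" "\<lceil>of_int z - 1/2 :: real\<rceil> = z" for z by linarith+
    show ?thesis unfolding x y round by (simp add: e algebra_simps)
  qed
  let ?d = "\<lambda>k. real_of_int \<lceil>2 ^ k * ?y - 1/2\<rceil> / 4 ^ Suc k - of_int \<lfloor>2 ^ k * ?x + 1/2\<rfloor> / 4 ^ Suc k"
  have g: "(\<lambda>k. 1 / 2 ^ r * (2 ^ k / 4 ^ Suc k) :: real) sums (1 / 2 ^ r * (1/2))"
    by (intro sums_mult sums_half_power)
  have "(\<Sum>k. ?d k) \<le> (\<Sum>k. 1 / 2 ^ r * (2 ^ k / 4 ^ Suc k) :: real)"
  proof (intro suminf_le summable_diff summable_lo summable_hi sums_summable[OF g])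
    fix k
    have "?d k = (real_of_int \<lceil>2 ^ k * ?y - 1/2\<rceil> - of_int \<lfloor>2 ^ k * ?x + 1/2\<rfloor>) / 4 ^ Suc k"
      by (simp add: diff_divide_distrib)
    also have "\<dots> \<le> (2 ^ k / 2 ^ r) / 4 ^ Suc k"
      by (intro divide_right_mono summand) simp
    finally show "?d k \<le> 1 / 2 ^ r * (2 ^ k / 4 ^ Suc k)" by simp
  qed
  also have "\<dots> = 1 / 2 ^ r * (1/2)" using g by (simp add: sums_iff)
  finally have "(\<Sum>k. real_of_int \<lceil>2 ^ k * ?y - 1/2\<rceil> / 4 ^ Suc k) -
      (\<Sum>k. of_int \<lfloor>2 ^ k * ?x + 1/2\<rfloor> / 4 ^ Suc k) \<le> 1 / 2 ^ r * (1/2)"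
    by (subst suminf_diff[OF summable_lo summable_hi])
  moreover have "?y / 2 - ?x / 2 = 1 / 2 ^ r * (1/2)" by (simp add: add_divide_distrib)
  ultimately show ?thesis unfolding stair_lo_def stair_hi_def by linarith
qed

section \<open>The positions of the gaps\<close>

definition pt :: "nat \<Rightarrow> nat \<Rightarrow> real" where
  "pt k m = (2 * real m + 1) / 2 ^ Suc k"

lemma pt_range: "m < 2 ^ k \<Longrightarrow> 0 < pt k m \<and> pt k m < 1"
proof -
  assume "m < 2 ^ k"
  then have "2 * m + 1 < 2 ^ Suc k" by simp
  then have "real (2 * m + 1) < real (2 ^ Suc k)" by (simp only: of_nat_less_iff)
  then show ?thesis by (simp add: pt_def)
qed

text \<open>Both sides become an odd number times a power of two, and the exponents must
  match.\<close>

lemma pt_half_integer: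
  assumes "2 ^ i * pt k m = of_int n + 1/2" shows "i = k"
proof (rule ccontr)
  assume "i \<noteq> k"
  have "2 ^ i * (2 * real m + 1) = (of_int n + 1/2) * 2 ^ Suc k"
    using assms by (simp add: pt_def field_simps)
  then have "real_of_int (2 ^ i * (2 * int m + 1)) = of_int ((2 * n + 1) * 2 ^ k)"
    by (simp add: algebra_simps)
  then have eq: "2 ^ i * (2 * int m + 1) = (2 * n + 1) * 2 ^ k" unfolding of_int_eq_iff .
  show False
  proof (cases "i < k")
    case True
    then have "(2::int) ^ k = 2 ^ i * (2 * 2 ^ (k - Suc i))" by (simp flip: power_add power_Suc)
    then have "2 * int m + 1 = 2 * ((2 * n + 1) * 2 ^ (k - Suc i))" using eq by simp
    then show False by presburger
  next
    case False
    then have "(2::int) ^ i = 2 ^ k * (2 * 2 ^ (i - Suc k))"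
      using \<open>i \<noteq> k\<close> by (simp flip: power_add power_Suc)
    then have "2 * n + 1 = 2 * ((2 * int m + 1) * 2 ^ (i - Suc k))" using eq by (simp add: mult_ac)
    then show False by presburger
  qed
qed

lemma pt_inject: "pt k m = pt k' m' \<longleftrightarrow> k = k' \<and> m = m'"
proof
  assume eq: "pt k m = pt k' m'"
  have "2 ^ k * pt k m = of_int (int m) + 1/2" by (simp add: pt_def field_simps)
  then have "k = k'" using pt_half_integer[of k k' m' "int m"] eq by simp
  then show "k = k' \<and> m = m'" using eq by (auto simp: pt_def)
qed auto

lemma half_integer_jump:
  "\<lfloor>b + 1/2 :: real\<rfloor> - \<lceil>b - 1/2\<rceil> = (if \<exists>n::int. b = of_int n + 1/2 then 1 else 0)"
proof (cases "\<exists>n::int. b = of_int n + 1/2")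
  case True
  then obtain n :: int where "b = of_int n + 1/2" by blast
  then show ?thesis by simp
next
  case False
  have "\<lfloor>b + 1/2\<rfloor> \<noteq> b + 1/2"
  proof
    assume "\<lfloor>b + 1/2\<rfloor> = b + 1/2"
    then have "b = of_int (\<lfloor>b + 1/2\<rfloor> - 1) + 1/2" unfolding of_int_diff of_int_1 by linarith
    then show False using False by blast
  qed
  then have "\<lfloor>b + 1/2\<rfloor> - \<lceil>b - 1/2\<rceil> = 0" by linarith
  with False show ?thesis by simp
qed

lemma stair_jump:
  "stair_hi y - stair_lo y = (\<Sum>k. (if \<exists>n::int. 2 ^ k * y = of_int n + 1/2 then 1 else 0) / 4 ^ Suc k)"
proof -
  have "(\<Sum>k. real_of_int \<lfloor>2 ^ k * y + 1/2\<rfloor> / 4 ^ Suc k) - (\<Sum>k. of_int \<lceil>2 ^ k * y - 1/2\<rceil> / 4 ^ Suc k) =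
      (\<Sum>k. of_int (\<lfloor>2 ^ k * y + 1/2\<rfloor> - \<lceil>2 ^ k * y - 1/2\<rceil>) / 4 ^ Suc k)"
    by (subst suminf_diff[OF summable_hi summable_lo]) (simp add: diff_divide_distrib)
  then show ?thesis
    unfolding stair_lo_def stair_hi_def half_integer_jump by (simp add: if_distrib cong: if_cong)
qed

lemma stair_pt: "stair_hi (pt k m) - stair_lo (pt k m) = 1 / 4 ^ Suc k"
proof -
  have "(\<exists>n::int. 2 ^ i * pt k m = of_int n + 1/2) \<longleftrightarrow> i = k" for i
  proof
    assume "i = k"
    then have "2 ^ i * pt k m = of_int (int m) + 1/2" by (simp add: pt_def field_simps)
    then show "\<exists>n::int. 2 ^ i * pt k m = of_int n + 1/2" by blast
  qed (use pt_half_integer in blast)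
  then have "stair_hi (pt k m) - stair_lo (pt k m) = (\<Sum>i. if i = k then 1 / 4 ^ Suc i else 0)"
    unfolding stair_jump by (intro suminf_cong) simp
  also have "\<dots> = 1 / 4 ^ Suc k"
    using sums_single[of k "\<lambda>i. 1 / 4 ^ Suc i :: real"] by (simp add: sums_iff eq_commute)
  finally show ?thesis .
qed

lemma stair_jump_pt:
  assumes "stair_lo y < stair_hi y" "0 \<le> y" "y \<le> 1"
  shows "\<exists>k m. m < 2 ^ k \<and> y = pt k m"
proof -
  have "\<exists>k. \<exists>n::int. 2 ^ k * y = of_int n + 1/2"
  proof (rule ccontr)
    assume "\<not> ?thesis"
    then have "stair_hi y - stair_lo y = 0" unfolding stair_jump by simp
    then show False using assms by simp
  qed
  then obtain k and n :: int where n: "2 ^ k * y = of_int n + 1/2" by blast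
  have "(0::real) \<le> 2 ^ k * y" "2 ^ k * y \<le> 2 ^ k" using assms by auto
  then have "real_of_int 0 < of_int (n + 1)" "real_of_int n < of_int (2 ^ k)"
    unfolding n of_int_add of_int_power of_int_0 of_int_1 of_int_numeral by linarith+
  then have "0 < n + 1" "n < 2 ^ k" unfolding of_int_less_iff .
  then have "0 \<le> n" "n < 2 ^ k" by auto
  then have "nat n < 2 ^ k" "real (nat n) = of_int n" by (auto simp: nat_less_iff)
  moreover from this have "y = pt k (nat n)" using n by (simp add: pt_def field_simps)
  ultimately show ?thesis by blast
qed

section \<open>The staircase function, inverse to the jump function\<close>

definition stair_inv :: "real \<Rightarrow> real" where
  "stair_inv t = Sup {y. 0 \<le> y \<and> y \<le> 1 \<and> stair_lo y \<le> t}"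

text \<open>The sup is attained up to the jump there: by \<open>stair_cell\<close>, neighbouring
  points on fine dyadic grids bring \<open>stair_lo\<close> and \<open>stair_hi\<close> arbitrarily
  close across it.\<close>

lemma stair_inv:
  assumes t: "0 \<le> t" "t \<le> 1"
  shows "0 \<le> stair_inv t" "stair_inv t \<le> 1" "stair_lo (stair_inv t) \<le> t" "t \<le> stair_hi (stair_inv t)"
proof -
  let ?A = "{y. 0 \<le> y \<and> y \<le> 1 \<and> stair_lo y \<le> t}"
  define y where "y = stair_inv t"
  have ne: "0 \<in> ?A" using t stair_0 by simp
  have bdd: "bdd_above ?A" by (auto simp: bdd_above_def)
  have up: "z \<le> y" if "z \<in> ?A" for z
    unfolding y_def stair_inv_def by (rule cSup_upper[OF that bdd])
  have "y \<le> 1" unfolding y_def stair_inv_def by (rule cSup_least) (use ne in blast, simp)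
  with up[OF ne] have y: "0 \<le> y" "y \<le> 1" by simp_all
  then show "0 \<le> stair_inv t" "stair_inv t \<le> 1" by (auto simp: y_def)
  show "t \<le> stair_hi (stair_inv t)"
  proof (rule ccontr)
    assume "\<not> ?thesis"
    then have gt: "stair_hi y < t" by (simp add: y_def)
    then have y1: "y < 1" using stair_1 t y by (cases "y = 1") auto
    obtain r where r: "(1/2::real) ^ r < t - stair_hi y" using real_arch_pow_inv[of "t - stair_hi y" "1/2"] gt by auto
    define i where "i = \<lfloor>2 ^ r * y\<rfloor>"
    have i: "of_int i \<le> 2 ^ r * y" "2 ^ r * y < of_int i + 1" unfolding i_def by linarith+
    have "2 ^ r * y < 2 ^ r * 1" using y1 by (intro mult_strict_left_mono) auto
    with i(1) have "of_int i < (2 ^ r * 1 :: real)" by (rule le_less_trans)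
    then have "real_of_int i < of_int (2 ^ r)" by simp
    then have "i + 1 \<le> 2 ^ r" unfolding of_int_less_iff by simp
    then have "real_of_int (i + 1) \<le> of_int (2 ^ r)" unfolding of_int_le_iff .
    then have q1: "(of_int i + 1) / 2 ^ r \<le> (1::real)" by simp
    have q: "y < (of_int i + 1) / 2 ^ r" "of_int i / 2 ^ r \<le> y" using i by (simp_all add: field_simps)
    have "stair_lo ((of_int i + 1) / 2 ^ r) \<le> stair_hi y + 1 / 2 ^ r"
      using stair_cell[of i r] stair_hi_mono[OF q(2)] by linarith
    then have "stair_lo ((of_int i + 1) / 2 ^ r) \<le> t" using r by (simp add: power_divide)
    then have "(of_int i + 1) / 2 ^ r \<le> y" using q q1 y by (intro up) auto
    then show False using q by simp
  qed
  show "stair_lo (stair_inv t) \<le> t"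
  proof (rule ccontr)
    assume "\<not> ?thesis"
    then have gt: "t < stair_lo y" by (simp add: y_def)
    obtain r where r: "(1/2::real) ^ r < stair_lo y - t" using real_arch_pow_inv[of "stair_lo y - t" "1/2"] gt by auto
    define i where "i = \<lceil>2 ^ r * y\<rceil> - 1"
    have i: "of_int i < 2 ^ r * y" "2 ^ r * y \<le> of_int i + 1" unfolding i_def by linarith+
    have q: "y \<le> (of_int i + 1) / 2 ^ r" "of_int i / 2 ^ r < y" using i by (simp_all add: field_simps)
    have "stair_lo y \<le> stair_hi (of_int i / 2 ^ r) + 1 / 2 ^ r"
      using stair_cell[of i r] stair_lo_mono[OF q(1)] by linarith
    then have "t < stair_hi (of_int i / 2 ^ r)" using r by (simp add: power_divide)
    moreover obtain z where z: "z \<in> ?A" "of_int i / 2 ^ r < z"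
      using less_cSup_iff[of ?A "of_int i / 2 ^ r"] ne bdd q(2) unfolding y_def stair_inv_def by blast
    ultimately show False using stair_less[OF z(2)] z(1) by auto
  qed
qed

lemma stair_inv_eq:
  assumes "stair_lo y \<le> t" "t \<le> stair_hi y" "0 \<le> y" "y \<le> 1"
  shows "stair_inv t = y"
proof -
  have t: "0 \<le> t" "t \<le> 1" using stair_range[OF assms(3,4)] assms(1,2) by linarith+
  show ?thesis
    using stair_inv[OF t] stair_less[of y "stair_inv t"] stair_less[of "stair_inv t" y] assms
    by (cases y "stair_inv t" rule: linorder_cases) linarith+
qed

lemma stair_inv_lo: "0 \<le> y \<Longrightarrow> y \<le> 1 \<Longrightarrow> stair_inv (stair_lo y) = y"
  and stair_inv_hi: "0 \<le> y \<Longrightarrow> y \<le> 1 \<Longrightarrow> stair_inv (stair_hi y) = y"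
  using stair_lo_le_hi[of y] by (auto intro: stair_inv_eq)

lemma stair_inv_lipschitz:
  assumes "0 \<le> s" "s \<le> t" "t \<le> 1"
  shows "\<bar>stair_inv t - stair_inv s\<bar> \<le> 2 * (t - s)"
proof -
  have s: "stair_lo (stair_inv s) \<le> s" "s \<le> stair_hi (stair_inv s)"
    and t: "stair_lo (stair_inv t) \<le> t" "t \<le> stair_hi (stair_inv t)"
    using stair_inv[of s] stair_inv[of t] assms by auto
  show ?thesis
  proof (cases "stair_inv s" "stair_inv t" rule: linorder_cases)
    case less
    then show ?thesis using stair_gap[OF less] s t by simp
  next
    case equal
    then show ?thesis using assms by simp
  next
    case greater
    then show ?thesis using stair_gap[OF greater] s t assms by simp
  qed
qed

lemma stair_inv_reflect:
  assumes "0 \<le> t" "t \<le> 1" shows "stair_inv (1 - t) = 1 - stair_inv t"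
  using stair_inv[OF assms] stair_reflect[of "stair_inv t"] stair_reflect[of "1 - stair_inv t"]
  by (intro stair_inv_eq) auto

lemma stair_inv_continuous: "continuous_on {0..1} stair_inv"
proof (rule continuous_onI)
  fix x e :: real assume x: "x \<in> {0..1}" and e: "e > 0"
  have "\<bar>stair_inv z - stair_inv x\<bar> \<le> 2 * \<bar>z - x\<bar>" if "z \<in> {0..1}" for z
    using stair_inv_lipschitz[of x z] stair_inv_lipschitz[of z x] x that
    by (cases "x \<le> z") (auto simp: abs_minus_commute)
  then have "dist (stair_inv z) (stair_inv x) \<le> e" if "z \<in> {0..1}" "dist z x < e / 2" for z
    using that unfolding dist_real_def by fastforce
  then show "\<exists>d>0. \<forall>z\<in>{0..1}. dist z x < d \<longrightarrow> dist (stair_inv z) (stair_inv x) \<le> e"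
    using e by (intro exI[of _ "e / 2"]) auto
qed

text \<open>To the right of any point of the Cantor set there are gaps of arbitrarily high level
  whose distance is of the order of the square root of their width. That is the height of the
  excursions made in them.\<close>

lemma stair_near:
  assumes y: "0 \<le> y" "y < 1"
  shows "\<exists>k m. K \<le> k \<and> m < 2 ^ k \<and> y < pt k m \<and> stair_lo (pt k m) - stair_hi y \<le> 1 / 2 ^ Suc k"
proof -
  \<comment> \<open>The next point of the grid of mesh \<open>1 / 2 ^ K\<close>. A dyadic point
    strictly between \<open>y\<close> and \<open>g\<close> is not on that grid, so its level is at
    least \<open>K\<close>.\<close>
  define g where "g = (of_int \<lfloor>2 ^ K * y\<rfloor> + 1) / (2::real) ^ K"
  have g: "y < g" unfolding g_def by (simp add: field_simps) linarith
  have g1: "g \<le> 1"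
  proof -
    have "2 ^ K * y < 2 ^ K * 1" using y by (intro mult_strict_left_mono) auto
    then have "\<lfloor>2 ^ K * y\<rfloor> < 2 ^ K" by (simp add: floor_less_iff)
    then have "real_of_int (\<lfloor>2 ^ K * y\<rfloor> + 1) \<le> of_int (2 ^ K)" unfolding of_int_le_iff by simp
    then show ?thesis by (simp add: g_def)
  qed
  obtain r where r: "(1/2::real) ^ r < g - y" using real_arch_pow_inv[of "g - y" "1/2"] g by auto
  define i where "i = \<lfloor>2 ^ r * y\<rfloor>"
  have i: "of_int i \<le> 2 ^ r * y" "2 ^ r * y < of_int i + 1" "0 \<le> i"
    unfolding i_def using y by (linarith, linarith, simp)
  define q where "q = (of_int i + 1) / (2::real) ^ r"
  have q: "y < q" "of_int i / 2 ^ r \<le> y" using i by (simp_all add: q_def field_simps)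
  have "q \<le> y + 1 / 2 ^ r" using i by (simp add: q_def field_simps)
  then have qg: "q < g" using r by (simp add: power_divide)
  \<comment> \<open>Putting \<open>q\<close> in lowest terms reveals its level; cancelling only
    makes the allowed distance \<open>1 / 2 ^ Suc k\<close> larger than
    \<open>1 / 2 ^ r\<close>.\<close>
  obtain e and a :: nat where a: "nat (i + 1) = 2 ^ e * a" "odd a"
  proof -
    define N where "N = nat (i + 1)"
    have N: "N \<noteq> 0" using i by (simp add: N_def)
    then obtain a where "N = 2 ^ multiplicity 2 N * a" "\<not> 2 dvd a"
      using multiplicity_decompose'[of N 2] by auto
    then show ?thesis using that N_def by blast
  qed
  obtain m where m: "a = 2 * m + 1" using a(2) oddE by blast
  have "real (nat (i + 1)) = of_int i + 1" using i(3) by simp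
  then have "of_int i + 1 = real (2 ^ e * (2 * m + 1))" using a(1) m by simp
  then have qa: "q = 2 ^ e * (2 * real m + 1) / 2 ^ r"
    unfolding q_def by (simp add: algebra_simps)
  have er: "e < r"
  proof (rule ccontr)
    assume "\<not> e < r"
    then have "(2::real) ^ r \<le> 2 ^ e" by (intro power_increasing) auto
    then have "1 \<le> (2::real) ^ e / 2 ^ r" by simp
    then have "1 * 1 \<le> 2 ^ e / 2 ^ r * (2 * real m + 1)" by (intro mult_mono) auto
    then have "1 \<le> q" unfolding qa by simp
    then show False using qg g1 by simp
  qed
  define k where "k = r - Suc e"
  have "(2::real) ^ r = 2 ^ e * 2 ^ Suc k"
    using er by (simp only: k_def power_add[symmetric]) simp
  then have qp: "q = pt k m" by (simp add: qa pt_def)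
  have "pt k m < 1" using qp qg g1 by simp
  then have "real (2 * m + 1) < real (2 ^ Suc k)" by (simp add: pt_def)
  then have "2 * m + 1 < 2 ^ Suc k" unfolding of_nat_less_iff .
  then have mk: "m < 2 ^ k" by simp
  have Kk: "K \<le> k"
  proof (rule ccontr)
    assume "\<not> K \<le> k"
    then have "(2::real) ^ K = 2 ^ Suc k * 2 ^ (K - Suc k)"
      by (simp only: power_add[symmetric]) simp
    then have Kq: "2 ^ K * q = of_int ((2 * int m + 1) * 2 ^ (K - Suc k))" by (simp add: qp pt_def)
    have "2 ^ K * y < 2 ^ K * q" using q by simp
    then have "\<lfloor>2 ^ K * y\<rfloor> < (2 * int m + 1) * 2 ^ (K - Suc k)" unfolding Kq by linarith
    then have "real_of_int (\<lfloor>2 ^ K * y\<rfloor> + 1) \<le> 2 ^ K * q" unfolding Kq of_int_le_iff by simp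
    then have "g \<le> q" by (simp add: g_def field_simps)
    then show False using qg by simp
  qed
  have "stair_lo q - stair_hi y \<le> 1 / 2 ^ r"
    using stair_cell[of i r] stair_hi_mono[OF q(2)] unfolding q_def by linarith
  also have "\<dots> \<le> 1 / 2 ^ Suc k"
    using er by (intro divide_left_mono power_increasing) (auto simp: k_def)
  finally show ?thesis using Kk mk q(1) qp by blast
qed

lemma stair_neighbour:
  assumes "m < 2 ^ k" "k < n"
  shows "\<exists>m'. m' < 2 ^ n \<and> stair_hi (pt k m) \<le> stair_lo (pt n m') \<and>
           stair_hi (pt n m') - stair_lo (pt k m) \<le> 1 / 2 ^ k"
proof -
  \<comment> \<open>Chosen so that \<open>pt n m'\<close> is \<open>pt k m\<close> shifted right by
    \<open>1 / 2 ^ Suc n\<close>, inside the adjacent cell of mesh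
    \<open>1 / 2 ^ Suc k\<close>.\<close>
  define m' where "m' = (2 * m + 1) * 2 ^ (n - Suc k)"
  have 2: "(2::real) ^ Suc n = 2 ^ Suc k * (2 * 2 ^ (n - Suc k))"
    using assms by (simp flip: power_add power_Suc)
  have pt: "pt n m' = pt k m + 1 / 2 ^ Suc n"
    unfolding pt_def 2 by (simp add: m'_def field_simps)
  have "2 * m + 1 < 2 ^ Suc k" using assms by simp
  then have "m' < 2 ^ Suc k * 2 ^ (n - Suc k)" unfolding m'_def by (intro mult_strict_right_mono) auto
  also have "(2::nat) ^ Suc k * 2 ^ (n - Suc k) = 2 ^ n"
    using assms by (simp only: power_add[symmetric]) simp
  finally have 1: "m' < 2 ^ n" .
  have lt: "pt k m < pt n m'" by (simp add: pt)
  have "(1::real) / 2 ^ Suc n < 1 / 2 ^ Suc k"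
    using assms by (intro divide_strict_left_mono power_strict_increasing) auto
  also have "pt k m + 1 / 2 ^ Suc k = (of_int (2 * int m + 1) + 1) / 2 ^ Suc k"
    by (simp add: pt_def field_simps)
  finally have lt2: "pt n m' < (of_int (2 * int m + 1) + 1) / 2 ^ Suc k" by (simp add: pt)
  have "stair_hi (pt n m') \<le> stair_lo ((of_int (2 * int m + 1) + 1) / 2 ^ Suc k)"
    using stair_less[OF lt2] by simp
  also have "\<dots> \<le> stair_hi (of_int (2 * int m + 1) / 2 ^ Suc k) + 1 / 2 ^ Suc k"
    using stair_cell[of "2 * int m + 1" "Suc k"] by linarith
  also have "of_int (2 * int m + 1) / 2 ^ Suc k = pt k m" by (simp add: pt_def)
  also have "stair_hi (pt k m) = stair_lo (pt k m) + 1 / 4 ^ Suc k" using stair_pt[of k m] by linarith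
  finally have "stair_hi (pt n m') - stair_lo (pt k m) \<le> 1 / 4 ^ Suc k + 1 / 2 ^ Suc k" by simp
  also have "\<dots> \<le> 1 / 2 ^ Suc k + 1 / 2 ^ Suc k"
    by (intro add_mono divide_left_mono power_mono) auto
  finally have "stair_hi (pt n m') - stair_lo (pt k m) \<le> 1 / 2 ^ k" by simp
  moreover have "stair_hi (pt k m) \<le> stair_lo (pt n m')" using stair_less[OF lt] by simp
  ultimately show ?thesis using 1 by blast
qed

section \<open>The two-layer profile\<close>

definition tent :: "real \<Rightarrow> real" where "tent y = 1 - \<bar>2 * y - 1\<bar>"
text \<open>Peaks at 1/4 and 3/4, zeros at 0, 1/2 and 1. The zero in the middle gives the profile a
  gap with value exactly 1, the peaks give it gaps with value exactly 0.\<close>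

definition two_tents :: "real \<Rightarrow> real" where "two_tents y = 1 - \<bar>1 - \<bar>4 * y - 2\<bar>\<bar>"

text \<open>The width of the gap of the staircase at \<^term>\<open>pt k m\<close> is \<^term>\<open>1 / 4 ^ Suc k\<close>, so its square root
  doubled is the height \<^term>\<open>1 / 2 ^ k\<close> of the excursion made there; away from the gaps the width,
  and hence the second term, is zero.\<close>

definition profile :: "real \<Rightarrow> real" where
  "profile t = (let y = stair_inv t; w = stair_hi y - stair_lo y
     in tent y - 2 * sqrt w * two_tents (stair_inv ((t - stair_lo y) / w)))"

text \<open>The first two components locate an outer gap, the last two a gap of the rescaled
  staircase inside it.\<close>

type_synonym gap_index = "nat \<times> nat \<times> nat \<times> nat"

definition gaps :: "gap_index set" where
  "gaps = {(k, m, k', m'). m < 2 ^ k \<and> m' < 2 ^ k'}"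

text \<open>The size is what \<open>gap_return\<close> can afford. For \<open>k' = 0\<close> the
  value recurs only at the end of the outer gap, hence a fraction of its width; otherwise the outer
  staircase has to descend by an amount of order \<open>1 / 2 ^ (k + k')\<close>.\<close>

fun gap_lo gap_hi gap_val gap_size :: "gap_index \<Rightarrow> real" where
  "gap_lo (k, m, k', m') = stair_lo (pt k m) + stair_lo (pt k' m') / 4 ^ Suc k"
| "gap_hi (k, m, k', m') = stair_lo (pt k m) + stair_hi (pt k' m') / 4 ^ Suc k"
| "gap_val (k, m, k', m') = tent (pt k m) - two_tents (pt k' m') / 2 ^ k"
| "gap_size (k, m, k', m') = (if k' = 0 then 1 / 4 ^ (k + 2) else 1 / 2 ^ (k + k' + 2))"

text \<open>The exponent of 2 in \<open>k'\<close> takes each value with bounded spacing, so each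
  target appears at a level only a bounded number of steps away.\<close>

fun gap_goal :: "gap_index \<Rightarrow> nat" where
  "gap_goal (k, m, k', m') = multiplicity 2 k'"

fun gap_mirror :: "gap_index \<Rightarrow> gap_index" where
  "gap_mirror (k, m, k', m') = (k, 2 ^ k - 1 - m, k', 2 ^ k' - 1 - m')"

lemma ex_multiplicity: "\<exists>n>k. n \<le> k + 2 ^ (d + 2) \<and> multiplicity (2::nat) n = d"
proof -
  define c where "c = k div 2 ^ Suc d"
  define n where "n = 2 ^ d * (2 * (c + 1) + 1)"
  have 1: "k = 2 ^ Suc d * c + k mod 2 ^ Suc d" by (simp add: c_def)
  have 2: "k mod 2 ^ Suc d < 2 ^ Suc d" by simp
  have 3: "n = 2 ^ Suc d * c + 2 ^ Suc d + 2 ^ d" by (simp add: n_def algebra_simps)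
  have "k < n" using 1 2 3 by linarith
  moreover have "n \<le> k + 2 ^ (d + 2)" using 1 3 by simp
  moreover have "multiplicity (2::nat) n = d"
  proof (rule multiplicity_eqI)
    show "2 ^ d dvd n" by (simp add: n_def)
    show "\<not> 2 ^ Suc d dvd n" by (simp only: n_def power_Suc2 nat_mult_dvd_cancel_disj) simp
  qed
  ultimately show ?thesis by blast
qed

lemma tent_lipschitz: "\<bar>tent x - tent y\<bar> \<le> 2 * \<bar>x - y\<bar>"
  unfolding tent_def by (auto simp: abs_if split: if_splits)

lemma two_tents_lipschitz: "\<bar>two_tents x - two_tents y\<bar> \<le> 4 * \<bar>x - y\<bar>"
  unfolding two_tents_def by (auto simp: abs_if split: if_splits)

lemma two_tents_range: "0 \<le> y \<Longrightarrow> y \<le> 1 \<Longrightarrow> 0 \<le> two_tents y \<and> two_tents y \<le> 1"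
  unfolding two_tents_def by (auto simp: abs_if split: if_splits)

lemma tent_range: "0 \<le> y \<Longrightarrow> y \<le> 1 \<Longrightarrow> 0 \<le> tent y \<and> tent y \<le> 1"
  unfolding tent_def by (auto simp: abs_if split: if_splits)

text \<open>Ensures that the downward excursion of height \<open>1 / 2 ^ k\<close> does not make the
  profile negative.\<close>

lemma tent_pt: assumes "m < 2 ^ k" shows "1 / 2 ^ k \<le> tent (pt k m)"
proof -
  have "1 / 2 ^ Suc k \<le> pt k m" by (simp add: pt_def divide_right_mono)
  moreover have "pt k m \<le> 1 - 1 / 2 ^ Suc k"
  proof -
    have "2 * m + 2 \<le> 2 ^ Suc k" using assms by simp
    then have "real (2 * m + 2) \<le> real (2 ^ Suc k)" unfolding of_nat_le_iff .
    then have "(2 * real m + 1) / 2 ^ Suc k + 1 / 2 ^ Suc k \<le> 1" by (simp flip: add_divide_distrib)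
    then show ?thesis unfolding pt_def by linarith
  qed
  moreover have "2 * (1 / 2 ^ Suc k) = (1::real) / 2 ^ k" by simp
  ultimately show ?thesis unfolding tent_def by linarith
qed

text \<open>Gap values of the inner layer stay this far below the outer value, which gives the
  return its distance.\<close>

lemma two_tents_pt: assumes "m < 2 ^ k" "0 < k" shows "2 / 2 ^ k \<le> two_tents (pt k m)"
proof -
  \<comment> \<open>An odd number of absolute value below \<open>2 ^ k\<close>, which bounds
    \<open>pt k m\<close> away from all three zeros of \<open>two_tents\<close>.\<close>
  define z where "z = 2 * int m + 1 - 2 ^ k"
  have "odd z" using assms by (simp add: z_def)
  then have "z \<noteq> 0" by auto
  then have z: "1 \<le> \<bar>z\<bar>" by linarith
  have "int m < int (2 ^ k)" using assms(1) unfolding of_nat_less_iff .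
  then have "int m < 2 ^ k" by simp
  then have z2: "\<bar>z\<bar> \<le> 2 ^ k - 1" unfolding z_def by linarith
  have zr: "1 \<le> \<bar>real_of_int z\<bar>" "\<bar>real_of_int z\<bar> \<le> 2 ^ k - 1"
  proof -
    have "real_of_int 1 \<le> of_int \<bar>z\<bar>" using z unfolding of_int_le_iff .
    then show "1 \<le> \<bar>real_of_int z\<bar>" by simp
    have "real_of_int \<bar>z\<bar> \<le> of_int (2 ^ k - 1)" using z2 unfolding of_int_le_iff .
    then show "\<bar>real_of_int z\<bar> \<le> 2 ^ k - 1" by simp
  qed
  define x where "x = \<bar>4 * pt k m - 2\<bar>"
  have "4 * pt k m - 2 = 2 * of_int z / 2 ^ k" by (simp add: pt_def z_def field_simps)
  then have "x = 2 / 2 ^ k * \<bar>of_int z\<bar>" unfolding x_def by (simp add: abs_mult)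
  moreover have "2 / 2 ^ k * 1 \<le> 2 / 2 ^ k * \<bar>real_of_int z\<bar>" "2 / 2 ^ k * \<bar>real_of_int z\<bar> \<le> 2 / 2 ^ k * (2 ^ k - 1)"
    by (intro mult_left_mono zr; simp)+
  moreover have "2 / 2 ^ k * (2 ^ k - 1) = 2 - 2 / (2::real) ^ k" by (simp add: field_simps)
  ultimately have "2 / 2 ^ k \<le> x" "x \<le> 2 - 2 / 2 ^ k" by simp_all
  then show ?thesis unfolding two_tents_def x_def[symmetric] by linarith
qed

lemma profile_stair:
  assumes "0 \<le> y" "y \<le> 1"
  shows "profile (stair_lo y) = tent y" "profile (stair_hi y) = tent y"
proof -
  have t: "two_tents 0 = 0" "two_tents 1 = 0" by (auto simp: two_tents_def)
  have i: "stair_inv 0 = 0" "stair_inv 1 = 1"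
    using stair_inv_lo[of 0] stair_inv_lo[of 1] by (auto simp: stair_0 stair_1)
  show "profile (stair_lo y) = tent y"
    using assms by (simp add: profile_def stair_inv_lo i t)
  show "profile (stair_hi y) = tent y"
    using assms by (cases "stair_hi y = stair_lo y") (simp_all add: profile_def stair_inv_lo stair_inv_hi i t)
qed

lemma profile_gap:
  assumes "m < 2 ^ k" "0 \<le> x" "x \<le> 1"
  shows "stair_inv (stair_lo (pt k m) + x / 4 ^ Suc k) = pt k m"
    and "profile (stair_lo (pt k m) + x / 4 ^ Suc k) = tent (pt k m) - two_tents (stair_inv x) / 2 ^ k"
proof -
  have p: "0 \<le> pt k m" "pt k m \<le> 1" using pt_range[OF assms(1)] by auto
  have "x / 4 ^ Suc k \<le> 1 / 4 ^ Suc k" using assms by (intro divide_right_mono) auto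
  then show inv: "stair_inv (stair_lo (pt k m) + x / 4 ^ Suc k) = pt k m"
    using stair_pt[of k m] assms p by (intro stair_inv_eq) auto
  have "sqrt (1 / 4 ^ Suc k) = 1 / 2 ^ Suc k"
    by (rule real_sqrt_unique) (simp_all add: power2_eq_square flip: power_mult_distrib)
  then show "profile (stair_lo (pt k m) + x / 4 ^ Suc k) = tent (pt k m) - two_tents (stair_inv x) / 2 ^ k"
    unfolding profile_def Let_def inv stair_pt by simp
qed

lemma outer_gap_form:
  assumes "stair_lo (pt k m) \<le> u" "u \<le> stair_hi (pt k m)"
  obtains x where "0 \<le> x" "x \<le> 1" "u = stair_lo (pt k m) + x / 4 ^ Suc k"
proof
  let ?x = "(u - stair_lo (pt k m)) * 4 ^ Suc k"
  show "0 \<le> ?x" using assms by simp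
  have "?x \<le> (1 / 4 ^ Suc k) * 4 ^ Suc k"
    using stair_pt[of k m] assms by (intro mult_right_mono) auto
  then show "?x \<le> 1" by simp
  show "u = stair_lo (pt k m) + ?x / 4 ^ Suc k" by simp
qed

lemma stair_pt_less: "stair_lo (pt k m) < stair_hi (pt k m)"
proof -
  have "(0::real) < 1 / 4 ^ Suc k" by simp
  then show ?thesis unfolding stair_pt[of k m, symmetric] by simp
qed

lemma gap_outer:
  assumes "(k, m, k', m') \<in> gaps"
  shows "stair_lo (pt k m) < gap_lo (k, m, k', m')" "gap_lo (k, m, k', m') < gap_hi (k, m, k', m')"
    "gap_hi (k, m, k', m') < stair_hi (pt k m)"
proof -
  have m': "m' < 2 ^ k'" using assms by (simp add: gaps_def)
  have p: "0 < stair_lo (pt k' m')" "stair_hi (pt k' m') < 1"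
    using pt_range[OF m'] stair_less[of 0 "pt k' m'"] stair_less[of "pt k' m'" 1] stair_0 stair_1 by auto
  have lt: "stair_lo (pt k' m') < stair_hi (pt k' m')"
    by (rule stair_pt_less)
  show "stair_lo (pt k m) < gap_lo (k, m, k', m')" using p by simp
  show "gap_lo (k, m, k', m') < gap_hi (k, m, k', m')" using lt by (simp add: divide_strict_right_mono)
  have "stair_hi (pt k' m') / 4 ^ Suc k < 1 / 4 ^ Suc k" using p by (intro divide_strict_right_mono) auto
  then show "gap_hi (k, m, k', m') < stair_hi (pt k m)" using stair_pt[of k m] by simp
qed

lemma gap_inner:
  assumes "(k, m, k', m') \<in> gaps"
  shows "gap_lo (k, m, k', m') \<le> stair_lo (pt k m) + x / 4 ^ Suc k \<longleftrightarrow> stair_lo (pt k' m') \<le> x"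
    and "gap_lo (k, m, k', m') < stair_lo (pt k m) + x / 4 ^ Suc k \<longleftrightarrow> stair_lo (pt k' m') < x"
    and "stair_lo (pt k m) + x / 4 ^ Suc k \<le> gap_hi (k, m, k', m') \<longleftrightarrow> x \<le> stair_hi (pt k' m')"
    and "stair_lo (pt k m) + x / 4 ^ Suc k < gap_hi (k, m, k', m') \<longleftrightarrow> x < stair_hi (pt k' m')"
  by (simp_all add: divide_le_cancel divide_less_cancel)

lemma pt_unique:
  assumes "m < 2 ^ k" "n < 2 ^ l" "stair_lo (pt k m) \<le> t" "t \<le> stair_hi (pt k m)"
    "stair_lo (pt l n) \<le> t" "t \<le> stair_hi (pt l n)"
  shows "k = l" "m = n"
proof -
  have "pt k m = pt l n"
    using stair_inv_eq[OF assms(3,4)] stair_inv_eq[OF assms(5,6)] pt_range[OF assms(1)] pt_range[OF assms(2)]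
    by simp
  then show "k = l" "m = n" by (auto simp: pt_inject)
qed

lemma outer_free:
  assumes y: "0 \<le> y" "y \<le> 1" and s: "s = stair_lo y \<or> s = stair_hi y" and i: "i \<in> gaps"
  shows "\<not> (gap_lo i < s \<and> s < gap_hi i)"
proof
  assume a: "gap_lo i < s \<and> s < gap_hi i"
  obtain k m k' m' where k: "i = (k, m, k', m')" by (cases i)
  have m: "m < 2 ^ k" using i k by (simp add: gaps_def)
  have in_gap: "stair_lo (pt k m) < s" "s < stair_hi (pt k m)"
    using a gap_outer[OF i[unfolded k]] k by auto
  then have "stair_inv s = pt k m" using pt_range[OF m] by (intro stair_inv_eq) auto
  moreover have "stair_inv s = y" using s y stair_inv_lo stair_inv_hi by auto
  ultimately show False using s in_gap by auto
qed

lemma inner_free: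
  assumes m: "m < 2 ^ k" and y: "0 \<le> y" "y \<le> 1" and s: "x = stair_lo y \<or> x = stair_hi y"
    and i: "i \<in> gaps"
  shows "\<not> (gap_lo i < stair_lo (pt k m) + x / 4 ^ Suc k \<and> stair_lo (pt k m) + x / 4 ^ Suc k < gap_hi i)"
    (is "\<not> ?P")
proof
  assume a: ?P
  obtain l n l' n' where l: "i = (l, n, l', n')" by (cases i)
  have n: "n < 2 ^ l" "n' < 2 ^ l'" using i l by (auto simp: gaps_def)
  have x: "0 \<le> x" "x \<le> 1" using s stair_range[OF y] by auto
  have "stair_inv (stair_lo (pt k m) + x / 4 ^ Suc k) = pt l n"
    using a gap_outer[OF i[unfolded l]] l pt_range[OF n(1)] by (intro stair_inv_eq) auto
  then have "k = l" "m = n" using profile_gap(1)[OF m x] by (auto simp: pt_inject)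
  then have in_gap: "stair_lo (pt l' n') < x" "x < stair_hi (pt l' n')"
    using a gap_inner[OF i[unfolded l], of x] l by auto
  then have "stair_inv x = pt l' n'" using pt_range[OF n(2)] by (intro stair_inv_eq) auto
  moreover have "stair_inv x = y" using s y stair_inv_lo stair_inv_hi by auto
  ultimately show False using s in_gap by auto
qed

text \<open>If the point were only a lower end of its jump, the jump would be a gap containing it in
  the half-open sense.\<close>

lemma not_in_half_open_gap:
  assumes t: "0 \<le> t" "t < 1"
    and "\<And>k m. m < 2 ^ k \<Longrightarrow> \<not> (stair_lo (pt k m) \<le> t \<and> t < stair_hi (pt k m))"
  obtains y where "0 \<le> y" "y < 1" "t = stair_hi y"
proof
  have i: "0 \<le> stair_inv t" "stair_inv t \<le> 1" "stair_lo (stair_inv t) \<le> t" "t \<le> stair_hi (stair_inv t)"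
    using stair_inv[of t] t by auto
  show "0 \<le> stair_inv t" by fact
  show "stair_inv t < 1" using i t stair_1 by (cases "stair_inv t = 1") auto
  show "t = stair_hi (stair_inv t)"
    using i assms(3) stair_jump_pt[of "stair_inv t"] by force
qed

text \<open>The outer function \<open>tent (stair_inv t)\<close> is continuous, and the excursions
  are bumps of height \<open>1 / 2 ^ k\<close>, only \<open>2 ^ k\<close> of them at level
  \<open>k\<close>.\<close>

lemma profile_continuous: "continuous_on {0..1} profile"
proof -
  let ?G = "{(k, m). m < (2::nat) ^ k}"
  define bump where "bump = (\<lambda>(k, m) t. - (two_tents (stair_inv ((t - stair_lo (pt k m)) * 4 ^ Suc k)) / 2 ^ k))"
  have tt: "continuous_on A two_tents" for A
    unfolding two_tents_def[abs_def] by (intro continuous_intros)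
  have "continuous_on {0..1} (\<lambda>t. profile t - tent (stair_inv t))"
  proof (rule continuous_on_bump_sum[where G = ?G and \<beta> = bump and lo = "\<lambda>(k, m). stair_lo (pt k m)"
        and hi = "\<lambda>(k, m). stair_hi (pt k m)" and \<eta> = "\<lambda>(k, m). 1 / 2 ^ k"])
    fix j assume "j \<in> ?G"
    then obtain k m where j: "j = (k, m)" and m: "m < 2 ^ k" by auto
    have form: "0 \<le> (t - stair_lo (pt k m)) * 4 ^ Suc k \<and> (t - stair_lo (pt k m)) * 4 ^ Suc k \<le> 1 \<and>
        t = stair_lo (pt k m) + ((t - stair_lo (pt k m)) * 4 ^ Suc k) / 4 ^ Suc k"
      if "stair_lo (pt k m) \<le> t" "t \<le> stair_hi (pt k m)" for t
      using that by (rule outer_gap_form) simp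
    have "continuous_on {stair_lo (pt k m)..stair_hi (pt k m)} (bump j)"
      unfolding j bump_def prod.case
      by (intro continuous_intros continuous_on_compose2[OF tt] continuous_on_compose2[OF stair_inv_continuous])
        (use form in auto)
    then show "continuous_on {case j of (k, m) \<Rightarrow> stair_lo (pt k m)..case j of (k, m) \<Rightarrow> stair_hi (pt k m)} (bump j)"
      by (simp add: j)
    have eq: "(stair_hi (pt k m) - stair_lo (pt k m)) * 4 ^ Suc k = 1" unfolding stair_pt by simp
    have i: "stair_inv 0 = 0" "stair_inv 1 = 1"
      using stair_inv_lo[of 0] stair_inv_lo[of 1] by (auto simp: stair_0 stair_1)
    have "stair_lo (pt k m) < stair_hi (pt k m)"
      by (rule stair_pt_less)
    moreover have "bump j (stair_lo (pt k m)) = 0" "bump j (stair_hi (pt k m)) = 0"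
      unfolding j bump_def prod.case eq by (simp_all add: i two_tents_def)
    ultimately show "(case j of (k, m) \<Rightarrow> stair_lo (pt k m)) < (case j of (k, m) \<Rightarrow> stair_hi (pt k m)) \<and>
        bump j (case j of (k, m) \<Rightarrow> stair_lo (pt k m)) = 0 \<and>
        bump j (case j of (k, m) \<Rightarrow> stair_hi (pt k m)) = 0" by (simp add: j)
    fix t assume "(case j of (k, m) \<Rightarrow> stair_lo (pt k m)) < t" "t < (case j of (k, m) \<Rightarrow> stair_hi (pt k m))"
    then have t: "stair_lo (pt k m) \<le> t" "t \<le> stair_hi (pt k m)" by (auto simp: j)
    define x where "x = (t - stair_lo (pt k m)) * 4 ^ Suc k"
    have x: "0 \<le> x" "x \<le> 1" "t = stair_lo (pt k m) + x / 4 ^ Suc k" using form[OF t] by (auto simp: x_def)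
    have b: "bump j t = - (two_tents (stair_inv x) / 2 ^ k)" by (simp add: bump_def j x_def)
    show "\<bar>bump j t\<bar> \<le> (case j of (k, m) \<Rightarrow> 1 / 2 ^ k)"
      using two_tents_range[of "stair_inv x"] stair_inv[OF x(1,2)] unfolding b unfolding j by (simp add: divide_right_mono)
    show "profile t - tent (stair_inv t) = bump j t"
      using profile_gap[OF m x(1,2), folded x(3)] b by simp
  next
    fix e :: real assume "e > 0"
    then obtain N where N: "(1/2::real) ^ N < e" using real_arch_pow_inv[of e "1/2"] by auto
    have "k < N" if "e \<le> 1 / 2 ^ k" for k
    proof (rule ccontr)
      assume "\<not> k < N"
      then have "(1/2::real) ^ k \<le> (1/2) ^ N" by (intro power_decreasing) auto
      then show False using N that by (simp add: power_divide)
    qed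
    then have "{j \<in> ?G. (case j of (k, m) \<Rightarrow> 1 / 2 ^ k) \<ge> e} \<subseteq> Sigma {..<N} (\<lambda>k. {..<2 ^ k})"
      by auto
    then show "finite {j \<in> ?G. (case j of (k, m) \<Rightarrow> 1 / 2 ^ k) \<ge> e}"
      by (rule finite_subset) auto
  next
    fix u :: real
    assume u: "u \<in> {0..1}"
      and off: "\<And>j. j \<in> ?G \<Longrightarrow> \<not> ((case j of (k, m) \<Rightarrow> stair_lo (pt k m)) < u \<and>
        u < (case j of (k, m) \<Rightarrow> stair_hi (pt k m)))"
    have i: "0 \<le> stair_inv u" "stair_inv u \<le> 1" "stair_lo (stair_inv u) \<le> u" "u \<le> stair_hi (stair_inv u)"
      using stair_inv[of u] u by auto
    have "u = stair_lo (stair_inv u) \<or> u = stair_hi (stair_inv u)"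
      using i off stair_jump_pt[of "stair_inv u"] by force
    then show "profile u - tent (stair_inv u) = 0"
      using profile_stair[OF i(1,2)] by auto
  next
    fix i j :: "nat \<times> nat" and u
    assume ij: "i \<in> ?G" "j \<in> ?G" "(case i of (k, m) \<Rightarrow> stair_lo (pt k m)) < u"
      "u < (case i of (k, m) \<Rightarrow> stair_hi (pt k m))" "(case j of (k, m) \<Rightarrow> stair_lo (pt k m)) < u"
      "u < (case j of (k, m) \<Rightarrow> stair_hi (pt k m))"
    obtain k m l n where kl: "i = (k, m)" "j = (l, n)" by (cases i; cases j) auto
    show "i = j" using pt_unique[of m k n l u] ij unfolding kl by auto
  qed
  moreover have "continuous_on {0..1} (\<lambda>t. tent (stair_inv t))"
    unfolding tent_def by (intro continuous_intros stair_inv_continuous)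
  ultimately have "continuous_on {0..1} (\<lambda>t. (profile t - tent (stair_inv t)) + tent (stair_inv t))"
    by (rule continuous_on_add)
  then show ?thesis by simp
qed

lemma profile_range:
  assumes t: "0 \<le> t" "t \<le> 1" shows "0 \<le> profile t \<and> profile t \<le> 1"
proof (cases "\<exists>k m. m < 2 ^ k \<and> stair_lo (pt k m) \<le> t \<and> t \<le> stair_hi (pt k m)")
  case True
  then obtain k m where m: "m < 2 ^ k" and k: "stair_lo (pt k m) \<le> t" "t \<le> stair_hi (pt k m)" by blast
  obtain x where x: "0 \<le> x" "x \<le> 1" "t = stair_lo (pt k m) + x / 4 ^ Suc k"
    using outer_gap_form[OF k] .
  have "0 \<le> two_tents (stair_inv x)" "two_tents (stair_inv x) \<le> 1"
    using two_tents_range stair_inv[OF x(1,2)] by auto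
  then have "0 \<le> two_tents (stair_inv x) / 2 ^ k" "two_tents (stair_inv x) / 2 ^ k \<le> 1 / 2 ^ k"
    by (auto intro: divide_right_mono)
  moreover have "tent (pt k m) \<le> 1" using tent_range pt_range[OF m] by auto
  ultimately show ?thesis
    unfolding x(3) profile_gap(2)[OF m x(1,2)] using tent_pt[OF m] by linarith
next
  case False
  have i: "0 \<le> stair_inv t" "stair_inv t \<le> 1" "stair_lo (stair_inv t) \<le> t" "t \<le> stair_hi (stair_inv t)"
    using stair_inv[OF t] .
  have "t = stair_lo (stair_inv t)"
    using i False stair_jump_pt[of "stair_inv t"] by force
  then show ?thesis using profile_stair(1)[OF i(1,2)] tent_range[OF i(1,2)] by auto
qed

lemma profile_symmetric:
  assumes t: "0 \<le> t" "t \<le> 1" shows "profile (1 - t) = profile t"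
proof -
  define y where "y = stair_inv t"
  define w where "w = stair_hi y - stair_lo y"
  have i: "0 \<le> y" "y \<le> 1" "stair_lo y \<le> t" "t \<le> stair_hi y"
    unfolding y_def using stair_inv[OF t] .
  have inv: "stair_inv (1 - t) = 1 - y" unfolding y_def by (rule stair_inv_reflect[OF t])
  have lo: "stair_lo (1 - y) = 1 - stair_hi y" and hi: "stair_hi (1 - y) = 1 - stair_lo y"
    using stair_reflect[of y] stair_reflect[of "1 - y"] by simp_all
  have w': "stair_hi (1 - y) - stair_lo (1 - y) = w" by (simp add: lo hi w_def)
  have tents: "tent (1 - y) = tent y" "two_tents (1 - z) = two_tents z" for z
    unfolding tent_def two_tents_def by (auto simp: abs_if)
  have p: "profile (1 - t) = tent y - 2 * sqrt w * two_tents (stair_inv ((stair_hi y - t) / w))"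
    unfolding profile_def Let_def inv unfolding w' unfolding lo tents by simp
  have q: "profile t = tent y - 2 * sqrt w * two_tents (stair_inv ((t - stair_lo y) / w))"
    by (simp add: profile_def Let_def y_def w_def)
  show ?thesis
  proof (cases "w = 0")
    case True
    then show ?thesis unfolding p q by simp
  next
    case False
    then have "w > 0" using stair_lo_le_hi[of y] by (simp add: w_def)
    define z where "z = (t - stair_lo y) / w"
    have "(stair_hi y - t) / w = (w - (t - stair_lo y)) / w" by (simp add: w_def)
    also have "\<dots> = 1 - z" using False by (simp add: z_def diff_divide_distrib)
    finally have "(stair_hi y - t) / w = 1 - z" .
    moreover have "0 \<le> z" "z \<le> 1" using i \<open>w > 0\<close> by (auto simp: z_def w_def divide_le_eq)
    ultimately show ?thesis unfolding p q z_def[symmetric] by (simp add: stair_inv_reflect tents)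
  qed
qed

lemma gap_disjoint:
  assumes i: "i \<in> gaps" "gap_lo i \<le> u" "u < gap_hi i" and j: "j \<in> gaps" "gap_lo j \<le> u" "u < gap_hi j"
  shows "i = j"
proof -
  obtain k m k' m' where k: "i = (k, m, k', m')" by (cases i)
  obtain l n l' n' where l: "j = (l, n, l', n')" by (cases j)
  have m: "m < 2 ^ k" "m' < 2 ^ k'" "n < 2 ^ l" "n' < 2 ^ l'" using i j k l by (auto simp: gaps_def)
  have o: "stair_lo (pt k m) \<le> u" "u \<le> stair_hi (pt k m)" "stair_lo (pt l n) \<le> u" "u \<le> stair_hi (pt l n)"
    using i j gap_outer[OF i(1)[unfolded k]] gap_outer[OF j(1)[unfolded l]] unfolding k l by auto
  have eq: "k = l" "m = n" using pt_unique[OF m(1,3) o] by auto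
  obtain x where x: "0 \<le> x" "x \<le> 1" "u = stair_lo (pt k m) + x / 4 ^ Suc k"
    using outer_gap_form[OF o(1,2)] .
  have "stair_lo (pt k' m') \<le> x" "x \<le> stair_hi (pt k' m')" "stair_lo (pt l' n') \<le> x" "x \<le> stair_hi (pt l' n')"
    using i(2,3) j(2,3) gap_inner[OF i(1)[unfolded k], of x] gap_inner[OF j(1)[unfolded l], of x]
    unfolding k l eq x(3)[unfolded eq] by auto
  then have "k' = l'" "m' = n'" using pt_unique[OF m(2,4)] by auto
  then show ?thesis using k l eq by simp
qed

text \<open>Excursions point down and the outer tent ends at 0, so it still has to cross the value
  of the gap on its way.\<close>

lemma gap_return:
  assumes i: "i \<in> gaps"
  shows "\<exists>s. gap_hi i + gap_size i \<le> s \<and> s \<le> 1 \<and> (\<forall>j\<in>gaps. \<not> (gap_lo j < s \<and> s < gap_hi j)) \<and>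
    profile s = gap_val i"
proof -
  obtain k m k' m' where k: "i = (k, m, k', m')" by (cases i)
  have m: "m < 2 ^ k" "m' < 2 ^ k'" using i k by (auto simp: gaps_def)
  have p: "0 \<le> pt k m" "pt k m \<le> 1" "0 \<le> pt k' m'" "pt k' m' \<le> 1"
    using pt_range[OF m(1)] pt_range[OF m(2)] by auto
  show ?thesis
  proof (cases "k' = 0")
    case True
    then have m': "m' = 0" using m by simp
    have half: "pt 0 0 = 1/2" by (simp add: pt_def)
    \<comment> \<open>The middle inner gap ends at 5/8 of the outer gap. The remaining 3/8 exceed
      the allowed quarter, and at the end the profile is back at
      \<open>tent (pt k m)\<close>.\<close>
    have "stair_hi (pt 0 0) = 5/8"
      using stair_pt[of 0 0] stair_reflect[of "1/2"] unfolding half by simp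
    then have "gap_hi i = stair_lo (pt k m) + 5/8 / 4 ^ Suc k"
      by (simp only: k True m' gap_hi.simps)
    moreover have "gap_size i = 1/4 * (1 / 4 ^ Suc k)" by (simp add: k True)
    moreover have "5/8 / 4 ^ Suc k = 5/8 * (1 / 4 ^ Suc k :: real)" by simp
    moreover have "(0::real) < 1 / 4 ^ Suc k" by simp
    ultimately have "gap_hi i + gap_size i \<le> stair_hi (pt k m)"
      using stair_pt[of k m] by linarith
    moreover have "gap_val i = tent (pt k m)" by (simp add: k True m' half two_tents_def)
    ultimately show ?thesis
      using profile_stair(2)[OF p(1,2)] outer_free[OF p(1,2)] stair_range(4)[OF p(1,2)] by auto
  next
    case False
    define v where "v = gap_val i"
    define b where "b = two_tents (pt k' m') / 2 ^ k"
    have b: "2 / 2 ^ k' / 2 ^ k \<le> b" unfolding b_def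
      using two_tents_pt[OF m(2)] False by (intro divide_right_mono) auto
    have "b \<le> 1 / 2 ^ k" unfolding b_def using two_tents_range[OF p(3,4)] by (intro divide_right_mono) auto
    then have v: "0 \<le> v" "v \<le> 1" "v = tent (pt k m) - b"
      using tent_pt[OF m(1)] tent_range[OF p(1,2)] b order_trans[of 0 "2 / 2 ^ k' / 2 ^ k" b]
      by (auto simp: v_def b_def k)
    \<comment> \<open>The point on the descending side of the tent with height \<open>v\<close>; a
      drop by \<open>b\<close> takes at least \<open>b / 2\<close> in \<open>y\<close>, hence at
      least \<open>b / 4\<close> along the staircase.\<close>
    define y where "y = 1 - v / 2"
    have y: "0 \<le> y" "y \<le> 1" "tent y = v" using v unfolding y_def tent_def by (auto simp: abs_if)
    have py: "b \<le> 2 * (y - pt k m)" proof -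
      have "2 * (y - pt k m) = 2 - v - 2 * pt k m" by (simp add: y_def)
      then show ?thesis using v(3) unfolding tent_def by linarith
    qed
    have "0 < 2 / 2 ^ k' / (2::real) ^ k" by simp
    then have "0 < b" using b by (rule less_le_trans)
    then have "pt k m < y" using py by simp
    from stair_gap[OF this] have gap: "b \<le> 4 * (stair_lo y - stair_hi (pt k m))" using py by simp
    have "4 * gap_size i \<le> 2 / 2 ^ k' / 2 ^ k"
      using False by (simp add: k power_add field_simps)
    from order_trans[OF this b] have "stair_hi (pt k m) + gap_size i \<le> stair_lo y" using gap by simp
    moreover have "gap_hi i \<le> stair_hi (pt k m)" using gap_outer(3)[OF i[unfolded k]] k by simp
    ultimately have "gap_hi i + gap_size i \<le> stair_lo y" by linarith
    then show ?thesis
      using profile_stair(1)[OF y(1,2)] outer_free[OF y(1,2)] stair_range(2)[OF y(1,2)] y(3)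
      by (auto simp: v_def)
  qed
qed

lemma stair_near_small:
  fixes y e :: real
  assumes "0 \<le> y" "y < 1" "e > 0"
  shows "\<exists>k m. K \<le> k \<and> m < 2 ^ k \<and> y < pt k m \<and> stair_lo (pt k m) - stair_hi y \<le> 1 / 2 ^ Suc k \<and> 2 / 2 ^ k < e"
proof -
  obtain N where N: "(1/2::real) ^ N < e / 2" using real_arch_pow_inv[of "e / 2" "1/2"] assms(3) by auto
  obtain k m where k: "max K N \<le> k" "m < 2 ^ k" "y < pt k m"
    "stair_lo (pt k m) - stair_hi y \<le> 1 / 2 ^ Suc k" using stair_near[OF assms(1,2)] by blast
  have "(1/2::real) ^ k \<le> (1/2) ^ N" using k by (intro power_decreasing) auto
  then have "2 / 2 ^ k < e" using N by (simp add: power_divide)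
  then show ?thesis using k by (intro exI[of _ k] exI[of _ m]) simp
qed

lemma not_in_half_open_composite:
  assumes u: "0 \<le> u" "u < 1" and off: "\<And>j. j \<in> gaps \<Longrightarrow> \<not> (gap_lo j \<le> u \<and> u < gap_hi j)"
  obtains (outer) y where "0 \<le> y" "y < 1" "u = stair_hi y"
  | (inner) k m y where "m < 2 ^ k" "0 \<le> y" "y < 1" "u = stair_lo (pt k m) + stair_hi y / 4 ^ Suc k"
proof (cases "\<exists>k m. m < 2 ^ k \<and> stair_lo (pt k m) \<le> u \<and> u < stair_hi (pt k m)")
  case False
  then show thesis using not_in_half_open_gap[OF u] outer by metis
next
  case True
  then obtain k m where k: "m < 2 ^ k" "stair_lo (pt k m) \<le> u" "u < stair_hi (pt k m)" by blast
  obtain x where x: "0 \<le> x" "x \<le> 1" "u = stair_lo (pt k m) + x / 4 ^ Suc k"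
    using outer_gap_form[of k m u] k by auto
  have "x \<noteq> 1" using k(3) stair_pt[of k m] x(3) by auto
  then have x1: "x < 1" using x by simp
  have "\<not> (stair_lo (pt k' m') \<le> x \<and> x < stair_hi (pt k' m'))" if "m' < 2 ^ k'" for k' m'
  proof -
    have g: "(k, m, k', m') \<in> gaps" using that k by (simp add: gaps_def)
    show ?thesis using off[OF g] gap_inner[OF g, of x] x(3) by simp
  qed
  from not_in_half_open_gap[OF x(1) x1 this] obtain y where "0 \<le> y" "y < 1" "x = stair_hi y" by blast
  then show thesis using inner[OF k(1)] x(3) by blast
qed

text \<open>Left ends of outer or inner gaps are free points that accumulate at \<open>u\<close>
  from the right, and along them the profile is a Lipschitz tent of the Lipschitz staircase.\<close>

lemma gap_lipschitz:
  assumes u: "0 \<le> u" "u < 1" and off: "\<And>j. j \<in> gaps \<Longrightarrow> \<not> (gap_lo j \<le> u \<and> u < gap_hi j)"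
  shows "\<exists>C. \<forall>e>0. \<exists>s. u < s \<and> s < u + e \<and> s \<le> 1 \<and> (\<forall>i\<in>gaps. \<not> (gap_lo i < s \<and> s < gap_hi i)) \<and>
    \<bar>profile s - profile u\<bar> \<le> C * (s - u)"
proof (cases rule: not_in_half_open_composite[OF u off])
  case 1: (2 y)
  show ?thesis
  proof (rule exI[of _ 4], intro allI impI)
    fix e :: real assume e: "e > 0"
    obtain k m where k: "m < 2 ^ k" "y < pt k m" "stair_lo (pt k m) - stair_hi y \<le> 1 / 2 ^ Suc k"
      "2 / 2 ^ k < e" using stair_near_small[OF 1(1,2) e, of 0] by blast
    define s where "s = stair_lo (pt k m)"
    have p: "0 \<le> pt k m" "pt k m \<le> 1" using pt_range[OF k(1)] by auto
    have "(1::real) / 2 ^ Suc k \<le> 2 / 2 ^ k" by (simp add: field_simps)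
    then have "s < u + e" using k 1 by (simp add: s_def)
    moreover have "u < s" using stair_less[OF k(2)] 1 by (simp add: s_def)
    moreover have "\<bar>profile s - profile u\<bar> \<le> 4 * (s - u)"
      using tent_lipschitz[of "pt k m" y] stair_gap[OF k(2)] k(2) 1 profile_stair(1)[OF p]
        profile_stair(2)[of y] by (simp add: s_def)
    ultimately show "\<exists>s. u < s \<and> s < u + e \<and> s \<le> 1 \<and>
        (\<forall>i\<in>gaps. \<not> (gap_lo i < s \<and> s < gap_hi i)) \<and> \<bar>profile s - profile u\<bar> \<le> 4 * (s - u)"
      using outer_free[OF p, of s] stair_range(2)[OF p] by (auto simp: s_def)
  qed
next
  case 2: (3 k m y)
  show ?thesis
  \<comment> \<open>8 is the slope 4 of \<open>two_tents\<close> times the constant 2 of the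
    staircase; the other factors are the height and the inverse width of the outer gap.\<close>
  proof (rule exI[of _ "8 / 2 ^ k * 4 ^ Suc k"], intro allI impI)
    fix e :: real assume e: "e > 0"
    obtain l n where l: "n < 2 ^ l" "y < pt l n" "stair_lo (pt l n) - stair_hi y \<le> 1 / 2 ^ Suc l"
      "2 / 2 ^ l < e" using stair_near_small[OF 2(2,3) e, of 0] by blast
    have p: "0 \<le> pt l n" "pt l n \<le> 1" using pt_range[OF l(1)] by auto
    define x where "x = stair_lo (pt l n)"
    define s where "s = stair_lo (pt k m) + x / 4 ^ Suc k"
    have x: "0 \<le> x" "x \<le> 1" using stair_range[OF p] by (auto simp: x_def)
    have y: "0 \<le> stair_hi y" "stair_hi y \<le> 1" using stair_range[of y] 2 by auto
    have su: "s - u = (x - stair_hi y) / 4 ^ Suc k" by (simp add: s_def 2 diff_divide_distrib)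
    have xy: "0 < x - stair_hi y" using stair_less[OF l(2)] by (simp add: x_def)
    have "(1::real) / 2 ^ Suc l \<le> 2 / 2 ^ l" by (simp add: field_simps)
    then have "x - stair_hi y < e" using l by (simp add: x_def)
    moreover have "(x - stair_hi y) / 4 ^ Suc k \<le> (x - stair_hi y) / 1"
      using xy one_le_power[of "4::real" "Suc k"] by (intro divide_left_mono) auto
    ultimately have "s < u + e" using su by simp
    moreover have "0 < s - u" unfolding su using xy by simp
    then have "u < s" by simp
    moreover have "\<bar>profile s - profile u\<bar> \<le> 8 / 2 ^ k * 4 ^ Suc k * (s - u)"
    proof -
      have "profile s - profile u = (two_tents y - two_tents (pt l n)) / 2 ^ k"
        unfolding s_def 2(4) profile_gap(2)[OF 2(1) x] profile_gap(2)[OF 2(1) y]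
        using 2 p by (simp add: x_def stair_inv_lo stair_inv_hi diff_divide_distrib)
      also have "\<bar>\<dots>\<bar> = \<bar>two_tents y - two_tents (pt l n)\<bar> / 2 ^ k" by simp
      also have "\<dots> \<le> (4 * (pt l n - y)) / 2 ^ k"
        using two_tents_lipschitz[of y "pt l n"] l(2) by (intro divide_right_mono) auto
      also have "\<dots> \<le> (8 * (x - stair_hi y)) / 2 ^ k"
        using stair_gap[OF l(2)] by (intro divide_right_mono) (auto simp: x_def)
      also have "8 * D / 2 ^ k = 8 / 2 ^ k * 4 ^ Suc k * (D / 4 ^ Suc k)" for D :: real by simp
      finally have "\<bar>profile s - profile u\<bar> \<le> 8 / 2 ^ k * 4 ^ Suc k * ((x - stair_hi y) / 4 ^ Suc k)" .
      then show ?thesis unfolding su .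
    qed
    moreover have "s \<le> 1"
    proof -
      have "x / 4 ^ Suc k \<le> 1 / 4 ^ Suc k" using x by (intro divide_right_mono) auto
      then show ?thesis
        using stair_pt[of k m] stair_range(4)[of "pt k m"] pt_range[OF 2(1)] by (simp add: s_def)
    qed
    ultimately show "\<exists>s. u < s \<and> s < u + e \<and> s \<le> 1 \<and>
        (\<forall>i\<in>gaps. \<not> (gap_lo i < s \<and> s < gap_hi i)) \<and>
        \<bar>profile s - profile u\<bar> \<le> 8 / 2 ^ k * 4 ^ Suc k * (s - u)"
      using inner_free[OF 2(1) p, of x] by (intro exI[of _ s]) (auto simp: s_def x_def)
  qed
qed

text \<open>All lie in the central outer gap, where the tent is 1 and the excursion has height 1: at
  its two peaks, and, for \<open>one_gaps\<close>, in the middle.\<close>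

definition zero_gaps :: "gap_index set" where "zero_gaps = {(0, 0, 1, 0), (0, 0, 1, 1)}"
definition one_gaps :: "gap_index set" where "one_gaps = {(0, 0, 0, 0)}"

text \<open>On the outer Cantor set a fixed inner level suffices, since sizes there scale like
  \<open>1 / 2 ^ k\<close> and so do the distances. On an inner one the outer level \<open>k\<close>
  is fixed and the inner level must follow the distance.\<close>

lemma gap_near:
  assumes u: "0 \<le> u" "u < 1" and off: "\<And>j. j \<in> gaps \<Longrightarrow> \<not> (gap_lo j \<le> u \<and> u < gap_hi j)"
  shows "\<exists>C>0. \<forall>e>0. \<exists>j\<in>gaps - (zero_gaps \<union> one_gaps). gap_goal j = d \<and> u < gap_lo j \<and>
    gap_hi j < u + e \<and> gap_hi j - u \<le> C * gap_size j"
proof (cases rule: not_in_half_open_composite[OF u off])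
  case 1: (2 y)
  \<comment> \<open>Inner level above 1 avoids \<open>zero_gaps\<close> and
    \<open>one_gaps\<close>.\<close>
  obtain r where r: "r > 1" "multiplicity (2::nat) r = d" using ex_multiplicity[of 1 d] by blast
  show ?thesis
  proof (intro exI[of _ "2 ^ (r + 2)"] conjI allI impI)
    fix e :: real assume e: "e > 0"
    obtain k m where k: "m < 2 ^ k" "y < pt k m" "stair_lo (pt k m) - stair_hi y \<le> 1 / 2 ^ Suc k"
      "2 / 2 ^ k < e" using stair_near_small[OF 1(1,2) e, of 0] by blast
    let ?j = "(k, m, r, 0)"
    have j: "?j \<in> gaps" using k by (simp add: gaps_def)
    have "(1::real) / 4 ^ Suc k \<le> 1 / 2 ^ Suc k" by (intro divide_left_mono power_mono) auto
    then have hi: "gap_hi ?j - u \<le> 1 / 2 ^ Suc k + 1 / 2 ^ Suc k"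
      using gap_outer(3)[OF j] stair_pt[of k m] k(3) 1 by linarith
    moreover have "(1::real) / 2 ^ Suc k + 1 / 2 ^ Suc k = 1 / 2 ^ k" by simp
    moreover have "(1::real) / 2 ^ k \<le> 2 / 2 ^ k" by (simp add: divide_right_mono)
    moreover have "2 ^ (r + 2) * gap_size ?j = 1 / 2 ^ k" using r by (simp add: power_add)
    ultimately have "gap_hi ?j < u + e" "gap_hi ?j - u \<le> 2 ^ (r + 2) * gap_size ?j" using k(4) by linarith+
    moreover have "u < gap_lo ?j" using gap_outer(1)[OF j] stair_less[OF k(2)] 1 by linarith
    moreover have "?j \<notin> zero_gaps \<union> one_gaps" using r by (auto simp: zero_gaps_def one_gaps_def)
    ultimately show "\<exists>j\<in>gaps - (zero_gaps \<union> one_gaps). gap_goal j = d \<and> u < gap_lo j \<and>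
        gap_hi j < u + e \<and> gap_hi j - u \<le> 2 ^ (r + 2) * gap_size j"
      using j r by (intro bexI[of _ ?j]) auto
  qed simp
next
  case 2: (3 k m y)
  define W :: nat where "W = 2 ^ (d + 2)"
  show ?thesis
  proof (intro exI[of _ "2 ^ (k + W + 3)"] conjI allI impI)
    fix e :: real assume e: "e > 0"
    obtain l n where l: "1 \<le> l" "n < 2 ^ l" "y < pt l n"
      "stair_lo (pt l n) - stair_hi y \<le> 1 / 2 ^ Suc l" "2 / 2 ^ l < e"
      using stair_near_small[OF 2(2,3) e, of 1] by blast
    \<comment> \<open>The nearby gap of level \<open>l\<close> may have the wrong target; a gap of
      slightly higher level beside it has the right one, at the cost of the constant factor
      \<open>2 ^ W\<close>.\<close>
    obtain r where r: "r > l" "r \<le> l + W" "multiplicity (2::nat) r = d"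
      using ex_multiplicity[of l d] by (auto simp: W_def)
    obtain q where q: "q < 2 ^ r" "stair_hi (pt l n) \<le> stair_lo (pt r q)"
      "stair_hi (pt r q) - stair_lo (pt l n) \<le> 1 / 2 ^ l" using stair_neighbour[OF l(2) r(1)] by blast
    let ?j = "(k, m, r, q)"
    have j: "?j \<in> gaps" using q 2 by (simp add: gaps_def)
    have "(1::real) / 2 ^ Suc l \<le> 1 / 2 ^ l" "2 / 2 ^ l = 1 / 2 ^ l + 1 / (2::real) ^ l"
      by (simp_all add: field_simps)
    then have hx: "stair_hi (pt r q) - stair_hi y \<le> 2 / 2 ^ l" using q(3) l(4) by linarith
    have yq: "stair_hi y < stair_lo (pt r q)"
      using stair_less[OF l(3)] stair_lo_le_hi[of "pt l n"] q(2) by linarith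
    have pos: "0 < stair_hi (pt r q) - stair_hi y" using yq stair_pt_less[of r q] by linarith
    have "gap_hi ?j - u = (stair_hi (pt r q) - stair_hi y) / 4 ^ Suc k"
      by (simp add: 2 diff_divide_distrib)
    also have "\<dots> \<le> (stair_hi (pt r q) - stair_hi y) / 1"
      using pos one_le_power[of "4::real" "Suc k"] by (intro divide_left_mono) auto
    finally have hi: "gap_hi ?j - u \<le> 2 / 2 ^ l" using hx by simp
    have "(2::real) ^ (r + k + 2) \<le> 2 ^ (l + W + k + 2)" using r by (intro power_increasing) auto
    then have "1 / 2 ^ (l + W + k + 2) \<le> gap_size ?j"
      using r by (simp add: frac_le add.commute add.left_commute)
    then have "2 ^ (k + W + 3) * (1 / 2 ^ (l + W + k + 2)) \<le> 2 ^ (k + W + 3) * gap_size ?j"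
      by (intro mult_left_mono) auto
    moreover have "2 ^ (k + W + 3) * (1 / 2 ^ (l + W + k + 2)) = 2 / (2::real) ^ l"
      by (simp add: power_add eval_nat_numeral)
    ultimately have "gap_hi ?j - u \<le> 2 ^ (k + W + 3) * gap_size ?j" using hi by linarith
    moreover have "gap_hi ?j < u + e" using hi l(5) by linarith
    moreover have "u < gap_lo ?j" using yq by (simp add: 2 divide_strict_right_mono)
    moreover have "?j \<notin> zero_gaps \<union> one_gaps" using r l by (auto simp: zero_gaps_def one_gaps_def)
    ultimately show "\<exists>j\<in>gaps - (zero_gaps \<union> one_gaps). gap_goal j = d \<and> u < gap_lo j \<and>
        gap_hi j < u + e \<and> gap_hi j - u \<le> 2 ^ (k + W + 3) * gap_size j"
      using j r by (intro bexI[of _ ?j]) auto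
  qed simp
qed

text \<open>One constant serves all gaps: the witness lies in the next outer gap of level
  \<open>Suc k\<close>, with inner level \<open>r\<close> depending on \<open>d\<close>
  alone.\<close>

lemma gap_neighbour:
  "\<exists>C>0. \<forall>j\<in>gaps. \<exists>i\<in>gaps - (zero_gaps \<union> one_gaps). gap_goal i = d \<and> gap_hi j \<le> gap_lo i \<and>
     gap_hi i - gap_lo j \<le> C * gap_size i"
proof -
  obtain r where r: "r > 1" "multiplicity (2::nat) r = d" using ex_multiplicity[of 1 d] by blast
  show ?thesis
  proof (intro exI[of _ "2 ^ (r + 3)"] conjI ballI)
    fix j assume j: "j \<in> gaps"
    obtain k m k' m' where k: "j = (k, m, k', m')" by (cases j)
    have m: "m < 2 ^ k" using j k by (simp add: gaps_def)
    obtain n where n: "n < 2 ^ Suc k" "stair_hi (pt k m) \<le> stair_lo (pt (Suc k) n)"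
      "stair_hi (pt (Suc k) n) - stair_lo (pt k m) \<le> 1 / 2 ^ k"
      using stair_neighbour[OF m, of "Suc k"] by auto
    let ?i = "(Suc k, n, r, 0)"
    have i: "?i \<in> gaps" using n by (simp add: gaps_def)
    have "gap_hi j \<le> gap_lo ?i"
      using gap_outer(3)[OF j[unfolded k]] gap_outer(1)[OF i] n(2) unfolding k by linarith
    moreover have "gap_hi ?i - gap_lo j \<le> 1 / 2 ^ k"
      using gap_outer(1)[OF j[unfolded k]] gap_outer(3)[OF i] n(3) unfolding k by linarith
    moreover have "2 ^ (r + 3) * gap_size ?i = 1 / 2 ^ k" using r by (simp add: power_add eval_nat_numeral)
    moreover have "?i \<notin> zero_gaps \<union> one_gaps" by (simp add: zero_gaps_def one_gaps_def)
    ultimately show "\<exists>i\<in>gaps - (zero_gaps \<union> one_gaps). gap_goal i = d \<and> gap_hi j \<le> gap_lo i \<and>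
        gap_hi i - gap_lo j \<le> 2 ^ (r + 3) * gap_size i"
      using i r by (intro bexI[of _ ?i]) auto
  qed simp
qed

lemma pt_mirror: assumes "m < 2 ^ k" shows "pt k (2 ^ k - 1 - m) = 1 - pt k m"
proof -
  have "real (2 ^ k - 1 - m) = 2 ^ k - 1 - real m"
    using assms by (simp add: of_nat_diff)
  then show ?thesis by (simp add: pt_def field_simps)
qed

lemma gap_mirror:
  assumes j: "j \<in> gaps"
  shows "gap_mirror j \<in> gaps" "gap_lo (gap_mirror j) = 1 - gap_hi j" "gap_hi (gap_mirror j) = 1 - gap_lo j"
    "gap_val (gap_mirror j) = gap_val j" "gap_size (gap_mirror j) = gap_size j"
    "gap_goal (gap_mirror j) = gap_goal j"
    "gap_mirror j \<in> zero_gaps \<longleftrightarrow> j \<in> zero_gaps" "gap_mirror j \<in> one_gaps \<longleftrightarrow> j \<in> one_gaps"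
proof -
  obtain k m k' m' where k: "j = (k, m, k', m')" by (cases j)
  have m: "m < 2 ^ k" "m' < 2 ^ k'" using j k by (auto simp: gaps_def)
  have tents: "tent (1 - y) = tent y" "two_tents (1 - y) = two_tents y" for y
    unfolding tent_def two_tents_def by (auto simp: abs_if)
  have lo: "stair_lo (1 - y) = 1 - stair_hi y" and hi: "stair_hi (1 - y) = 1 - stair_lo y" for y
    using stair_reflect[of y] stair_reflect[of "1 - y"] by simp_all
  have w: "stair_hi (pt k m) = stair_lo (pt k m) + 1 / 4 ^ Suc k" using stair_pt[of k m] by linarith
  show "gap_mirror j \<in> gaps" using m by (simp add: k gaps_def)
  have pm: "pt k (2 ^ k - Suc m) = 1 - pt k m" "pt k' (2 ^ k' - Suc m') = 1 - pt k' m'"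
    using pt_mirror[OF m(1)] pt_mirror[OF m(2)] by simp_all
  show "gap_lo (gap_mirror j) = 1 - gap_hi j" "gap_hi (gap_mirror j) = 1 - gap_lo j"
    by (simp_all add: k pm lo hi w diff_divide_distrib)
  show "gap_val (gap_mirror j) = gap_val j" by (simp add: k pm tents)
  show "gap_size (gap_mirror j) = gap_size j" "gap_goal (gap_mirror j) = gap_goal j"
    by (simp_all add: k)
  have "m' = 0 \<or> m' = 1" if "k' = 1" using m that by auto
  then show "gap_mirror j \<in> zero_gaps \<longleftrightarrow> j \<in> zero_gaps" "gap_mirror j \<in> one_gaps \<longleftrightarrow> j \<in> one_gaps"
    using m by (auto simp: k zero_gaps_def one_gaps_def)
qed

lemma gap_size_finite:
  assumes "e > 0" shows "finite {j \<in> gaps. e \<le> gap_size j}"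
proof -
  obtain N where N: "(1/2::real) ^ N < e" using real_arch_pow_inv[of e "1/2"] assms by auto
  have "k + k' < N" if "e \<le> gap_size (k, m, k', m')" for k m k' m'
  proof (rule ccontr)
    assume "\<not> k + k' < N"
    then have "(1/2::real) ^ (k + k') \<le> (1/2) ^ N" by (intro power_decreasing) auto
    moreover have "gap_size (k, m, k', m') \<le> (1/2) ^ (k + k')"
    proof (cases "k' = 0")
      case True
      have "(1/4::real) ^ (k + 2) \<le> (1/2) ^ (k + 2)" by (intro power_mono) auto
      moreover have "(1/2::real) ^ (k + 2) \<le> (1/2) ^ k" by (intro power_decreasing) auto
      ultimately show ?thesis using True by (simp add: power_divide)
    next
      case False
      have "(1/2::real) ^ (k + k' + 2) \<le> (1/2) ^ (k + k')" by (intro power_decreasing) auto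
      then show ?thesis using False by (simp add: power_divide)
    qed
    ultimately show False using that N by linarith
  qed
  then have "{j \<in> gaps. e \<le> gap_size j} \<subseteq>
      (\<Union>k<N. \<Union>k'<N. {k} \<times> {..<2 ^ k} \<times> {k'} \<times> {..<2 ^ k'})"
    by (fastforce simp: gaps_def)
  then show ?thesis by (rule finite_subset) auto
qed

lemma gap_size_bounds:
  assumes j: "j \<in> gaps" shows "gap_hi j - gap_lo j \<le> gap_size j" "gap_size j \<le> 1/4"
proof -
  obtain k m k' m' where k: "j = (k, m, k', m')" by (cases j)
  have "gap_hi j - gap_lo j = (stair_hi (pt k' m') - stair_lo (pt k' m')) / 4 ^ Suc k"
    by (simp add: k diff_divide_distrib)
  also have "\<dots> = 1 / 4 ^ (k + k' + 2)" unfolding stair_pt by (simp add: power_add)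
  finally have w: "gap_hi j - gap_lo j = 1 / 4 ^ (k + k' + 2)" .
  have "(1::real) / 4 ^ (k + k' + 2) \<le> 1 / 2 ^ (k + k' + 2)"
    by (intro divide_left_mono power_mono) auto
  then show "gap_hi j - gap_lo j \<le> gap_size j" unfolding w by (simp add: k)
  have "(1::real) / 2 ^ (k + k' + 2) \<le> 1 / 2 ^ 2" "(1::real) / 4 ^ (k + 2) \<le> 1 / 4 ^ 1"
    by (intro divide_left_mono power_increasing; simp)+
  then show "gap_size j \<le> 1/4" by (simp add: k)
qed

lemma gap_profile_profile:
  "gap_profile profile gaps gap_lo gap_hi gap_val gap_size gap_goal zero_gaps one_gaps gap_mirror"
proof unfold_locales
  show "continuous_on {0..1} profile" by (rule profile_continuous)
  show "0 \<le> profile u \<and> profile u \<le> 1" if "0 \<le> u" "u \<le> 1" for u by (rule profile_range[OF that])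
  show "profile 0 = 0" using profile_stair(1)[of 0] stair_0 by (simp add: tent_def)
  show "profile (1 - u) = profile u" if "0 \<le> u" "u \<le> 1" for u by (rule profile_symmetric[OF that])
  fix j assume j: "j \<in> gaps"
  obtain k m k' m' where k: "j = (k, m, k', m')" by (cases j)
  have m: "m < 2 ^ k" "m' < 2 ^ k'" using j k by (auto simp: gaps_def)
  note o = gap_outer[OF j[unfolded k], folded k]
  show "0 < gap_lo j \<and> gap_lo j < gap_hi j \<and> gap_hi j < 1"
    using o stair_range(1,4)[of "pt k m"] pt_range[OF m(1)] by auto
  show "profile u = gap_val j" if u: "gap_lo j \<le> u" "u \<le> gap_hi j" for u
  proof -
    obtain x where x: "0 \<le> x" "x \<le> 1" "u = stair_lo (pt k m) + x / 4 ^ Suc k"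
      using outer_gap_form[of k m u] u o by auto
    have "stair_lo (pt k' m') \<le> x" "x \<le> stair_hi (pt k' m')"
      using gap_inner[OF j[unfolded k], of x] u unfolding k x(3) by auto
    then have "stair_inv x = pt k' m'" using pt_range[OF m(2)] by (intro stair_inv_eq) auto
    then show ?thesis unfolding x(3) profile_gap(2)[OF m(1) x(1,2)] by (simp add: k)
  qed
  show "gap_mirror j \<in> gaps \<and> gap_lo (gap_mirror j) = 1 - gap_hi j \<and> gap_hi (gap_mirror j) = 1 - gap_lo j \<and>
    gap_val (gap_mirror j) = gap_val j \<and> gap_size (gap_mirror j) = gap_size j \<and>
    gap_goal (gap_mirror j) = gap_goal j"
    "(gap_mirror j \<in> zero_gaps \<longleftrightarrow> j \<in> zero_gaps) \<and> (gap_mirror j \<in> one_gaps \<longleftrightarrow> j \<in> one_gaps)"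
    using gap_mirror[OF j] by auto
  show "gap_hi j - gap_lo j \<le> gap_size j \<and> gap_size j \<le> 1 / 4" using gap_size_bounds[OF j] by auto
  show "\<exists>s. gap_hi j + gap_size j \<le> s \<and> s \<le> 1 \<and> (\<forall>i\<in>gaps. \<not> (gap_lo i < s \<and> s < gap_hi i)) \<and>
      profile s = gap_val j" by (rule gap_return[OF j])
  show "i = j" if "i \<in> gaps" "gap_lo i \<le> u" "u < gap_hi i" "gap_lo j \<le> u" "u < gap_hi j" for i u
    using gap_disjoint[of i u j] that j by blast
next
  show "finite {j \<in> gaps. e \<le> gap_size j}" if "e > 0" for e by (rule gap_size_finite[OF that])
  show "zero_gaps \<subseteq> gaps" "one_gaps \<subseteq> gaps" "finite zero_gaps" "finite one_gaps"
    "zero_gaps \<noteq> {}" "one_gaps \<noteq> {}"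
    by (auto simp: zero_gaps_def one_gaps_def gaps_def)
  show "gap_val j = 0" if "j \<in> zero_gaps" for j
    using that by (auto simp: zero_gaps_def tent_def two_tents_def pt_def)
  show "gap_val j = 1" if "j \<in> one_gaps" for j
    using that by (auto simp: one_gaps_def tent_def two_tents_def pt_def)
qed (use gap_lipschitz gap_near gap_neighbour in blast)+

section \<open>Countable compact spaces\<close>

lemma finite_subfamily:
  assumes "compactin X S" "\<And>k. k \<in> I \<Longrightarrow> openin X (V k)" "S \<subseteq> (\<Union>k\<in>I. V k)"
  shows "\<exists>K\<subseteq>I. finite K \<and> S \<subseteq> (\<Union>k\<in>K. V k)"
proof -
  obtain \<F> where "finite \<F>" "\<F> \<subseteq> V ` I" "S \<subseteq> \<Union>\<F>"
    using compactinD[OF assms(1), of "V ` I"] assms(2,3) by auto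
  then show ?thesis by (metis finite_subset_image)
qed

text \<open>A Urysohn function has countable image, so it omits some value strictly between 0 and 1;
  the part below that value is clopen.\<close>

lemma clopen_separation:
  assumes X: "Hausdorff_space X" "compact_space X" "countable (topspace X)"
    and ab: "a \<in> topspace X" "b \<in> topspace X" "a \<noteq> b"
  obtains U where "openin X U" "openin X (topspace X - U)" "a \<in> U" "b \<notin> U"
proof -
  have "completely_regular_space X"
    using X compact_Hausdorff_or_regular_imp_normal_space normal_imp_completely_regular_space by blast
  moreover have "closedin X {b}" using X(1) ab(2) by (simp add: closedin_Hausdorff_singleton)
  ultimately obtain f :: "'a \<Rightarrow> real" where f: "continuous_map X (top_of_set {0..1}) f" "f a = 0" "f b = 1"
    using ab unfolding completely_regular_space_def by (metis DiffI image_subset_iff singletonD singletonI)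
  have fc: "continuous_map X euclideanreal f" using f(1) continuous_map_into_fulltopology by blast
  have "countable (f ` topspace X)" using X(3) by blast
  then have "\<not> {0<..<1} \<subseteq> f ` topspace X"
    using uncountable_open_interval[of 0 1] countable_subset by force
  then obtain r where r: "0 < r" "r < 1" "r \<notin> f ` topspace X"
    unfolding subset_iff by (metis greaterThanLessThan_iff)
  let ?U = "{x \<in> topspace X. f x \<in> {..<r}}"
  have "openin X ?U" "openin X {x \<in> topspace X. f x \<in> {r<..}}"
    by (rule openin_continuous_map_preimage[OF fc]; simp)+
  moreover have "topspace X - ?U = {x \<in> topspace X. f x \<in> {r<..}}"
    using r(3) by (force simp: not_less)
  ultimately show thesis using that[of ?U] ab f r by auto
qed

section \<open>Cells of a countable separating family of clopen sets\<close>

locale separated_sequence =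
  fixes X :: "'a topology" and x :: "nat \<Rightarrow> 'a" and U :: "nat \<Rightarrow> 'a set"
  assumes compact: "compact_space X"
    and range_x: "range x = topspace X"
    and clopen: "openin X (U k)" "openin X (topspace X - U k)"
    and separating: "a \<in> topspace X \<Longrightarrow> b \<in> topspace X \<Longrightarrow> a \<noteq> b \<Longrightarrow> \<exists>k. (a \<in> U k) \<noteq> (b \<in> U k)"
begin

definition agree :: "nat \<Rightarrow> nat \<Rightarrow> nat \<Rightarrow> bool" where
  "agree m i j \<longleftrightarrow> (\<forall>k<m. x i \<in> U k \<longleftrightarrow> x j \<in> U k)"

definition cell :: "nat \<Rightarrow> 'a \<Rightarrow> 'a set" where
  "cell m a = {b \<in> topspace X. \<forall>k<m. b \<in> U k \<longleftrightarrow> a \<in> U k}"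

lemma openin_side: "openin X {b \<in> topspace X. b \<in> U k \<longleftrightarrow> P}"
proof (cases P)
  case True
  then have "{b \<in> topspace X. b \<in> U k \<longleftrightarrow> P} = U k" using openin_subset[OF clopen(1)[of k]] by auto
  then show ?thesis using clopen(1) by simp
next
  case False
  then have "{b \<in> topspace X. b \<in> U k \<longleftrightarrow> P} = topspace X - U k" by auto
  then show ?thesis using clopen(2) by simp
qed

lemma openin_cell: "openin X (cell m a)"
proof (induction m)
  case 0
  then show ?case by (simp add: cell_def)
next
  case (Suc m)
  have "cell (Suc m) a = cell m a \<inter> {b \<in> topspace X. b \<in> U m \<longleftrightarrow> a \<in> U m}"
    by (auto simp: cell_def less_Suc_eq)
  then show ?case using Suc openin_side by auto
qed

lemma x_in: "x i \<in> topspace X"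
  using range_x by auto

lemma agree_cell: "agree m i j \<longleftrightarrow> x i \<in> cell m (x j)"
  using x_in by (simp add: agree_def cell_def)

sublocale agreement agree
proof
  fix m show "\<exists>N. \<forall>n\<ge>N. \<exists>i<n. agree m i n"
  proof -
    define g where "g n = {k. k < m \<and> x n \<in> U k}" for n
    have "finite (range g)" by (rule finite_subset[of _ "Pow {..<m}"]) (auto simp: g_def)
    then obtain I where I: "finite I" "range g = g ` I"
      using finite_subset_image[of "range g" g UNIV] by auto
    have "\<exists>i<n. agree m i n" if n: "n \<ge> Suc (Max (insert 0 I))" for n
    proof -
      obtain i where i: "i \<in> I" "g i = g n" using I(2) by (metis image_iff rangeI)
      have "i \<le> Max (insert 0 I)" using i(1) I(1) by simp
      moreover have "agree m i n" using i(2) unfolding agree_def g_def by blast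
      ultimately show ?thesis using n by (intro exI[of _ i]) auto
    qed
    then show ?thesis by blast
  qed
next
  fix f :: "nat \<Rightarrow> nat"
  show "\<exists>j. \<forall>m. infinite {n. agree m (f n) j}"
  proof (rule ccontr)
    assume "\<not> ?thesis"
    \<comment> \<open>Otherwise each listed point has a cell visited only finitely often. As the
      list exhausts the space, finitely many of these cells cover it, and only finitely many indices
      would exist.\<close>
    then obtain m where m: "\<And>j. finite {n. agree (m j) (f n) j}" by metis
    have "topspace X \<subseteq> (\<Union>j\<in>UNIV. cell (m j) (x j))"
      unfolding range_x[symmetric] using x_in by (auto simp: cell_def)
    then have "\<exists>J\<subseteq>UNIV. finite J \<and> topspace X \<subseteq> (\<Union>j\<in>J. cell (m j) (x j))"
      by (intro finite_subfamily[OF compact[unfolded compact_space_def]] openin_cell)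
    then obtain J where J: "finite J" "topspace X \<subseteq> (\<Union>j\<in>J. cell (m j) (x j))" by blast
    have "UNIV \<subseteq> (\<Union>j\<in>J. {n. agree (m j) (f n) j})"
      using J(2) x_in agree_cell by blast
    then have "finite (UNIV :: nat set)" using J(1) m by (meson finite_UN_I finite_subset)
    then show False by simp
  qed
qed (auto simp: agree_def)

text \<open>Separation and compactness of the complement of \<open>W\<close>: finitely many of the
  clopen sets already exclude it.\<close>

lemma cell_small:
  assumes W: "openin X W" "a \<in> W" shows "\<exists>m. cell m a \<subseteq> W"
proof -
  have a: "a \<in> topspace X" using openin_subset[OF W(1)] W(2) by blast
  have "compactin X (topspace X - W)"
    using compact W(1) by (simp add: closedin_compact_space closedin_def Diff_Diff_Int openin_subset Int_absorb1)
  moreover have "topspace X - W \<subseteq> (\<Union>k. {b \<in> topspace X. b \<in> U k \<longleftrightarrow> \<not> a \<in> U k})"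
    using separating[OF a] W(2) by blast
  ultimately have "\<exists>K\<subseteq>UNIV. finite K \<and>
      topspace X - W \<subseteq> (\<Union>k\<in>K. {b \<in> topspace X. b \<in> U k \<longleftrightarrow> \<not> a \<in> U k})"
    using openin_side by (intro finite_subfamily)
  then obtain K where K: "finite K"
    "topspace X - W \<subseteq> (\<Union>k\<in>K. {b \<in> topspace X. b \<in> U k \<longleftrightarrow> \<not> a \<in> U k})" by blast
  obtain m where m: "\<forall>k\<in>K. k < m" using K(1) unfolding finite_nat_set_iff_bounded by blast
  have "cell m a \<subseteq> W"
  proof
    fix b assume b: "b \<in> cell m a"
    then have "b \<in> topspace X" "\<And>k. k \<in> K \<Longrightarrow> b \<in> U k \<longleftrightarrow> a \<in> U k" using m by (auto simp: cell_def)
    then show "b \<in> W" using K(2) by blast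
  qed
  then show ?thesis ..
qed

text \<open>The usual proof of uniform continuity, with cells in place of balls.\<close>

lemma continuous_uniform_on_cells:
  fixes f :: "'a \<Rightarrow> real"
  assumes f: "continuous_map X euclideanreal f" and e: "e > 0"
  shows "\<exists>m. \<forall>i j. agree m i j \<longrightarrow> \<bar>f (x i) - f (x j)\<bar> \<le> e"
proof -
  have "\<exists>m. \<forall>b\<in>cell m a. \<bar>f b - f a\<bar> < e / 2" if a: "a \<in> topspace X" for a
  proof -
    have "openin X {b \<in> topspace X. f b \<in> ball (f a) (e / 2)}"
      by (rule openin_continuous_map_preimage[OF f]) simp
    then obtain m where "cell m a \<subseteq> {b \<in> topspace X. f b \<in> ball (f a) (e / 2)}"
      using cell_small[of _ a] a e by force
    then show ?thesis by (intro exI[of _ m]) (force simp: dist_real_def abs_minus_commute)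
  qed
  then obtain m where m: "\<And>a b. a \<in> topspace X \<Longrightarrow> b \<in> cell (m a) a \<Longrightarrow> \<bar>f b - f a\<bar> < e / 2" by metis
  have "topspace X \<subseteq> (\<Union>a\<in>topspace X. cell (m a) a)" by (auto simp: cell_def)
  then have "\<exists>A\<subseteq>topspace X. finite A \<and> topspace X \<subseteq> (\<Union>a\<in>A. cell (m a) a)"
    by (intro finite_subfamily[OF compact[unfolded compact_space_def]] openin_cell)
  then obtain A where A: "finite A" "A \<subseteq> topspace X" "topspace X \<subseteq> (\<Union>a\<in>A. cell (m a) a)" by blast
  \<comment> \<open>Agreement at the largest of the finitely many stages puts both points into the
    same cell around some \<open>a\<close>.\<close>
  define M where "M = Max (insert 0 (m ` A))"
  have "\<bar>f (x i) - f (x j)\<bar> \<le> e" if ij: "agree M i j" for i j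
  proof -
    obtain a where a: "a \<in> A" "x j \<in> cell (m a) a" using A(3) x_in by blast
    have "m a \<le> M" using A(1) a(1) by (simp add: M_def)
    then have "x i \<in> cell (m a) a" using ij a(2) x_in by (auto simp: agree_def cell_def)
    then have "\<bar>f (x i) - f a\<bar> < e / 2" "\<bar>f (x j) - f a\<bar> < e / 2"
      using m[of a "x i"] m[of a "x j"] a A(2) by auto
    then show ?thesis by linarith
  qed
  then show ?thesis by blast
qed

end

lemma cont_fun_space_bounded:
  assumes "compact_space X" "f \<in> cont_fun_space X"
  shows "bdd_above (insert 0 ((\<lambda>x. \<bar>f x\<bar>) ` topspace X))"
    and "a \<in> topspace X \<Longrightarrow> \<bar>f a\<bar> \<le> sup_norm X f"
proof -
  have "compactin euclideanreal (f ` topspace X)"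
    using assms by (intro image_compactin) (auto simp: cont_fun_space_def compact_space_def)
  then have "bounded (f ` topspace X)" by (simp add: compact_imp_bounded)
  then show bdd: "bdd_above (insert 0 ((\<lambda>x. \<bar>f x\<bar>) ` topspace X))"
    unfolding bdd_above_insert by (auto simp: bounded_iff bdd_above_def)
  show "\<bar>f a\<bar> \<le> sup_norm X f" if "a \<in> topspace X"
    unfolding sup_norm_def by (rule cSup_upper[OF _ bdd]) (use that in blast)
qed

lemma cont_fun_space_linear:
  assumes "f \<in> cont_fun_space X" "g \<in> cont_fun_space X"
  shows "a *\<^sub>R f + b *\<^sub>R g \<in> cont_fun_space X"
  using assms unfolding cont_fun_space_def
  by (auto simp: plus_fun_def scaleR_fun_def intro!: continuous_map_add continuous_map_real_mult_left)

theorem theorem1p1: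
  fixes X :: "'a topology"
  assumes "Hausdorff_space X" and "compact_space X" and "countable (topspace X)"
  shows "\<exists>Y. Y \<subseteq> cont_fun_space unit_interval \<and> subspace Y \<and>
             linearly_isometric X (cont_fun_space X) unit_interval Y \<and>
             (\<forall>f\<in>Y. f \<noteq> 0 \<longrightarrow> besicovitch_function 0 1 f)"
proof (cases "topspace X = {}")
  case True
  \<comment> \<open>On the empty space only the zero function remains, and the subspace consisting
    of 0 does.\<close>
  have C: "cont_fun_space X = {0}"
    using True by (auto simp: cont_fun_space_def fun_eq_iff zero_fun_def continuous_map_def Pi_def
        openin_topspace_empty)
  have "linear_isometry_between X {0} unit_interval {0} (\<lambda>f. 0)"
    by (auto simp: linear_isometry_between_def bij_betw_def sup_norm_def zero_fun_def scaleR_fun_def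
        image_constant_conv)
  moreover have "0 \<in> cont_fun_space unit_interval"
    by (simp add: cont_fun_space_def zero_fun_def)
  ultimately show ?thesis
    by (intro exI[of _ "{0}"]) (auto simp: C linearly_isometric_def)
next
  case False
  \<comment> \<open>Repetitions are allowed, so finite spaces are covered too.\<close>
  obtain x :: "nat \<Rightarrow> 'a" where x: "range x = topspace X"
    using range_from_nat_into[OF False assms(3)] by blast
  have x_in: "x p \<in> topspace X" for p using x by auto
  have "\<exists>V. openin X V \<and> openin X (topspace X - V) \<and> (x p \<noteq> x q \<longrightarrow> x p \<in> V \<and> x q \<notin> V)" for p q
  proof (cases "x p = x q")
    case True
    then show ?thesis by (intro exI[of _ "{}"]) simp
  next
    case False
    then show ?thesis using clopen_separation[OF assms x_in x_in False] by blast
  qed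
  then obtain S where S: "\<And>p q. openin X (S p q)" "\<And>p q. openin X (topspace X - S p q)"
    "\<And>p q. x p \<noteq> x q \<Longrightarrow> x p \<in> S p q \<and> x q \<notin> S p q" by metis
  define U where "U k = case_prod S (prod_decode k)" for k
  interpret separated_sequence X x U
  proof
    show "openin X (U k)" "openin X (topspace X - U k)" for k
      using S(1,2) by (simp_all add: U_def split: prod.splits)
    fix a b assume ab: "a \<in> topspace X" "b \<in> topspace X" "a \<noteq> b"
    then obtain p q where "a = x p" "b = x q" using x by (metis rangeE)
    then show "\<exists>k. (a \<in> U k) \<noteq> (b \<in> U k)"
      using S(3)[of p q] ab(3) by (intro exI[of _ "prod_encode (p, q)"]) (simp add: U_def)
  qed (use assms x in auto)
  interpret gap_embedding profile gaps gap_lo gap_hi gap_val gap_size gap_goal zero_gaps one_gaps gap_mirror agree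
    by (intro gap_embedding.intro gap_profile_profile agreement_axioms)
  let ?C = "cont_fun_space X"
  \<comment> \<open>The value 0 outside the unit interval matches the convention of
    \<open>cont_fun_space\<close>.\<close>
  define T where "T f u = (if 0 \<le> u \<and> u \<le> 1 then curve (\<lambda>i. f (x i)) root (f (x 0)) u else 0)"
    for f :: "'a \<Rightarrow> real" and u :: real
  have adm: "admissible (\<lambda>i. f (x i))" if "f \<in> ?C" for f
    using that continuous_uniform_on_cells by (simp add: admissible_def cont_fun_space_def)
  have bnd: "\<bar>f (x i)\<bar> \<le> sup_norm X f" if "f \<in> ?C" for f i
    by (rule cont_fun_space_bounded(2)[OF assms(2) that x_in])
  have snd: "sound (\<lambda>i. f (x i)) (sup_norm X f) root (f (x 0))" if "f \<in> ?C" for f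
    by (rule sound_root) (rule bnd[OF that])
  have T_lin: "T (a *\<^sub>R f + b *\<^sub>R g) = a *\<^sub>R T f + b *\<^sub>R T g" if "f \<in> ?C" "g \<in> ?C" for a b f g
  proof
    fix u
    show "T (a *\<^sub>R f + b *\<^sub>R g) u = (a *\<^sub>R T f + b *\<^sub>R T g) u"
      using curve_linear[OF adm[OF that(1)] snd[OF that(1)] adm[OF that(2)] snd[OF that(2)], of u a b]
      by (simp add: T_def plus_fun_def scaleR_fun_def)
  qed
  have T_bound: "\<bar>T f u\<bar> \<le> sup_norm X f" if "f \<in> ?C" "0 \<le> u" "u \<le> 1" for f u
    using curve_bound[OF adm[OF that(1)] snd[OF that(1)] that(2,3)] that by (simp add: T_def)
  have T_attains: "\<exists>u. 0 \<le> u \<and> u \<le> 1 \<and> T f u = f a" if f: "f \<in> ?C" and a: "a \<in> topspace X" for f a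
  proof -
    obtain k where "a = x k" using a x by auto
    then show ?thesis
      using curve_attains[OF adm[OF f] bnd[OF f], of k] by (auto simp: T_def)
  qed
  have T_C: "T f \<in> cont_fun_space unit_interval" if "f \<in> ?C" for f
  proof -
    have "continuous_on {0..1} (T f)"
      using curve_continuous[OF adm[OF that] snd[OF that]]
      by (rule continuous_on_eq) (simp add: T_def)
    then show ?thesis by (auto simp: cont_fun_space_def T_def)
  qed
  have T_norm: "sup_norm unit_interval (T f) = sup_norm X f" if f: "f \<in> ?C" for f
  proof (rule antisym)
    have "0 \<le> sup_norm X f" using bnd[OF f, of 0] by linarith
    then show "sup_norm unit_interval (T f) \<le> sup_norm X f"
      using T_bound[OF f] unfolding sup_norm_def[of unit_interval] by (intro cSup_least) auto
    have upper: "\<bar>T f u\<bar> \<le> sup_norm unit_interval (T f)" if "0 \<le> u" "u \<le> 1" for u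
      using cont_fun_space_bounded(2)[OF _ T_C[OF f], of u] that by (simp add: compact_space_subtopology)
    then have "0 \<le> sup_norm unit_interval (T f)" using abs_ge_zero order_trans by (metis zero_le_one order_refl)
    then show "sup_norm X f \<le> sup_norm unit_interval (T f)"
      unfolding sup_norm_def[of X] using upper T_attains[OF f] by (intro cSup_least) force+
  qed
  have T_inj: "f = g" if fg: "f \<in> ?C" "g \<in> ?C" "T f = T g" for f g
  proof
    fix a
    \<comment> \<open>Every value of the difference is attained by its image, which
      vanishes.\<close>
    let ?d = "1 *\<^sub>R f + (- 1) *\<^sub>R g"
    have d: "?d \<in> ?C" by (rule cont_fun_space_linear[OF fg(1,2)])
    have "T ?d = 0" unfolding T_lin[OF fg(1,2)] fg(3) by simp
    then have "?d a = 0" if "a \<in> topspace X" using T_attains[OF d that] by (auto simp: zero_fun_def)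
    then show "f a = g a"
      using fg(1,2) by (cases "a \<in> topspace X") (auto simp: cont_fun_space_def plus_fun_def scaleR_fun_def)
  qed
  have C0: "0 \<in> ?C" by (simp add: cont_fun_space_def zero_fun_def)
  have T_add: "T (f + g) = T f + T g" and add_C: "f + g \<in> ?C" if "f \<in> ?C" "g \<in> ?C" for f g
    using T_lin[OF that, of 1 1] cont_fun_space_linear[OF that, of 1 1] by simp_all
  have T_scale: "T (c *\<^sub>R f) = c *\<^sub>R T f" and scale_C: "c *\<^sub>R f \<in> ?C" if "f \<in> ?C" for c f
    using T_lin[OF that that, of c 0] cont_fun_space_linear[OF that that, of c 0] by simp_all
  have T_0: "T 0 = 0" using T_scale[OF C0, of 0] by simp
  have "subspace (T ` ?C)"
    unfolding subspace_def
  proof (intro conjI ballI allI)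
    show "0 \<in> T ` ?C" using T_0 C0 by (intro image_eqI[of 0 T 0]) simp_all
  next
    fix p q assume "p \<in> T ` ?C" "q \<in> T ` ?C"
    then obtain f g where fg: "p = T f" "f \<in> ?C" "q = T g" "g \<in> ?C" by blast
    show "p + q \<in> T ` ?C"
      unfolding fg T_add[OF fg(2,4), symmetric] by (rule imageI[OF add_C[OF fg(2,4)]])
  next
    fix c p assume "p \<in> T ` ?C"
    then obtain f where f: "p = T f" "f \<in> ?C" by blast
    show "c *\<^sub>R p \<in> T ` ?C"
      unfolding f T_scale[OF f(2), symmetric] by (rule imageI[OF scale_C[OF f(2)]])
  qed
  moreover have "linearly_isometric X ?C unit_interval (T ` ?C)"
    unfolding linearly_isometric_def linear_isometry_between_def
  proof (rule exI[of _ T], intro conjI ballI allI)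
    show "bij_betw T ?C (T ` ?C)" using T_inj by (intro inj_on_imp_bij_betw inj_onI)
  qed (fact T_add T_scale T_norm)+
  moreover have "besicovitch_function 0 1 (T f)" if f: "f \<in> ?C" and "T f \<noteq> 0" for f
  proof -
    have "f \<noteq> 0" using that T_0 by auto
    then obtain a where a: "f a \<noteq> 0" by (auto simp: fun_eq_iff zero_fun_def)
    then have "a \<in> range x" using f unfolding x by (auto simp: cont_fun_space_def)
    then obtain k where k: "f (x k) \<noteq> 0" using a by auto
    have F: "T f u = curve (\<lambda>i. f (x i)) root (f (x 0)) u" if "0 \<le> u" "u \<le> 1" for u
      using that by (simp add: T_def)
    have "continuous_on {0..1} (T f)" using T_C[OF f] by (simp add: cont_fun_space_def)
    then show ?thesis
      unfolding besicovitch_function_def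
      using curve_no_left_derivative[OF adm[OF f] bnd[OF f] k _ _ F]
        curve_no_right_derivative[OF adm[OF f] bnd[OF f] k _ _ F]
      by auto
  qed
  ultimately show ?thesis using T_C by (intro exI[of _ "T ` ?C"]) auto
qed

end
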